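(* Let $\Omega\subset\mathbb{R}^2$ be the unit disk centered at $0$, and let $d>2$ be fixed. For small $\varepsilon>0$ let $\partial\Omega_i\subset\partial\Omega$, $i=1,2$, be the arcs parameterized by $x(t)=(\cos t,\sin t)$, $t\in(s_i-\varepsilon,s_i+\varepsilon)$, with $|s_1-s_2|=d\varepsilon$. Let $\partial\Omega_a=\partial\Omega_1\cup\partial\Omega_2$, $\partial\Omega_r=\partial\Omega\setminus\overline{\partial\Omega_a}$, and let $u$ be the solution of $$\Delta u=-1\ \text{in }\Omega,\qquad u=0\ \text{on }\partial\Omega_a,\qquad \frac{\partial u}{\partial\nu}=0\ \text{on }\partial\Omega_r .$$ Then, as $\varepsilon\to0$, $$u(x)=\ln\frac1\varepsilon-\frac{1}{2\alpha(d)}+\frac14(1-|x|^2)+\frac12\ln|x-x(s_1)|+\frac12\ln|x-x(s_2)|+O(\varepsilon),$$ where $O(\varepsilon)$ is uniform in $x\in\Omega$ satisfying $\mathrm{dist}(x,\partial\Omega_1\cup\partial\Omega_2)\ge c$ for some $c>0$, and $\alpha(d)$ is the constant defined in the context.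
   Context: $\nu$ denotes the outward unit normal on $\partial\Omega$. Let $\mathbf{X}_1$ be the Hilbert space of functions $\varphi$ on $(-1,1)$ with $\|\varphi\|_{\mathbf{X}_1}=\big(\int_{-1}^1\sqrt{1-x^2}\,|\varphi(x)|^2dx\big)^{1/2}<\infty$, and $\mathbf{Y}_1=\{\psi\in\mathcal{C}^0([-1,1]):\psi'\in\mathbf{X}_1\}$ (distributional derivative) with norm $(\|\psi\|_{\mathbf{X}_1}^2+\|\psi'\|_{\mathbf{X}_1}^2)^{1/2}$. Define $$\mathcal{L}[\varphi](s)=\int_{-1}^1\ln|s-t|\,\varphi(t)\,dt,\quad \mathcal{L}_1[\varphi](s)=\int_{-1}^1\ln|d+s-t|\,\varphi(t)\,dt,\quad \mathcal{L}_2[\varphi](s)=\int_{-1}^1\ln|d-s+t|\,\varphi(t)\,dt,$$ $$\mathcal{A}=\begin{pmatrix}\mathcal{L}&\mathcal{L}_2\\ \mathcal{L}_1&\mathcal{L}\end{pmatrix}:\mathbf{X}_1\times\mathbf{X}_1\to\mathbf{Y}_1\times\mathbf{Y}_1 .$$ The operator $\mathcal{A}$ is invertible (known). Put $$\begin{pmatrix}\alpha_1\\ \alpha_2\end{pmatrix}=\int_{-1}^1\mathcal{A}^{-1}\begin{pmatrix}1\\1\end{pmatrix}(t)\,dt .$$ By symmetry $\alpha_1=\alpha_2$, and $\alpha(d)$ denotes this common value. *)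

theory Defs
  imports "HOL-Analysis.Analysis"
begin

section \<open>The logarithmic operators and the constant \<open>\<alpha>(d)\<close>\<close>

text \<open>Elements of \<open>X1\<close> are functions rather than classes of functions modulo equality
  almost everywhere; values outside \<open>(-1,1)\<close> are irrelevant.\<close>

definition X1 :: "(real \<Rightarrow> real) set" where
  "X1 = {\<phi>. \<phi> \<in> borel_measurable (lebesgue_on {-1<..<1}) \<and>
             integrable (lebesgue_on {-1<..<1}) (\<lambda>x. sqrt (1 - x\<^sup>2) * \<bar>\<phi> x\<bar>\<^sup>2)}"

text \<open>In \<open>op_L\<close>, the convention \<open>ln 0 = 0\<close> only affects the single point \<open>t = s\<close>.\<close>

definition op_L :: "(real \<Rightarrow> real) \<Rightarrow> real \<Rightarrow> real" where
  "op_L \<phi> s = (\<integral>t. ln \<bar>s - t\<bar> * \<phi> t \<partial>lebesgue_on {-1<..<1})"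

definition op_L1 :: "real \<Rightarrow> (real \<Rightarrow> real) \<Rightarrow> real \<Rightarrow> real" where
  "op_L1 d \<phi> s = (\<integral>t. ln \<bar>d + s - t\<bar> * \<phi> t \<partial>lebesgue_on {-1<..<1})"

definition op_L2 :: "real \<Rightarrow> (real \<Rightarrow> real) \<Rightarrow> real \<Rightarrow> real" where
  "op_L2 d \<phi> s = (\<integral>t. ln \<bar>d - s + t\<bar> * \<phi> t \<partial>lebesgue_on {-1<..<1})"

text \<open>The values of \<open>op_A\<close> are pairs of functions on \<open>[-1,1]\<close>, encoded as restrictions, so that
  equality of values is equality on all of \<open>[-1,1]\<close> (they are continuous there).\<close>

definition op_A :: "real \<Rightarrow> (real \<Rightarrow> real) \<times> (real \<Rightarrow> real) \<Rightarrow> (real \<Rightarrow> real) \<times> (real \<Rightarrow> real)" where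
  "op_A d = (\<lambda>(\<phi>\<^sub>1, \<phi>\<^sub>2).
     (\<lambda>s\<in>{-1..1}. op_L \<phi>\<^sub>1 s + op_L2 d \<phi>\<^sub>2 s,
      \<lambda>s\<in>{-1..1}. op_L1 d \<phi>\<^sub>1 s + op_L \<phi>\<^sub>2 s))"

text \<open>\<open>inv_into\<close> selects a representative of the preimage. For \<open>d > 2\<close> the operator is injective
  modulo equality almost everywhere, so the integrals in \<open>alpha_vec\<close> do not depend on the choice.\<close>

definition op_A_inv :: "real \<Rightarrow> (real \<Rightarrow> real) \<times> (real \<Rightarrow> real) \<Rightarrow> (real \<Rightarrow> real) \<times> (real \<Rightarrow> real)" where
  "op_A_inv d = inv_into (X1 \<times> X1) (op_A d)"

definition alpha_vec :: "real \<Rightarrow> real \<times> real" where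
  "alpha_vec d =
     (let (\<phi>\<^sub>1, \<phi>\<^sub>2) = op_A_inv d (\<lambda>s\<in>{-1..1}. 1, \<lambda>s\<in>{-1..1}. 1)
      in (\<integral>t. \<phi>\<^sub>1 t \<partial>lebesgue_on {-1<..<1}, \<integral>t. \<phi>\<^sub>2 t \<partial>lebesgue_on {-1<..<1}))"

definition alpha :: "real \<Rightarrow> real" where
  "alpha d = (THE a. alpha_vec d = (a, a))"

section \<open>The mixed boundary value problem on the unit disk\<close>

definition partial_deriv :: "'n::finite \<Rightarrow> (real^'n \<Rightarrow> real) \<Rightarrow> real^'n \<Rightarrow> real" where
  "partial_deriv i f x = frechet_derivative f (at x) (axis i 1)"

definition laplacian :: "(real^'n::finite \<Rightarrow> real) \<Rightarrow> real^'n \<Rightarrow> real" where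
  "laplacian f x = (\<Sum>i\<in>UNIV. partial_deriv i (partial_deriv i f) x)"

text \<open>Twice continuously differentiable; meant for open \<open>S\<close>.\<close>

definition C2_on :: "(real^'n::finite) set \<Rightarrow> (real^'n \<Rightarrow> real) \<Rightarrow> bool" where
  "C2_on S f \<longleftrightarrow> f differentiable_on S \<and>
     (\<forall>i. partial_deriv i f differentiable_on S \<and>
          (\<forall>j. continuous_on S (partial_deriv j (partial_deriv i f))))"

definition circle_pt :: "real \<Rightarrow> real^2" where
  "circle_pt t = vector [cos t, sin t]"

definition boundary_arc :: "real \<Rightarrow> real \<Rightarrow> (real^2) set" where
  "boundary_arc s \<epsilon> = circle_pt ` {s - \<epsilon><..<s + \<epsilon>}"

text \<open>The normal derivative of a function on the closed unit disk is the one-sided derivative,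
  taken from inside, in the direction of the outward unit normal, which at a point \<open>x\<close> of
  the unit circle is \<open>x\<close> itself.\<close>

definition has_normal_derivative :: "(real^2 \<Rightarrow> real) \<Rightarrow> real \<Rightarrow> real^2 \<Rightarrow> bool" where
  "has_normal_derivative u D x \<longleftrightarrow> ((\<lambda>t. u (x + t *\<^sub>R x)) has_real_derivative D) (at_left 0)"

text \<open>Classical solutions. Continuity on the closed disk, including the end points of the
  absorbing part \<open>\<Gamma>\<close>, excludes the singular solutions of the homogeneous problem and makes
  the solution unique.\<close>

definition mixed_bvp_solution :: "(real^2) set \<Rightarrow> (real^2 \<Rightarrow> real) \<Rightarrow> bool" where
  "mixed_bvp_solution \<Gamma> u \<longleftrightarrow>
     C2_on (ball 0 1) u \<and> continuous_on (cball 0 1) u \<and>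
     (\<forall>x\<in>ball 0 1. laplacian u x = -1) \<and>
     (\<forall>x\<in>\<Gamma>. u x = 0) \<and>
     (\<forall>x\<in>sphere 0 1 - closure \<Gamma>. has_normal_derivative u 0 x)"

end

theory Submission
  imports Defs "HOL-Complex_Analysis.Cauchy_Integral_Formula"
begin

text \<open>Both sides of the expansion are explicit. On the interval side, \<open>x \<mapsto> x\<^sup>2\<close> folds two
  symmetric intervals into one, so their equilibrium density is algebraic and its potential reduces to
  \<open>\<integral>\<^sub>0\<^sup>\<pi> ln \<bar>cos \<phi> - cos \<theta>\<bar> d\<phi> = - \<pi> ln 2\<close>; this gives \<open>\<alpha>(d) = 1 / ln (d / 2)\<close>. That the
  masses do not depend on the chosen preimage follows from the symmetry of the logarithmic kernel and
  its definiteness on densities of total mass zero.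

  On the disk, rotate the arcs to be centred at \<open>\<plusminus>\<theta>\<close>. The Joukowski map \<open>z \<mapsto> (z + 1/z) / 2\<close> sends them
  to one interval with midpoint \<open>m\<close> and half length \<open>r = sin \<theta> sin \<epsilon>\<close>, and pulling back the Green
  function of that interval shows that \<open>u\<close> equals \<open>(1 - \<bar>x\<bar>\<^sup>2) / 4 + ln (\<bar>P + R\<bar> / r) / 2\<close> with
  \<open>P = (z\<^sup>2 - 2 m z + 1) / 2\<close> and \<open>R\<^sup>2 = P\<^sup>2 - r\<^sup>2 z\<^sup>2\<close>. As \<open>\<epsilon> \<rightarrow> 0\<close>, \<open>P + R\<close> tends to
  \<open>(z - e\<^sup>i\<^sup>\<theta>) (z - e\<^sup>-\<^sup>i\<^sup>\<theta>)\<close> and \<open>r\<close> is asymptotic to \<open>d \<epsilon>\<^sup>2 / 2\<close>.\<close>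

section \<open>Logarithmic integrals\<close>

text \<open>The two sides meet in one number. The set \<open>a < |x| < b\<close> has logarithmic
  capacity sqrt ((b^2 - a^2) / 4) = sqrt (d / 2), so a density with equilibrium potential 1 and mass
  m on each interval satisfies 2 m ln (sqrt (d / 2)) = 1; on the disk the same ln (d / 2) comes out
  of \<open>r\<close>. Three obstacles shape the rest. \<open>alpha\<close> goes through
  \<open>inv_into\<close>, which returns an arbitrary preimage known only to lie in a weighted L^2
  space, so its logarithmic energy must first be shown to exist; this is why an L^p class of Borel
  densities appears. The capacity exceeds 1, so the energy has no fixed sign on densities of nonzero
  mass; equality of the total masses is therefore obtained beforehand, from symmetry of the kernel
  alone. Finally, \<open>u\<close> is any classical solution, with no control of derivatives at the
  arc end points, so the formula is reached through uniqueness, by a maximum principle that never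
  evaluates a derivative there.\<close>

lemma abs_ln_power_le:
  fixes x :: real
  assumes "0 < x" "x \<le> 1"
  shows "\<bar>ln x\<bar> ^ n \<le> (2 * (real n + 1)) ^ n * x powr (-1/2)"
proof -
  \<comment> \<open>Chosen so that \<open>a * n < 1/2\<close>: the \<open>n\<close>-th power of
    \<open>x powr (- a)\<close> then stays below the single integrable singularity
    \<open>x powr (-1/2)\<close>, whatever \<open>n\<close> is.\<close>
  define a where "a = 1 / (2 * (real n + 1))"
  have a: "a > 0" by (simp add: a_def)
  have "ln (1 / x) \<le> (1 / x) powr a / a"
    using assms a by (intro ln_powr_bound) auto
  also have "(1 / x) powr a = x powr (- a)"
    using assms by (simp add: powr_divide powr_minus_divide)
  finally have 1: "\<bar>ln x\<bar> \<le> x powr (- a) / a"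
    using assms a by (auto simp: ln_div abs_if)
  have "\<bar>ln x\<bar> ^ n \<le> (x powr (- a) / a) ^ n"
    by (rule power_mono[OF 1]) simp
  also have "\<dots> = (2 * (real n + 1)) ^ n * x powr (- a * n)"
    using assms by (simp add: a_def power_mult_distrib power_divide powr_power)
  also have "x powr (- a * n) \<le> x powr (-1/2)"
  proof (rule powr_mono')
    show "- 1 / 2 \<le> - a * real n" by (simp add: a_def field_simps)
  qed (use assms in auto)
  finally show ?thesis by (simp add: mult_left_mono)
qed

lemma absolutely_integrable_ln_power:
  fixes c :: real
  shows "(\<lambda>x. ln \<bar>x\<bar> ^ n) absolutely_integrable_on {-c..c}"
proof -
  define K where "K = (2 * (real n + 1)) ^ n"
  \<comment> \<open>The first summand handles \<open>0 < |x| \<le> 1\<close>, the constant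
    everything else, including \<open>x = 0\<close>, where \<open>ln 0 = 0\<close>.\<close>
  define g where "g = (\<lambda>x::real. K * \<bar>x\<bar> powr (-1/2) + \<bar>ln (max 1 c)\<bar> ^ n)"
  have "(\<lambda>x. \<bar>x\<bar> powr (-1/2)) integrable_on {0..c}" for c :: real
  proof (cases "c \<ge> 0")
    case True
    have "(\<lambda>x. x powr (-1/2)) integrable_on {0..c}"
      by (rule integrable_on_powr_from_0) (use True in auto)
    then show ?thesis by (rule integrable_eq) auto
  qed auto
  moreover have "(\<lambda>x. \<bar>x\<bar> powr (-1/2)) integrable_on {-c..0}" for c :: real
    using calculation[of c] Henstock_Kurzweil_Integration.integrable_reflect_real
      [where f="\<lambda>x. \<bar>x\<bar> powr (-1/2)" and a=0 and b=c] by simp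
  ultimately have "(\<lambda>x. \<bar>x\<bar> powr (-1/2)) integrable_on {-c..c}"
    by (cases "c \<ge> 0") (auto intro: Henstock_Kurzweil_Integration.integrable_combine[where c=0])
  then have g: "g integrable_on {-c..c}"
    unfolding g_def by (intro integrable_add integrable_on_mult_right) auto
  have m: "(\<lambda>x::real. ln \<bar>x\<bar> ^ n) \<in> borel_measurable (lebesgue_on {-c..c})"
    by (intro measurable_restrict_space1 measurable_completion) measurable
  show ?thesis
  proof (rule measurable_bounded_by_integrable_imp_absolutely_integrable[OF m _ g])
    fix x :: real assume x: "x \<in> {-c..c}"
    have K: "K \<ge> 0" by (simp add: K_def)
    show "norm (ln \<bar>x\<bar> ^ n) \<le> g x"
    proof (cases "0 < \<bar>x\<bar> \<and> \<bar>x\<bar> \<le> 1")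
      case True
      then show ?thesis using abs_ln_power_le[of "\<bar>x\<bar>" n]
        by (auto simp: g_def K_def power_abs intro: order_trans)
    next
      case False
      then have "\<bar>ln \<bar>x\<bar>\<bar> \<le> \<bar>ln (max 1 c)\<bar>" using x by auto
      then have "\<bar>ln \<bar>x\<bar>\<bar> ^ n \<le> \<bar>ln (max 1 c)\<bar> ^ n" by (rule power_mono) auto
      then show ?thesis using K by (simp add: g_def power_abs add_increasing)
    qed
  qed auto
qed

text \<open>The difference \<open>sin y - y * cos y\<close> vanishes at 0 and has derivative
  \<open>y * sin y\<close>.\<close>

lemma mult_cos_le_sin:
  fixes y :: real
  assumes "0 \<le> y" "y \<le> pi"
  shows "y * cos y \<le> sin y"
proof -
  have "(\<lambda>y. sin y - y * cos y) 0 \<le> (\<lambda>y. sin y - y * cos y) y"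
  proof (rule DERIV_nonneg_imp_nondecreasing[OF assms(1)])
    fix x assume "0 \<le> x" "x \<le> y"
    then show "\<exists>z. ((\<lambda>y. sin y - y * cos y) has_real_derivative z) (at x) \<and> 0 \<le> z"
      using assms by (intro exI[of _ "x * sin x"] conjI) 
        (auto intro!: derivative_eq_intros mult_nonneg_nonneg sin_ge_zero)
  qed
  then show ?thesis by simp
qed

text \<open>A crude Jordan inequality from the half-angle formulas; it serves to dominate
  \<open>ln |sin x|\<close> by \<open>|ln |x||\<close> plus a constant.\<close>

lemma half_abs_le_abs_sin:
  fixes x :: real
  assumes "\<bar>x\<bar> \<le> pi / 2"
  shows "\<bar>x\<bar> / 2 \<le> \<bar>sin x\<bar>"
proof -
  have *: "x / 2 \<le> sin x" if "0 \<le> x" "x \<le> pi / 2" for x :: real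
  proof -
    have c: "0 \<le> cos x" using that by (intro cos_ge_zero) auto
    have c2: "0 \<le> cos (x/2)" using that by (intro cos_ge_zero) auto
    have "x / 2 \<le> x * ((1 + cos x) / 2)" using that c by (simp add: algebra_simps)
    also have "(1 + cos x) / 2 = (cos (x/2))\<^sup>2"
      using cos_double_cos[of "x/2"] by simp
    also have "x * (cos (x/2))\<^sup>2 = 2 * (x/2 * cos (x/2)) * cos (x/2)"
      by (simp add: power2_eq_square)
    also have "\<dots> \<le> 2 * sin (x/2) * cos (x/2)"
      using mult_cos_le_sin[of "x/2"] that c2 by (intro mult_right_mono) auto
    also have "\<dots> = sin x" using sin_double[of "x/2"] by simp
    finally show ?thesis .
  qed
  show ?thesis using *[of x] *[of "-x"] assms by (cases "x \<ge> 0") auto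
qed

lemma absolutely_integrable_ln_sin: "(\<lambda>x::real. ln \<bar>sin x\<bar>) absolutely_integrable_on {-pi/2..pi/2}"
proof -
  have "(\<lambda>x::real. ln \<bar>x\<bar>) absolutely_integrable_on {-pi/2..pi/2}"
    using absolutely_integrable_ln_power[where n=1 and c="pi/2"] by simp
  then have g: "(\<lambda>x::real. \<bar>ln \<bar>x\<bar>\<bar> + ln 2) integrable_on {-pi/2..pi/2}"
    by (intro integrable_add) (auto simp: absolutely_integrable_on_def)
  have m: "(\<lambda>x::real. ln \<bar>sin x\<bar>) \<in> borel_measurable (lebesgue_on {-pi/2..pi/2})"
    by (intro measurable_restrict_space1 measurable_completion) measurable
  show ?thesis
  proof (rule measurable_bounded_by_integrable_imp_absolutely_integrable[OF m _ g])
    fix x :: real assume x: "x \<in> {-pi/2..pi/2}"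
    show "norm (ln \<bar>sin x\<bar>) \<le> \<bar>ln \<bar>x\<bar>\<bar> + ln 2"
    proof (cases "x = 0")
      case False
      have "\<bar>x\<bar> / 2 \<le> \<bar>sin x\<bar>" using x by (intro half_abs_le_abs_sin) auto
      moreover have "\<bar>x\<bar> / 2 > 0" using False by auto
      ultimately have "ln (\<bar>x\<bar> / 2) \<le> ln \<bar>sin x\<bar>" "\<bar>sin x\<bar> > 0" by (auto simp: ln_mono)
      moreover have "ln \<bar>sin x\<bar> \<le> 0" using \<open>\<bar>sin x\<bar> > 0\<close> by simp
      ultimately show ?thesis using False by (simp add: ln_div)
    qed auto
  qed auto
qed

lemma has_integral_periodic_shift:
  fixes f :: "real \<Rightarrow> real"
  assumes per: "\<And>x. f (x + pi) = f x" and f: "(f has_integral I) {-pi/2..pi/2}"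
    and c: "0 \<le> c" "c \<le> pi / 2"
  shows "(f has_integral I) {c - pi/2..c + pi/2}"
proof -
  have int: "f integrable_on {-pi/2..pi/2}" using f by auto
  have "f integrable_on {-pi/2..c - pi/2}" "f integrable_on {c - pi/2..pi/2}"
    using c by (auto intro!: integrable_on_subinterval[OF int])
  then obtain J K where J: "(f has_integral J) {-pi/2..c - pi/2}" and K: "(f has_integral K) {c - pi/2..pi/2}"
    by (auto simp: integrable_on_def)
  have "(f has_integral (J + K)) {-pi/2..pi/2}"
    by (rule has_integral_combine[OF _ _ J K]) (use c in auto)
  from has_integral_unique[OF f this] have I: "I = K + J" by simp
  have "((\<lambda>x. f (x + - pi)) has_integral J) {-pi/2 - -pi..c - pi/2 - -pi}"
    by (rule has_integral_shift_real_ivl[OF J])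
  moreover have "f (x + - pi) = f x" for x using per[of "x - pi"] by simp
  ultimately have J': "(f has_integral J) {pi/2..c + pi/2}"
    by (simp add: algebra_simps)
  show ?thesis unfolding I
    by (rule has_integral_combine[OF _ _ K J']) (use c in auto)
qed

text \<open>As \<open>x\<close> runs over \<open>{0..pi}\<close>, \<open>(x + \<theta>) / 2\<close>
  covers one half of the period centred at \<open>\<theta> / 2\<close>, and
  \<open>(x - \<theta>) / 2\<close>, reflected at 0, covers the other half. The factor 2 comes from
  the substitution.\<close>

lemma has_integral_periodic_even_sum:
  fixes f :: "real \<Rightarrow> real"
  assumes per: "\<And>x. f (x + pi) = f x" and even: "\<And>x. f (- x) = f x"
    and f: "(f has_integral I) {-pi/2..pi/2}" and \<theta>: "0 \<le> \<theta>" "\<theta> \<le> pi"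
  shows "(\<lambda>x. f ((x + \<theta>) / 2)) integrable_on {0..pi}"
    and "(\<lambda>x. f ((x - \<theta>) / 2)) integrable_on {0..pi}"
    and "((\<lambda>x. f ((x + \<theta>) / 2) + f ((x - \<theta>) / 2)) has_integral (2 * I)) {0..pi}"
proof -
  have S: "(f has_integral I) {\<theta>/2 - pi/2..\<theta>/2 + pi/2}"
    using \<theta> by (intro has_integral_periodic_shift[OF per f]) auto
  have int: "f integrable_on {\<theta>/2 - pi/2..\<theta>/2 + pi/2}" using S by auto
  have "f integrable_on {\<theta>/2 - pi/2..\<theta>/2}" "f integrable_on {\<theta>/2..\<theta>/2 + pi/2}"
    by (auto intro!: integrable_on_subinterval[OF int])
  then obtain J K where J: "(f has_integral J) {\<theta>/2 - pi/2..\<theta>/2}" and K: "(f has_integral K) {\<theta>/2..\<theta>/2 + pi/2}"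
    by (auto simp: integrable_on_def)
  have "(f has_integral (J + K)) {\<theta>/2 - pi/2..\<theta>/2 + pi/2}"
    by (rule has_integral_combine[OF _ _ J K]) auto
  from has_integral_unique[OF S this] have I: "I = K + J" by simp
  have J': "(f has_integral J) {-\<theta>/2..pi/2 - \<theta>/2}"
    using has_integral_reflect_real[where f=f and a="\<theta>/2 - pi/2" and b="\<theta>/2"] J even by simp
  have A: "((\<lambda>x. f ((x + \<theta>) / 2)) has_integral (2 * K)) {0..pi}"
    using has_integral_affinity'[of f K "\<theta>/2" "\<theta>/2 + pi/2" "1/2" "\<theta>/2"] K
    by (simp add: field_simps)
  have B: "((\<lambda>x. f ((x - \<theta>) / 2)) has_integral (2 * J)) {0..pi}"
    using has_integral_affinity'[of f J "-\<theta>/2" "pi/2 - \<theta>/2" "1/2" "-\<theta>/2"] J'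
    by (simp add: field_simps)
  show "(\<lambda>x. f ((x + \<theta>) / 2)) integrable_on {0..pi}" "(\<lambda>x. f ((x - \<theta>) / 2)) integrable_on {0..pi}"
    using A B by auto
  show "((\<lambda>x. f ((x + \<theta>) / 2) + f ((x - \<theta>) / 2)) has_integral (2 * I)) {0..pi}"
    unfolding I using has_integral_add[OF A B] by (simp add: algebra_simps)
qed

text \<open>Euler's argument: \<open>sin (2 * x) = 2 * sin x * cos x\<close>, together with the
  equality of the integrals of \<open>ln |sin x|\<close> and \<open>ln |cos x|\<close> over a
  period, gives \<open>I = pi * ln 2 + 2 * I\<close>.\<close>

lemma has_integral_ln_sin: "((\<lambda>x::real. ln \<bar>sin x\<bar>) has_integral (- pi * ln 2)) {-pi/2..pi/2}"
proof -
  define f where "f = (\<lambda>x::real. ln \<bar>sin x\<bar>)"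
  have per: "f (x + pi) = f x" for x by (simp add: f_def)
  have even: "f (- x) = f x" for x by (simp add: f_def)
  obtain I where I: "(f has_integral I) {-pi/2..pi/2}"
    using absolutely_integrable_ln_sin by (auto simp: f_def absolutely_integrable_on_def)
  have C: "(f has_integral I) {0..pi}"
    using has_integral_periodic_shift[OF per I, of "pi/2"] by simp
  have "((\<lambda>x. f (x + pi/2)) has_integral I) {0 - pi/2..pi - pi/2}"
    by (rule has_integral_shift_real_ivl[OF C])
  then have cosI: "((\<lambda>x. ln \<bar>cos x\<bar>) has_integral I) {-pi/2..pi/2}"
    by (simp add: f_def sin_add)
  have "(f has_integral I) {-pi..0}"
    using has_integral_reflect_real[where f=f and a=0 and b=pi] C even by simp
  then have "(f has_integral (I + I)) {-pi..pi}"
    using C by (intro has_integral_combine[where c=0]) auto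
  then have D: "((\<lambda>x. f (2 * x)) has_integral I) {-pi/2..pi/2}"
    using has_integral_affinity'[of f "I + I" "-pi" "pi" 2 0] by (simp add: field_simps)
  have E: "((\<lambda>x. ln 2 + f x + ln \<bar>cos x\<bar>) has_integral (ln 2 * pi + I + I)) {-pi/2..pi/2}"
    using has_integral_const_real[of "ln 2 :: real" "-pi/2" "pi/2"]
    by (intro has_integral_add I cosI) (simp add: mult.commute)
  have "((\<lambda>x. f (2 * x)) has_integral (ln 2 * pi + I + I)) {-pi/2..pi/2}"
  proof (rule has_integral_spike_finite[OF _ _ E])
    fix x assume x: "x \<in> {-pi/2..pi/2} - {-pi/2, 0, pi/2}"
    then have "cos x > 0" by (intro cos_gt_zero_pi) auto
    moreover have "sin x \<noteq> 0"
    proof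
      assume "sin x = 0"
      moreover have "-pi < x" "x < pi" using x pi_gt_zero by (auto simp: field_simps)
      ultimately show False using x sin_eq_0_pi by auto
    qed
    ultimately show "f (2 * x) = ln 2 + f x + ln \<bar>cos x\<bar>"
      by (simp add: f_def sin_double abs_mult ln_mult)
  qed auto
  from has_integral_unique[OF D this] have "I = ln 2 * pi + I + I" .
  then have "I = - pi * ln 2" by (simp add: algebra_simps)
  then show ?thesis using I by (simp add: f_def)
qed

text \<open>The product formula for \<open>cos \<phi> - cos \<theta>\<close> splits the logarithm
  into \<open>ln 2\<close> and two half-angle copies of \<open>ln |sin|\<close> that together fill
  one period, so the value \<open>pi * ln 2 - 2 * pi * ln 2\<close> does not depend on
  \<open>\<theta>\<close>.\<close>

lemma
  fixes \<theta> :: real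
  assumes \<theta>: "0 \<le> \<theta>" "\<theta> \<le> pi"
  shows absolutely_integrable_ln_cos_diff: "(\<lambda>\<phi>. ln \<bar>cos \<phi> - cos \<theta>\<bar>) absolutely_integrable_on {0..pi}" (is ?A)
    and has_integral_ln_cos_diff: "((\<lambda>\<phi>. ln \<bar>cos \<phi> - cos \<theta>\<bar>) has_integral (- pi * ln 2)) {0..pi}" (is ?B)
proof -
  define f where "f = (\<lambda>x::real. ln \<bar>sin x\<bar>)"
  have per: "f (x + pi) = f x" for x by (simp add: f_def)
  have even: "f (- x) = f x" for x by (simp add: f_def)
  note f = has_integral_ln_sin[folded f_def]
  note F = has_integral_periodic_even_sum[of f, OF per even f \<theta>]
  obtain I where "((\<lambda>x. \<bar>f x\<bar>) has_integral I) {-pi/2..pi/2}"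
    using absolutely_integrable_ln_sin by (auto simp: f_def absolutely_integrable_on_def)
  \<comment> \<open>Applied to \<open>|f|\<close>, the same lemma gives absolute integrability of
    each half-angle term, which the later change of variables demands.\<close>
  note G = has_integral_periodic_even_sum[of "\<lambda>x. \<bar>f x\<bar>", OF _ _ this \<theta>, simplified per even]
  have eq: "ln \<bar>cos \<phi> - cos \<theta>\<bar> = ln 2 + (f ((\<phi> + \<theta>) / 2) + f ((\<phi> - \<theta>) / 2))" 
    if "\<phi> \<in> {0..pi} - {0, \<theta>, pi}" for \<phi>
  proof -
    have "sin ((\<phi> + \<theta>) / 2) > 0" using that \<theta> by (intro sin_gt_zero) auto
    moreover have "sin ((\<phi> - \<theta>) / 2) \<noteq> 0"
    proof
      assume "sin ((\<phi> - \<theta>) / 2) = 0"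
      moreover have "-pi < (\<phi> - \<theta>) / 2" "(\<phi> - \<theta>) / 2 < pi" using that \<theta> pi_gt_zero by (auto simp: field_simps)
      ultimately have "(\<phi> - \<theta>) / 2 = 0" using sin_eq_0_pi by blast
      then show False using that by auto
    qed
    moreover have "cos \<phi> - cos \<theta> = - 2 * sin ((\<phi> + \<theta>) / 2) * sin ((\<phi> - \<theta>) / 2)"
      using cos_diff_cos[of \<phi> \<theta>] sin_minus[of "(\<phi> - \<theta>) / 2"] by (simp add: minus_divide_left)
    ultimately show ?thesis by (simp add: f_def abs_mult ln_mult)
  qed
  have c: "((\<lambda>\<phi>. ln 2 :: real) has_integral (ln 2 * pi)) {0..pi}"
    using has_integral_const_real[of "ln 2 :: real" 0 pi] by (simp add: mult.commute)
  have "((\<lambda>\<phi>. ln \<bar>cos \<phi> - cos \<theta>\<bar>) has_integral (ln 2 * pi + 2 * (- pi * ln 2))) {0..pi}"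
    by (rule has_integral_spike_finite[where S="{0,\<theta>,pi}", OF _ eq has_integral_add[OF c F(3)]]) auto
  then show ?B by (simp add: algebra_simps)
  have "(\<lambda>\<phi>. f ((\<phi> + \<theta>) / 2)) absolutely_integrable_on {0..pi}" "(\<lambda>\<phi>. f ((\<phi> - \<theta>) / 2)) absolutely_integrable_on {0..pi}"
    using F G by (auto simp: absolutely_integrable_on_def)
  moreover have "(\<lambda>\<phi>. ln 2 :: real) absolutely_integrable_on {0..pi}"
    by (intro absolutely_integrable_continuous_real) auto
  ultimately have "(\<lambda>\<phi>. ln 2 + (f ((\<phi> + \<theta>) / 2) + f ((\<phi> - \<theta>) / 2))) absolutely_integrable_on {0..pi}"
    by (intro set_integral_add(1))
  from absolutely_integrable_spike[OF this negligible_finite[of "{0,\<theta>,pi}"] eq] show ?A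
    by simp
qed

section \<open>The equilibrium density of two intervals\<close>

lemma integrable_lebesgue_on_iff:
  fixes f :: "'a::euclidean_space \<Rightarrow> real"
  assumes "S \<in> sets lebesgue"
  shows "integrable (lebesgue_on S) f \<longleftrightarrow> f absolutely_integrable_on S"
  using assms by (simp add: integrable_restrict_space set_integrable_def)

text \<open>Centred at the midpoint of \<open>(-1,1) \<union> (d-1,d+1)\<close>, the two intervals are \<open>a < \<bar>x\<bar> < b\<close> with
  \<open>a = d/2 - 1\<close>, \<open>b = d/2 + 1\<close>, and the density is proportional to
  \<open>\<bar>x\<bar> / sqrt ((x\<^sup>2 - a\<^sup>2) (b\<^sup>2 - x\<^sup>2))\<close>; this is its restriction to the left interval. The parametrization
  \<open>eq_param\<close> is chosen so that it becomes constant.\<close>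

definition eq_density :: "real \<Rightarrow> real \<Rightarrow> real \<Rightarrow> real" where
  "eq_density d k s = k * (d / 2 - s) / (sqrt (1 - s\<^sup>2) * sqrt ((d - s)\<^sup>2 - 1))"

definition eq_param :: "real \<Rightarrow> real \<Rightarrow> real" where
  "eq_param d \<phi> = d / 2 - sqrt (d\<^sup>2 / 4 + 1 + d * cos \<phi>)"

context
  fixes d :: real
  assumes d: "d > 2"
begin

lemma eq_param_arg_pos: "d\<^sup>2 / 4 + 1 + d * cos \<phi> > 0"
proof -
  have "d * cos \<phi> \<ge> d * (-1)" using d by (intro mult_left_mono) auto
  moreover have "(d / 2 - 1)\<^sup>2 > 0" using d by simp
  ultimately show ?thesis by (simp add: power2_eq_square field_simps)
qed

text \<open>Measured from the midpoint \<open>d / 2\<close>, the squared coordinate runs over an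
  interval with centre \<open>d\<^sup>2 / 4 + 1\<close> and half length \<open>d\<close>;
  \<open>\<phi>\<close> is its Chebyshev angle there.\<close>

lemma eq_param_square: "(d / 2 - eq_param d \<phi>)\<^sup>2 = d\<^sup>2 / 4 + 1 + d * cos \<phi>"
  using eq_param_arg_pos[of \<phi>] by (simp add: eq_param_def)

lemma eq_param_pos: "d / 2 - eq_param d \<phi> > 0"
  using eq_param_arg_pos[of \<phi>] by (simp add: eq_param_def)

lemma eq_param_deriv:
  "(eq_param d has_real_derivative (d * sin \<phi> / (2 * (d / 2 - eq_param d \<phi>)))) (at \<phi> within S)"
proof -
  have "((\<lambda>\<phi>. d / 2 - sqrt (d\<^sup>2 / 4 + 1 + d * cos \<phi>)) has_real_derivative
          (d * sin \<phi> / (2 * sqrt (d\<^sup>2 / 4 + 1 + d * cos \<phi>)))) (at \<phi> within S)"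
    using eq_param_arg_pos[of \<phi>]
    by (auto intro!: derivative_eq_intros simp: field_simps)
  then show ?thesis unfolding eq_param_def[abs_def] by simp
qed

lemma eq_param_inj: "inj_on (eq_param d) {0<..<pi}"
proof (rule inj_onI)
  fix x y assume xy: "x \<in> {0<..<pi}" "y \<in> {0<..<pi}" "eq_param d x = eq_param d y"
  then have "cos x = cos y" using eq_param_square[of x] eq_param_square[of y] d by simp
  then show "x = y" using xy cos_inj_pi[of x y] by auto
qed

text \<open>The left side is the squared denominator of \<open>eq_density\<close>. It regroups as (d
  + q)(d - q) with \<open>q = t\<^sup>2 - d * t - 1 = d * cos \<phi>\<close>.\<close>

lemma eq_param_factor:
  "(1 - (eq_param d \<phi>)\<^sup>2) * ((d - eq_param d \<phi>)\<^sup>2 - 1) = (d * sin \<phi>)\<^sup>2"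
proof -
  define t where "t = eq_param d \<phi>"
  have "(d / 2 - t)\<^sup>2 = d\<^sup>2 / 4 + 1 + d * cos \<phi>" using eq_param_square by (simp add: t_def)
  then have 1: "t\<^sup>2 - d * t - 1 = d * cos \<phi>" by (simp add: power2_eq_square field_simps)
  have "(1 - t\<^sup>2) * ((d - t)\<^sup>2 - 1) = (d + (t\<^sup>2 - d * t - 1)) * (d - (t\<^sup>2 - d * t - 1))"
    by (simp add: power2_eq_square algebra_simps)
  also have "\<dots> = d\<^sup>2 * (1 - (cos \<phi>)\<^sup>2)" unfolding 1 by (simp add: power2_eq_square algebra_simps)
  finally show ?thesis by (simp add: t_def power_mult_distrib sin_squared_eq)
qed

lemma ex_eq_param:
  assumes "s \<in> {-1..1}"
  shows "\<exists>\<theta>\<in>{0..pi}. s = eq_param d \<theta>"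
proof -
  define c where "c = (s\<^sup>2 - d * s - 1) / d"
  \<comment> \<open>Expanded, the products are \<open>d + (s\<^sup>2 - d * s - 1)\<close> and
    \<open>d - (s\<^sup>2 - d * s - 1)\<close>, which puts \<open>c\<close> into [-1, 1].\<close>
  have "0 \<le> (1 - s) * (d - 1 - s)" "0 \<le> (1 + s) * (d + 1 - s)"
    using assms d by (intro mult_nonneg_nonneg; simp)+
  then have "- d \<le> s\<^sup>2 - d * s - 1" "s\<^sup>2 - d * s - 1 \<le> d"
    by (simp_all add: power2_eq_square algebra_simps)
  then have c: "-1 \<le> c" "c \<le> 1" using d by (auto simp: c_def field_simps)
  have "(d / 2 - s)\<^sup>2 = d\<^sup>2 / 4 + 1 + d * cos (arccos c)"
    using c d by (simp add: c_def power2_eq_square field_simps)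
  moreover have "d / 2 - s \<ge> 0" using assms d by simp
  ultimately have "d / 2 - s = sqrt (d\<^sup>2 / 4 + 1 + d * cos (arccos c))"
    by (rule real_sqrt_unique[symmetric])
  then show ?thesis using c 
    by (intro bexI[of _ "arccos c"]) (auto simp: eq_param_def arccos_lbound arccos_ubound)
qed

lemma eq_param_0: "eq_param d 0 = - 1"
proof -
  have "d\<^sup>2 / 4 + 1 + d = (d / 2 + 1)\<^sup>2" by (simp add: power2_eq_square field_simps)
  then show ?thesis using d by (simp add: eq_param_def)
qed

lemma eq_param_pi: "eq_param d pi = 1"
proof -
  have "d\<^sup>2 / 4 + 1 - d = (d / 2 - 1)\<^sup>2" by (simp add: power2_eq_square field_simps)
  then show ?thesis using d by (simp add: eq_param_def)
qed

lemma eq_param_range: "\<phi> \<in> {0<..<pi} \<Longrightarrow> eq_param d \<phi> \<in> {-1<..<1}"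
proof -
  assume "\<phi> \<in> {0<..<pi}"
  then have "cos \<phi> < 1" "cos \<phi> > -1"
    using cos_monotone_0_pi[of 0 \<phi>] cos_monotone_0_pi[of \<phi> pi] by auto
  then have "eq_param d 0 < eq_param d \<phi>" "eq_param d \<phi> < eq_param d pi"
    using mult_strict_left_mono[of "-1" "cos \<phi>" d] d by (auto simp: eq_param_def)
  then show ?thesis by (simp add: eq_param_0 eq_param_pi)
qed

lemma eq_param_image: "eq_param d ` {0<..<pi} = {-1<..<1}"
proof
  show "eq_param d ` {0<..<pi} \<subseteq> {-1<..<1}" using eq_param_range by auto
  show "{-1<..<1} \<subseteq> eq_param d ` {0<..<pi}"
  proof
    fix s :: real assume s: "s \<in> {-1<..<1}"
    then obtain \<theta> where \<theta>: "\<theta> \<in> {0..pi}" "s = eq_param d \<theta>" using ex_eq_param[of s] by auto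
    then have "\<theta> \<noteq> 0" "\<theta> \<noteq> pi" using s eq_param_0 eq_param_pi by auto
    then show "s \<in> eq_param d ` {0<..<pi}" using \<theta> by (intro image_eqI[of _ _ \<theta>]) auto
  qed
qed

lemma eq_density_pullback:
  assumes "\<phi> \<in> {0<..<pi}"
  shows "\<bar>d * sin \<phi> / (2 * (d / 2 - eq_param d \<phi>))\<bar> * eq_density d k (eq_param d \<phi>) = k / 2"
proof -
  have s: "sin \<phi> > 0" using assms by (intro sin_gt_zero) auto
  have "sqrt (1 - (eq_param d \<phi>)\<^sup>2) * sqrt ((d - eq_param d \<phi>)\<^sup>2 - 1) = d * sin \<phi>"
    using s d by (simp add: real_sqrt_mult[symmetric] eq_param_factor)
  then show ?thesis using s d eq_param_pos[of \<phi>] by (simp add: eq_density_def field_simps)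
qed

text \<open>The Jacobian of \<open>eq_param\<close> cancels the density up to \<open>k / 2\<close>.
  The equivalence form lets integrability and value be carried over together.\<close>

lemma eq_density_substitution:
  "(\<lambda>s. eq_density d k s * h s) absolutely_integrable_on {-1<..<1} \<and>
     integral {-1<..<1} (\<lambda>s. eq_density d k s * h s) = b \<longleftrightarrow>
   (\<lambda>\<phi>. k / 2 * h (eq_param d \<phi>)) absolutely_integrable_on {0..pi} \<and>
     integral {0..pi} (\<lambda>\<phi>. k / 2 * h (eq_param d \<phi>)) = b"
proof -
  let ?g' = "\<lambda>\<phi>. d * sin \<phi> / (2 * (d / 2 - eq_param d \<phi>))"
  let ?F = "\<lambda>\<phi>. \<bar>?g' \<phi>\<bar> * (eq_density d k (eq_param d \<phi>) * h (eq_param d \<phi>))"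
  let ?G = "\<lambda>\<phi>. k / 2 * h (eq_param d \<phi>)"
  have eq: "?F \<phi> = ?G \<phi>" if "\<phi> \<in> {0<..<pi}" for \<phi>
    using eq_density_pullback[OF that, of k] by (metis mult.assoc)
  have "?F absolutely_integrable_on {0<..<pi} \<and> integral {0<..<pi} ?F = b \<longleftrightarrow>
    (\<lambda>s. eq_density d k s * h s) absolutely_integrable_on eq_param d ` {0<..<pi} \<and>
     integral (eq_param d ` {0<..<pi}) (\<lambda>s. eq_density d k s * h s) = b"
    by (rule has_absolute_integral_change_of_variables_1')
       (use eq_param_deriv eq_param_inj in auto)
  moreover have "?F absolutely_integrable_on {0<..<pi} \<longleftrightarrow> ?G absolutely_integrable_on {0<..<pi}"
    by (rule absolutely_integrable_spike_eq[OF negligible_empty]) (use eq in auto)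
  moreover have "integral {0<..<pi} ?F = integral {0<..<pi} ?G"
    by (rule integral_cong) (use eq in auto)
  ultimately show ?thesis
    by (simp only: eq_param_image absolutely_integrable_on_Icc_iff_Ioo integral_open_interval_real)
qed

lemma eq_density_mass:
  "eq_density d k absolutely_integrable_on {-1<..<1}"
  "integral {-1<..<1} (eq_density d k) = k * pi / 2"
  using eq_density_substitution[of k "\<lambda>_. 1" "k * pi / 2"]
    absolutely_integrable_continuous_real[of 0 pi "\<lambda>_. k / 2"] by auto

text \<open>The second logarithm is the contribution of the mirror density, whose source point is
  \<open>d - t\<close>. The product \<open>(s - t) * (d - s - t)\<close> is a difference of squared
  distances to the midpoint, hence \<open>d * (cos \<phi> - cos \<theta>)\<close> in the angles; the
  integral is then independent of \<open>\<theta>\<close>, that is, of \<open>s\<close>.\<close>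

lemma eq_density_potential:
  assumes s: "s \<in> {-1..1}"
  shows "(\<lambda>t. eq_density d k t * (ln \<bar>s - t\<bar> + ln \<bar>d - s - t\<bar>)) absolutely_integrable_on {-1<..<1}"
    "integral {-1<..<1} (\<lambda>t. eq_density d k t * (ln \<bar>s - t\<bar> + ln \<bar>d - s - t\<bar>)) = k * pi / 2 * ln (d / 2)"
proof -
  obtain \<theta> where \<theta>: "0 \<le> \<theta>" "\<theta> \<le> pi" "s = eq_param d \<theta>" using ex_eq_param[OF s] by auto
  let ?h = "\<lambda>t. ln \<bar>s - t\<bar> + ln \<bar>d - s - t\<bar>"
  have eq: "k / 2 * ?h (eq_param d \<phi>) = k / 2 * (ln d + ln \<bar>cos \<phi> - cos \<theta>\<bar>)"
    if "\<phi> \<in> {0..pi} - {\<theta>}" for \<phi>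
  proof -
    let ?t = "eq_param d \<phi>"
    have "(s - ?t) * (d - s - ?t) = - ((d / 2 - s)\<^sup>2 - (d / 2 - ?t)\<^sup>2)"
      by (simp add: power2_eq_square algebra_simps)
    also have "\<dots> = d * (cos \<phi> - cos \<theta>)"
      using eq_param_square[of \<theta>] eq_param_square[of \<phi>] \<theta>(3) by (simp add: algebra_simps)
    finally have "\<bar>(s - ?t) * (d - s - ?t)\<bar> = \<bar>d * (cos \<phi> - cos \<theta>)\<bar>"
      by (rule arg_cong)
    then have 1: "\<bar>s - ?t\<bar> * \<bar>d - s - ?t\<bar> = d * \<bar>cos \<phi> - cos \<theta>\<bar>"
      using d by (simp add: abs_mult)
    have "cos \<phi> \<noteq> cos \<theta>" using cos_inj_pi[of \<phi> \<theta>] that \<theta> by auto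
    then have 2: "d * \<bar>cos \<phi> - cos \<theta>\<bar> > 0" using d by simp
    then have "s \<noteq> ?t" "d - s \<noteq> ?t" using 1 by auto
    then have "?h ?t = ln (\<bar>s - ?t\<bar> * \<bar>d - s - ?t\<bar>)" by (simp add: ln_mult)
    also have "\<dots> = ln d + ln \<bar>cos \<phi> - cos \<theta>\<bar>"
      unfolding 1 using d \<open>cos \<phi> \<noteq> cos \<theta>\<close> by (simp add: ln_mult)
    finally show ?thesis by simp
  qed
  have c: "(\<lambda>_. ln d :: real) absolutely_integrable_on {0..pi}"
    by (intro absolutely_integrable_continuous_real) auto
  have A: "(\<lambda>\<phi>. k / 2 * (ln d + ln \<bar>cos \<phi> - cos \<theta>\<bar>)) absolutely_integrable_on {0..pi}"
    by (intro set_integrable_mult_right set_integral_add(1) c absolutely_integrable_ln_cos_diff \<theta>)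
  have C: "((\<lambda>_. ln d) has_integral (ln d * pi)) {0..pi}"
    using has_integral_const_real[of "ln d" 0 pi] by (simp add: mult.commute)
  have B: "((\<lambda>\<phi>. k / 2 * (ln d + ln \<bar>cos \<phi> - cos \<theta>\<bar>)) has_integral
      (k / 2 * (ln d * pi + - pi * ln 2))) {0..pi}"
    by (intro has_integral_mult_right has_integral_add C has_integral_ln_cos_diff \<theta>)
  have "(\<lambda>\<phi>. k / 2 * ?h (eq_param d \<phi>)) absolutely_integrable_on {0..pi}"
    by (rule absolutely_integrable_spike[OF A negligible_finite[of "{\<theta>}"] eq]) auto
  moreover have "integral {0..pi} (\<lambda>\<phi>. k / 2 * ?h (eq_param d \<phi>)) = k / 2 * (ln d * pi + - pi * ln 2)"
    by (rule integral_unique, rule has_integral_spike_finite[where S="{\<theta>}", OF _ eq B]) auto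
  moreover have "k / 2 * (ln d * pi + - pi * ln 2) = k * pi / 2 * ln (d / 2)"
    using d by (simp add: ln_div algebra_simps)
  ultimately show "(\<lambda>t. eq_density d k t * ?h t) absolutely_integrable_on {-1<..<1}"
    "integral {-1<..<1} (\<lambda>t. eq_density d k t * ?h t) = k * pi / 2 * ln (d / 2)"
    using eq_density_substitution[of k ?h "k * pi / 2 * ln (d / 2)"] by auto
qed

text \<open>The weight removes one of the two inverse roots \<open>sqrt (1 - s\<^sup>2)\<close> from
  the squared density. What remains is the density times \<open>?h\<close>, which is continuous up
  to the end points because \<open>d > 2\<close>.\<close>

lemma eq_density_X1: "eq_density d k \<in> X1"
proof -
  let ?h = "\<lambda>s. k * (d / 2 - s) / sqrt ((d - s)\<^sup>2 - 1)"
  have pos: "(d - s)\<^sup>2 - 1 > 0" if "s \<in> {-1..1}" for s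
    using that d one_less_power[of "d - s" 2] by auto
  have 1: "continuous_on {-1..1} ?h"
    using pos by (intro continuous_intros) force
  have 2: "eq_param d ` {0..pi} \<subseteq> {-1..1}"
  proof safe
    fix \<phi> assume "\<phi> \<in> {0..pi}"
    then show "eq_param d \<phi> \<in> {-1..1}"
      using eq_param_range[of \<phi>] eq_param_0 eq_param_pi by (cases "\<phi> = 0 \<or> \<phi> = pi") auto
  qed
  have 3: "continuous_on {0..pi} (eq_param d)"
    unfolding eq_param_def[abs_def] by (intro continuous_intros)
  from continuous_on_compose2[OF 1 3 2] have "continuous_on {0..pi} (\<lambda>\<phi>. k / 2 * ?h (eq_param d \<phi>))"
    by (rule continuous_on_mult_left)
  then have "(\<lambda>\<phi>. k / 2 * ?h (eq_param d \<phi>)) absolutely_integrable_on {0..pi}"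
    by (rule absolutely_integrable_continuous_real)
  then have *: "(\<lambda>s. eq_density d k s * ?h s) absolutely_integrable_on {-1<..<1}"
    using eq_density_substitution[of k ?h] by blast
  have "(\<lambda>s. sqrt (1 - s\<^sup>2) * \<bar>eq_density d k s\<bar>\<^sup>2) absolutely_integrable_on {-1<..<1}"
  proof (rule absolutely_integrable_spike[OF * negligible_empty])
    fix s :: real assume "s \<in> {-1<..<1} - {}"
    then have "1 - s\<^sup>2 > 0" "(d - s)\<^sup>2 - 1 > 0" 
      using pos[of s] by (auto simp: abs_square_less_1)
    moreover have "a * (c / (a * b))\<^sup>2 = c / (a * b) * (c / b)" if "a > 0" "b > 0" for a b c :: real
      using that by (simp add: power2_eq_square)
    ultimately show "sqrt (1 - s\<^sup>2) * \<bar>eq_density d k s\<bar>\<^sup>2 = eq_density d k s * ?h s"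
      unfolding eq_density_def power2_abs by simp
  qed
  moreover have "eq_density d k \<in> borel_measurable (lebesgue_on {-1<..<1})"
    using eq_density_mass(1)[of k] integrable_lebesgue_on_iff[of "{-1<..<1}" "eq_density d k"] by auto
  ultimately show ?thesis by (simp add: X1_def integrable_lebesgue_on_iff)
qed

end

section \<open>The logarithmic energy\<close>

lemma integrable_ln_power_lborel:
  "integrable lborel (\<lambda>x. indicator {-c..c} x * \<bar>ln \<bar>x :: real\<bar>\<bar> ^ n)"
proof -
  have "set_integrable lebesgue {-c..c} (\<lambda>x. ln \<bar>x\<bar> ^ n)"
    by (rule absolutely_integrable_ln_power)
  then have "integrable lebesgue (\<lambda>x. \<bar>indicator {-c..c} x *\<^sub>R ln \<bar>x\<bar> ^ n\<bar>)"
    unfolding set_integrable_def by (rule integrable_abs)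
  also have "(\<lambda>x::real. \<bar>indicator {-c..c} x *\<^sub>R ln \<bar>x\<bar> ^ n\<bar>) = (\<lambda>x. indicator {-c..c} x * \<bar>ln \<bar>x\<bar>\<bar> ^ n)"
    by (auto simp: indicator_def power_abs)
  finally show ?thesis by (subst (asm) integrable_completion) auto
qed

text \<open>The exponent \<open>5/4\<close> is any number in \<open>(1, 4/3)\<close>: below \<open>4/3\<close> it admits all of \<open>X1\<close>, and above
  \<open>1\<close> the logarithm lies in the dual space.\<close>

definition Lp_supp :: "real \<Rightarrow> (real \<Rightarrow> real) \<Rightarrow> bool" where
  "Lp_supp B f \<longleftrightarrow> f \<in> borel_measurable borel \<and> (\<forall>x. \<bar>x\<bar> > B \<longrightarrow> f x = 0) \<and>
     integrable lborel (\<lambda>x. \<bar>f x\<bar> powr (5/4))"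

lemma Lp_supp_measurable [measurable_dest]: "Lp_supp B f \<Longrightarrow> f \<in> borel_measurable borel"
  by (simp add: Lp_supp_def)

lemma Lp_supp_zero: "Lp_supp B f \<Longrightarrow> \<bar>x\<bar> > B \<Longrightarrow> f x = 0"
  by (simp add: Lp_supp_def)

lemma Lp_supp_indicator: "Lp_supp B f \<Longrightarrow> f x * indicator {-B..B} x = f x"
  using Lp_supp_zero[of B f x] by (cases "\<bar>x\<bar> > B") (auto simp: indicator_def)

lemma Lp_supp_powr: "Lp_supp B f \<Longrightarrow> integrable lborel (\<lambda>x. \<bar>f x\<bar> powr (5/4))"
  by (simp add: Lp_supp_def)

text \<open>Young's inequality for the conjugate exponents 5/4 and 5 without sharp constants: the
  first term suffices when \<open>c ^ 4 \<le> t\<close>, the second otherwise.\<close>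

lemma mult_le_powr_plus_power:
  fixes t c :: real
  assumes "t \<ge> 0" "c \<ge> 0"
  shows "t * c \<le> t powr (5/4) + c ^ 5"
proof (cases "c ^ 4 \<le> t")
  case True
  show ?thesis
  proof (cases "t = 0")
    case False
    with assms have t: "t > 0" by simp
    have "c \<le> t powr (1/4)"
    proof (rule power_le_imp_le_base[of _ 3])
      show "c ^ Suc 3 \<le> (t powr (1/4)) ^ Suc 3" using True t by (simp add: powr_power)
    qed auto
    then have "t * c \<le> t powr 1 * t powr (1/4)" using t by simp
    also have "\<dots> = t powr (5/4)" by (simp only: powr_add[symmetric]) simp
    finally show ?thesis using zero_le_power[OF assms(2), of 5] by linarith
  qed (use assms in auto)
next
  case False
  then have "t * c \<le> c ^ 4 * c" using assms by (intro mult_right_mono) auto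
  also have "\<dots> = c ^ 5" by (simp add: power_Suc2[symmetric] del: power_Suc)
  finally show ?thesis by (simp add: add_increasing)
qed

lemma integrable_mult_Young:
  fixes t c :: "'a \<Rightarrow> real"
  assumes [measurable]: "t \<in> borel_measurable M" "c \<in> borel_measurable M"
    and t: "integrable M (\<lambda>x. \<bar>t x\<bar> powr (5/4))" and c: "integrable M (\<lambda>x. \<bar>c x\<bar> ^ 5)"
  shows "integrable M (\<lambda>x. t x * c x)"
proof (rule Bochner_Integration.integrable_bound[OF Bochner_Integration.integrable_add[OF t c]])
  show "AE x in M. norm (t x * c x) \<le> norm (\<bar>t x\<bar> powr (5/4) + \<bar>c x\<bar> ^ 5)"
    using mult_le_powr_plus_power[of "\<bar>t x\<bar>" "\<bar>c x\<bar>" for x] by (auto simp: abs_mult)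
qed measurable

lemma Lp_supp_integrable:
  assumes f: "Lp_supp B f"
  shows "integrable lborel f"
proof -
  note [measurable] = Lp_supp_measurable[OF f]
  have "integrable lborel (\<lambda>x. f x * indicator {-B..B} x)"
  proof (rule integrable_mult_Young)
    have "integrable lborel (\<lambda>x. indicator {-B..B} x :: real)"
      by (simp add: integrable_indicator_iff emeasure_lborel_Icc_eq)
    also have "(\<lambda>x. indicator {-B..B} x :: real) = (\<lambda>x. \<bar>indicator {-B..B} x\<bar> ^ 5)"
      by (auto simp: indicator_def)
    finally show "integrable lborel (\<lambda>x. \<bar>indicator {-B..B} x :: real\<bar> ^ 5)" .
  qed (use Lp_supp_powr[OF f] in auto)
  also have "(\<lambda>x. f x * indicator {-B..B} x) = f"
    by (simp add: Lp_supp_indicator[OF f])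
  finally show ?thesis .
qed

lemma integrable_lborel_pair_mult:
  fixes f g :: "real \<Rightarrow> real"
  assumes f: "integrable lborel f" and g: "integrable lborel g"
  shows "integrable (lborel \<Otimes>\<^sub>M lborel) (\<lambda>(x,y). f x * g y)"
proof (rule lborel_pair.Fubini_integrable)
  note [measurable] = borel_measurable_integrable[OF f] borel_measurable_integrable[OF g]
  show "(\<lambda>(x,y). f x * g y) \<in> borel_measurable (lborel \<Otimes>\<^sub>M lborel)" by measurable
  show "integrable lborel (\<lambda>x. \<integral>y. norm (case (x, y) of (x, y) \<Rightarrow> f x * g y) \<partial>lborel)"
    using f g by (simp add: abs_mult)
  show "AE x in lborel. integrable lborel (\<lambda>y. case (x, y) of (x, y) \<Rightarrow> f x * g y)"
    using g by simp
qed

lemma integrable_ln_translate: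
  "integrable lborel (\<lambda>y. \<bar>indicator {-B..B} y * ln \<bar>x - y :: real\<bar>\<bar> ^ 5)"
proof -
  have "integrable lborel (\<lambda>y. indicator {-(\<bar>B\<bar>+\<bar>x\<bar>)..\<bar>B\<bar>+\<bar>x\<bar>} (x + (-1) * y) * \<bar>ln \<bar>x + (-1) * y\<bar>\<bar> ^ 5)"
    by (rule lborel_integrable_real_affine[OF integrable_ln_power_lborel]) simp
  then show ?thesis
    by (rule Bochner_Integration.integrable_bound) (auto simp: indicator_def power_abs)
qed

text \<open>For \<open>x\<close> in [-B, B] every difference \<open>x - y\<close> stays in
  [-2B, 2B], so all inner integrals share the bound \<open>K\<close>.\<close>

lemma integrable_ln_pair:
  "integrable (lborel \<Otimes>\<^sub>M lborel) (\<lambda>(x,y). \<bar>indicator {-B..B} x * (indicator {-B..B} y * ln \<bar>x - y :: real\<bar>)\<bar> ^ 5)"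
proof (rule integrableI_bounded)
  define K where "K = (\<integral>\<^sup>+t. ennreal (indicator {-2*B..2*B} t * \<bar>ln \<bar>t\<bar>\<bar> ^ 5) \<partial>lborel)"
  have K: "K < \<infinity>"
    using integrable_ln_power_lborel[of "2*B" 5] unfolding K_def
    by (simp add: integrable_iff_bounded)
  have "(\<integral>\<^sup>+y. ennreal (norm (\<bar>indicator {-B..B} x * (indicator {-B..B} y * ln \<bar>x - y :: real\<bar>)\<bar> ^ 5)) \<partial>lborel) 
      \<le> K * indicator {-B..B} x" for x
  proof (cases "x \<in> {-B..B}")
    case True
    have "(\<integral>\<^sup>+y. ennreal (norm (\<bar>indicator {-B..B} x * (indicator {-B..B} y * ln \<bar>x - y :: real\<bar>)\<bar> ^ 5)) \<partial>lborel)
       \<le> (\<integral>\<^sup>+y. ennreal (indicator {-2*B..2*B} (x + (-1) * y) * \<bar>ln \<bar>x + (-1) * y\<bar>\<bar> ^ 5) \<partial>lborel)"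
      using True by (intro nn_integral_mono ennreal_leI) (auto simp: indicator_def power_abs)
    also have "\<dots> = K" unfolding K_def
      by (subst (2) nn_integral_real_affine[where t=x and c="-1"]) auto
    finally show ?thesis using True by simp
  qed simp
  then have "(\<integral>\<^sup>+x. (\<integral>\<^sup>+y. ennreal (norm (\<bar>indicator {-B..B} x * (indicator {-B..B} y * ln \<bar>x - y :: real\<bar>)\<bar> ^ 5)) \<partial>lborel) \<partial>lborel) 
      \<le> (\<integral>\<^sup>+x. K * indicator {-B..B} x \<partial>lborel)"
    by (rule nn_integral_mono)
  also have "\<dots> = K * emeasure lborel {-B..B}" by (simp add: nn_integral_cmult_indicator)
  also have "\<dots> < \<infinity>" using K by (simp add: emeasure_lborel_Icc_eq ennreal_mult_less_top)
  finally show "(\<integral>\<^sup>+z. ennreal (norm (case z of (x,y) \<Rightarrow> \<bar>indicator {-B..B} x * (indicator {-B..B} y * ln \<bar>x - y :: real\<bar>)\<bar> ^ 5)) \<partial>(lborel \<Otimes>\<^sub>M lborel)) < \<infinity>"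
    by (subst lborel.nn_integral_fst[symmetric]) auto
qed measurable

definition log_potential :: "(real \<Rightarrow> real) \<Rightarrow> real \<Rightarrow> real" where
  "log_potential f s = (\<integral>t. ln \<bar>s - t\<bar> * f t \<partial>lborel)"

lemma integrable_log_potential:
  assumes f: "Lp_supp B f"
  shows "integrable lborel (\<lambda>t. ln \<bar>s - t\<bar> * f t)"
proof -
  note [measurable] = Lp_supp_measurable[OF f]
  have "integrable lborel (\<lambda>t. f t * (indicator {-B..B} t * ln \<bar>s - t\<bar>))"
    by (rule integrable_mult_Young) (use Lp_supp_powr[OF f] integrable_ln_translate in auto)
  also have "(\<lambda>t. f t * (indicator {-B..B} t * ln \<bar>s - t\<bar>)) = (\<lambda>t. ln \<bar>s - t\<bar> * f t)"
    by (simp add: mult.assoc[symmetric] Lp_supp_indicator[OF f]) (simp add: mult.commute)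
  finally show ?thesis .
qed

text \<open>Hoelder in the plane: the product density lies in L^(5/4), the kernel cut off to a
  square in L^5. This licenses every use of Fubini for the energy.\<close>

lemma integrable_log_energy:
  assumes f: "Lp_supp B f" and g: "Lp_supp B g"
  shows "integrable (lborel \<Otimes>\<^sub>M lborel) (\<lambda>(x,y). ln \<bar>x - y\<bar> * (f x * g y))"
proof -
  note [measurable] = Lp_supp_measurable[OF f] Lp_supp_measurable[OF g]
  have "integrable (lborel \<Otimes>\<^sub>M lborel) (\<lambda>z. (case z of (x,y) \<Rightarrow> f x * g y) * 
      (case z of (x,y) \<Rightarrow> indicator {-B..B} x * (indicator {-B..B} y * ln \<bar>x - y\<bar>)))"
  proof (rule integrable_mult_Young)
    have "integrable (lborel \<Otimes>\<^sub>M lborel) (\<lambda>(x,y). \<bar>f x\<bar> powr (5/4) * \<bar>g y\<bar> powr (5/4))"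
      by (intro integrable_lborel_pair_mult Lp_supp_powr[OF f] Lp_supp_powr[OF g])
    then show "integrable (lborel \<Otimes>\<^sub>M lborel) (\<lambda>z. \<bar>case z of (x,y) \<Rightarrow> f x * g y\<bar> powr (5/4))"
      by (simp add: case_prod_unfold abs_mult powr_mult)
    show "integrable (lborel \<Otimes>\<^sub>M lborel) (\<lambda>z. \<bar>case z of (x,y) \<Rightarrow> indicator {-B..B} x * (indicator {-B..B} y * ln \<bar>x - y\<bar>)\<bar> ^ 5)"
      using integrable_ln_pair[of B] by (simp add: case_prod_unfold)
  qed measurable
  also have "(\<lambda>z. (case z of (x,y) \<Rightarrow> f x * g y) * 
      (case z of (x,y) \<Rightarrow> indicator {-B..B} x * (indicator {-B..B} y * ln \<bar>x - y\<bar>))) = (\<lambda>(x,y). ln \<bar>x - y\<bar> * (f x * g y))"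
  proof (rule ext)
    fix z :: "real \<times> real"
    obtain x y where z: "z = (x, y)" by (cases z)
    have "f x * g y * (indicator {-B..B} x * (indicator {-B..B} y * ln \<bar>x - y\<bar>)) =
        (f x * indicator {-B..B} x) * (g y * indicator {-B..B} y) * ln \<bar>x - y\<bar>" by simp
    then show "(case z of (x,y) \<Rightarrow> f x * g y) * 
      (case z of (x,y) \<Rightarrow> indicator {-B..B} x * (indicator {-B..B} y * ln \<bar>x - y\<bar>)) = (case z of (x,y) \<Rightarrow> ln \<bar>x - y\<bar> * (f x * g y))"
      unfolding Lp_supp_indicator[OF f] Lp_supp_indicator[OF g] z by simp
  qed
  finally show ?thesis .
qed

text \<open>Integrating the same double integral in both orders; the common right-hand side
  expresses the symmetry of the kernel.\<close>

lemma log_potential_energy: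
  assumes f: "Lp_supp B f" and g: "Lp_supp B g"
  shows "(\<integral>x. f x * log_potential g x \<partial>lborel) = (\<integral>z. (case z of (x,y) \<Rightarrow> ln \<bar>x - y\<bar> * (f x * g y)) \<partial>(lborel \<Otimes>\<^sub>M lborel))"
    and "(\<integral>y. log_potential f y * g y \<partial>lborel) = (\<integral>z. (case z of (x,y) \<Rightarrow> ln \<bar>x - y\<bar> * (f x * g y)) \<partial>(lborel \<Otimes>\<^sub>M lborel))"
proof -
  have "(\<integral>x. f x * log_potential g x \<partial>lborel) = (\<integral>x. (\<integral>y. ln \<bar>x - y\<bar> * (f x * g y) \<partial>lborel) \<partial>lborel)"
    unfolding log_potential_def
    by (intro Bochner_Integration.integral_cong refl, subst integral_mult_right_zero[symmetric])
       (simp add: mult_ac)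
  also have "\<dots> = (\<integral>z. (case z of (x,y) \<Rightarrow> ln \<bar>x - y\<bar> * (f x * g y)) \<partial>(lborel \<Otimes>\<^sub>M lborel))"
    by (rule lborel_pair.integral_fst[OF integrable_log_energy[OF f g]])
  finally show "(\<integral>x. f x * log_potential g x \<partial>lborel) = (\<integral>z. (case z of (x,y) \<Rightarrow> ln \<bar>x - y\<bar> * (f x * g y)) \<partial>(lborel \<Otimes>\<^sub>M lborel))" .
  have "(\<integral>y. log_potential f y * g y \<partial>lborel) = (\<integral>y. (\<integral>x. ln \<bar>x - y\<bar> * (f x * g y) \<partial>lborel) \<partial>lborel)"
    unfolding log_potential_def
    by (intro Bochner_Integration.integral_cong refl, subst integral_mult_left_zero[symmetric])
       (simp add: mult_ac abs_minus_commute)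
  also have "\<dots> = (\<integral>z. (case z of (x,y) \<Rightarrow> ln \<bar>x - y\<bar> * (f x * g y)) \<partial>(lborel \<Otimes>\<^sub>M lborel))"
    by (rule lborel_pair.integral_snd[OF integrable_log_energy[OF f g]])
  finally show "(\<integral>y. log_potential f y * g y \<partial>lborel) = (\<integral>z. (case z of (x,y) \<Rightarrow> ln \<bar>x - y\<bar> * (f x * g y)) \<partial>(lborel \<Otimes>\<^sub>M lborel))" .
qed


text \<open>If \<open>k\<close> is a superposition of the kernels \<open>h p\<close>, so is its
  pairing with \<open>F\<close>, even when \<open>F\<close> changes sign: Tonelli for
  \<open>|F|\<close> yields the integrability that Fubini needs. Used twice below, for triangles as
  mixtures of window products and for the logarithm as a mixture of triangles.\<close>

lemma
  fixes F k :: "'b \<Rightarrow> real" and h :: "'a \<Rightarrow> 'b \<Rightarrow> real"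
  assumes "sigma_finite_measure M" "sigma_finite_measure N"
    and [measurable]: "(\<lambda>(p,z). h p z) \<in> borel_measurable (M \<Otimes>\<^sub>M N)" "F \<in> borel_measurable N"
    and h: "\<And>p z. h p z \<ge> 0" and k: "\<And>z. k z \<ge> 0"
    and hk: "AE z in N. (\<integral>\<^sup>+p. ennreal (h p z) \<partial>M) = ennreal (k z)"
    and int: "integrable N (\<lambda>z. F z * k z)"
  shows integral_kernel_mixture: "(\<integral>z. F z * k z \<partial>N) = (\<integral>p. (\<integral>z. F z * h p z \<partial>N) \<partial>M)"
    and integrable_kernel_mixture: "integrable M (\<lambda>p. \<integral>z. F z * h p z \<partial>N)"
proof -
  interpret pair_sigma_finite M N using assms(1,2) by (simp add: pair_sigma_finite_def)
  have I: "integrable (M \<Otimes>\<^sub>M N) (\<lambda>(p,z). F z * h p z)"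
  proof (rule integrableI_bounded)
    have "(\<integral>\<^sup>+z. ennreal (norm (case z of (p,z) \<Rightarrow> F z * h p z)) \<partial>(M \<Otimes>\<^sub>M N))
        = (\<integral>\<^sup>+z. (\<integral>\<^sup>+p. ennreal \<bar>F z\<bar> * ennreal (h p z) \<partial>M) \<partial>N)"
      by (subst nn_integral_snd[symmetric]) (auto simp: abs_mult h ennreal_mult)
    also have "\<dots> = (\<integral>\<^sup>+z. ennreal \<bar>F z\<bar> * (\<integral>\<^sup>+p. ennreal (h p z) \<partial>M) \<partial>N)"
      by (intro nn_integral_cong nn_integral_cmult) measurable
    also have "\<dots> = (\<integral>\<^sup>+z. ennreal (norm (F z * k z)) \<partial>N)"
      by (rule nn_integral_cong_AE) (use hk in \<open>eventually_elim, simp add: abs_mult k ennreal_mult\<close>)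
    also have "\<dots> < \<infinity>" using int by (simp add: integrable_iff_bounded)
    finally show "(\<integral>\<^sup>+z. ennreal (norm (case z of (p,z) \<Rightarrow> F z * h p z)) \<partial>(M \<Otimes>\<^sub>M N)) < \<infinity>" .
  qed measurable
  show "integrable M (\<lambda>p. \<integral>z. F z * h p z \<partial>N)"
    by (rule integrable_fst[OF I])
  have "(\<integral>p. (\<integral>z. F z * h p z \<partial>N) \<partial>M) = (\<integral>z. (\<integral>p. F z * h p z \<partial>M) \<partial>N)"
    by (rule Fubini_integral[OF I, symmetric])
  also have "\<dots> = (\<integral>z. F z * k z \<partial>N)"
  proof (rule integral_cong_AE)
    show "AE z in N. (\<integral>p. F z * h p z \<partial>M) = F z * k z"
      using hk AE_space
    proof eventually_elim
      case (elim z)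
      note [measurable] = elim(2)
      have "(\<integral>p. h p z \<partial>M) = k z"
        using elim(1) h k by (subst integral_eq_nn_integral) auto
      then show ?case by simp
    qed
  qed (use int in auto)
  finally show "(\<integral>z. F z * k z \<partial>N) = (\<integral>p. (\<integral>z. F z * h p z \<partial>N) \<partial>M)" ..
qed

section \<open>Triangle kernels as overlaps of windows\<close>

definition window :: "real \<Rightarrow> real \<Rightarrow> real \<Rightarrow> real" where
  "window r z x = (if \<bar>x - z\<bar> < r / 2 then 1 else 0)"

lemma window_measurable [measurable (raw)]:
  "f \<in> borel_measurable M \<Longrightarrow> g \<in> borel_measurable M \<Longrightarrow> (\<lambda>x. window r (f x) (g x)) \<in> borel_measurable M"
  unfolding window_def by measurable

lemma window_mult_window:
  "window r z x * window r z y = indicator {max x y - r / 2<..<min x y + r / 2} z"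
  by (auto simp: window_def indicator_def abs_if split: if_splits)

lemma nn_integral_window:
  assumes "r \<ge> 0"
  shows "(\<integral>\<^sup>+z. ennreal (window r z x * window r z y) \<partial>lborel) = ennreal (max 0 (r - \<bar>x - y\<bar>))"
proof -
  have "(\<integral>\<^sup>+z. ennreal (window r z x * window r z y) \<partial>lborel) 
      = emeasure lborel {max x y - r / 2<..<min x y + r / 2}"
    by (simp add: window_mult_window ennreal_indicator)
  also have "\<dots> = ennreal (max 0 (r - \<bar>x - y\<bar>))"
    by (cases "x \<le> y"; cases "max x y - r / 2 \<le> min x y + r / 2")
       (auto simp: ennreal_neg max_def min_def abs_if)
  finally show ?thesis .
qed

definition window_mass :: "real \<Rightarrow> (real \<Rightarrow> real) \<Rightarrow> real \<Rightarrow> real" where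
  "window_mass r f z = (\<integral>x. f x * window r z x \<partial>lborel)"

lemma sigma_finite_lborel_pair: "sigma_finite_measure (lborel \<Otimes>\<^sub>M lborel :: (real \<times> real) measure)"
  by (rule lborel_pair.sigma_finite_measure_axioms)

text \<open>Mixture over the window centre \<open>p\<close>: for fixed \<open>p\<close> the kernel
  is a product in \<open>x\<close> and \<open>y\<close>, so the double integral factors into the
  square of \<open>window_mass\<close>.\<close>

lemma
  assumes f: "integrable lborel f" and r: "r \<ge> 0"
  shows integrable_triangle_energy: "integrable (lborel \<Otimes>\<^sub>M lborel) (\<lambda>(x,y). f x * f y * max 0 (r - \<bar>x - y\<bar>))" (is ?A)
    and triangle_energy_eq: "(\<integral>(x,y). f x * f y * max 0 (r - \<bar>x - y\<bar>) \<partial>(lborel \<Otimes>\<^sub>M lborel)) = (\<integral>z. (window_mass r f z)\<^sup>2 \<partial>lborel)" (is ?B)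
    and integrable_window_mass_square: "integrable lborel (\<lambda>z. (window_mass r f z)\<^sup>2)" (is ?C)
proof -
  note [measurable] = borel_measurable_integrable[OF f]
  have "integrable (lborel \<Otimes>\<^sub>M lborel) (\<lambda>(x,y). r * (f x * f y))"
    using integrable_lborel_pair_mult[OF f f] by (simp add: case_prod_unfold)
  then show A: ?A
  proof (rule Bochner_Integration.integrable_bound)
    have "\<bar>f x * f y * max 0 (r - \<bar>x - y\<bar>)\<bar> \<le> \<bar>r * (f x * f y)\<bar>" for x y
    proof -
      have "\<bar>f x * f y\<bar> * \<bar>max 0 (r - \<bar>x - y\<bar>)\<bar> \<le> \<bar>f x * f y\<bar> * r"
        using r by (intro mult_left_mono) auto
      then show ?thesis using r by (simp add: abs_mult mult_ac)
    qed
    then show "AE z in lborel \<Otimes>\<^sub>M lborel. norm (case z of (x,y) \<Rightarrow> f x * f y * max 0 (r - \<bar>x - y\<bar>)) \<le>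
        norm (case z of (x,y) \<Rightarrow> r * (f x * f y))"
      by auto
  qed measurable
  let ?h = "\<lambda>p z. window r p (fst z) * window r p (snd z)"
  have sq: "(\<integral>z. (f (fst z) * f (snd z)) * ?h p z \<partial>(lborel \<Otimes>\<^sub>M lborel)) = (window_mass r f p)\<^sup>2" for p
  proof -
    have w: "integrable lborel (\<lambda>x. f x * window r p x)"
      by (rule Bochner_Integration.integrable_bound[OF f]) (auto simp: window_def)
    have "(\<integral>z. (f (fst z) * f (snd z)) * ?h p z \<partial>(lborel \<Otimes>\<^sub>M lborel)) = 
       (\<integral>x. (\<integral>y. (f x * window r p x) * (f y * window r p y) \<partial>lborel) \<partial>lborel)"
      by (subst lborel_pair.integral_fst[OF integrable_lborel_pair_mult[OF w w]])
         (auto intro!: Bochner_Integration.integral_cong simp: case_prod_unfold)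
    also have "\<dots> = (window_mass r f p)\<^sup>2"
      by (simp add: window_mass_def power2_eq_square)
    finally show ?thesis .
  qed
  note mix = sigma_finite_lborel sigma_finite_lborel_pair
  have k: "AE z in lborel \<Otimes>\<^sub>M lborel. (\<integral>\<^sup>+p. ennreal (?h p z) \<partial>lborel) = ennreal (max 0 (r - \<bar>fst z - snd z\<bar>))"
    by (simp add: nn_integral_window[OF r])
  have A': "integrable (lborel \<Otimes>\<^sub>M lborel) (\<lambda>z. f (fst z) * f (snd z) * max 0 (r - \<bar>fst z - snd z\<bar>))"
    using A by (simp add: case_prod_unfold)
  have "(\<integral>z. f (fst z) * f (snd z) * max 0 (r - \<bar>fst z - snd z\<bar>) \<partial>(lborel \<Otimes>\<^sub>M lborel))
     = (\<integral>p. (\<integral>z. (f (fst z) * f (snd z)) * ?h p z \<partial>(lborel \<Otimes>\<^sub>M lborel)) \<partial>lborel)"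
    by (rule integral_kernel_mixture[OF mix _ _ _ _ k A']) (auto simp: window_def)
  then show ?B unfolding sq by (simp add: case_prod_unfold)
  have "integrable lborel (\<lambda>p. \<integral>z. (f (fst z) * f (snd z)) * ?h p z \<partial>(lborel \<Otimes>\<^sub>M lborel))"
    by (rule integrable_kernel_mixture[OF mix _ _ _ _ k A']) (auto simp: window_def)
  then show ?C unfolding sq .
qed

text \<open>Taylor's formula with integral remainder for \<open>- ln\<close>, expanded at
  \<open>R\<close>; the weight \<open>1 / s\<^sup>2\<close> is its second derivative.\<close>

lemma nn_integral_triangle_scales:
  assumes r: "0 < r" "r \<le> R"
  shows "(\<integral>\<^sup>+s. ennreal (indicator {0<..R} s * (max 0 (s - r) / s\<^sup>2)) \<partial>lborel) = ennreal (ln R - ln r - max 0 (R - r) / R)"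
proof -
  have "(\<integral>\<^sup>+s. ennreal (indicator {0<..R} s * (max 0 (s - r) / s\<^sup>2)) \<partial>lborel) 
    = (\<integral>\<^sup>+s. ennreal ((s - r) / s\<^sup>2) * indicator {r..R} s \<partial>lborel)"
    using r by (intro nn_integral_cong) (auto simp: indicator_def)
  also have "\<dots> = ennreal ((ln R + r / R) - (ln r + r / r))"
  proof (rule nn_integral_FTC_Icc)
    fix x assume x: "x \<in> {r..R}"
    show "((\<lambda>s. ln s + r / s) has_real_derivative (x - r) / x\<^sup>2) (at x)"
      using r x by (auto intro!: derivative_eq_intros simp: field_simps power2_eq_square)
    show "0 \<le> (x - r) / x\<^sup>2" using x by simp
  qed (use r in auto)
  also have "(ln R + r / R) - (ln r + r / r) = ln R - ln r - max 0 (R - r) / R"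
    using r by (simp add: field_simps max_def)
  finally show ?thesis .
qed

lemma AE_lborel_pair_neq: "AE z in lborel \<Otimes>\<^sub>M lborel. fst z \<noteq> (snd z :: real)"
proof (rule lborel_pair.AE_pair_measure)
  show "{x \<in> space (lborel \<Otimes>\<^sub>M lborel). fst x \<noteq> (snd x :: real)} \<in> sets (lborel \<Otimes>\<^sub>M lborel)"
    by measurable
  have "AE y in lborel. x \<noteq> y" for x :: real
    using AE_lborel_singleton[of x] by eventually_elim auto
  then show "AE x in lborel. AE y in lborel. fst (x, y) \<noteq> snd (x, y :: real)"
    by simp
qed

text \<open>For \<open>0 < r \<le> R\<close> one has
  \<open>- ln r = - ln R + \<integral>\<^sub>0\<^sup>R s\<^sup>-\<^sup>2 max 0 (s - r) ds + max 0 (R - r) / R\<close>, and every triangle kernel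
  \<open>max 0 (s - \<bar>x - y\<bar>)\<close> is the overlap of two windows of width \<open>s\<close>. Hence the negative
  logarithmic energy of a density of total mass zero is a superposition of squares.\<close>

lemma window_mass_zero_of_log_energy_zero:
  assumes f: "Lp_supp B f" and R: "R > 0" "2 * B \<le> R"
    and mass: "(\<integral>x. f x \<partial>lborel) = 0"
    and energy: "(\<integral>x. f x * log_potential f x \<partial>lborel) = 0"
  shows "AE z in lborel. window_mass R f z = 0"
proof -
  let ?P = "lborel \<Otimes>\<^sub>M lborel :: (real \<times> real) measure"
  define F where "F = (\<lambda>z. f (fst z) * f (snd z))"
  define D where "D = (\<lambda>z::real\<times>real. \<bar>fst z - snd z\<bar>)"
  \<comment> \<open>Setting \<open>k\<close> to 0 beyond \<open>R\<close> is harmless because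
    \<open>F\<close> vanishes there (\<open>2 * B \<le> R\<close>), and the diagonal is a null set.
    In exchange \<open>k\<close> is non-negative everywhere, as the mixture lemma requires.\<close>
  define k where "k = (\<lambda>z. if D z \<le> R \<and> D z > 0 then ln R - ln (D z) - max 0 (R - D z) / R else 0)"
  define h where "h = (\<lambda>s z. indicator {0<..R} s * (max 0 (s - D z) / s\<^sup>2))"
  note fi = Lp_supp_integrable[OF f]
  note [measurable] = Lp_supp_measurable[OF f]
  have Fm [measurable]: "F \<in> borel_measurable ?P" and [measurable]: "D \<in> borel_measurable ?P"
    unfolding F_def D_def by measurable
  have iF: "integrable ?P F" using integrable_lborel_pair_mult[OF fi fi] by (simp add: F_def case_prod_unfold)
  have "integral\<^sup>L ?P F = (\<integral>x. (\<integral>y. f x * f y \<partial>lborel) \<partial>lborel)"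
    by (subst lborel_pair.integral_fst[OF integrable_lborel_pair_mult[OF fi fi]]) (simp add: F_def case_prod_unfold)
  then have F0: "integral\<^sup>L ?P F = 0" by (simp add: mass)
  have iL: "integrable ?P (\<lambda>z. F z * ln (D z))"
    using integrable_log_energy[OF f f] by (simp add: F_def D_def case_prod_unfold mult.commute)
  have L0: "(\<integral>z. F z * ln (D z) \<partial>?P) = 0"
    using log_potential_energy(1)[OF f f] energy by (simp add: F_def D_def case_prod_unfold mult.commute)
  have iT: "integrable ?P (\<lambda>z. F z * max 0 (r - D z))"
    and T: "(\<integral>z. F z * max 0 (r - D z) \<partial>?P) = (\<integral>z. (window_mass r f z)\<^sup>2 \<partial>lborel)" if "r \<ge> 0" for r
    using integrable_triangle_energy[OF fi that] triangle_energy_eq[OF fi that]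
    by (simp_all add: F_def D_def case_prod_unfold)
  have Fk: "AE z in ?P. F z * k z = ln R * F z - F z * ln (D z) - F z * max 0 (R - D z) / R"
    using AE_lborel_pair_neq
  proof eventually_elim
    case (elim z)
    show ?case
    proof (cases "D z \<le> R")
      case False
      then have "\<bar>fst z\<bar> > B \<or> \<bar>snd z\<bar> > B" using R by (auto simp: D_def)
      then have "F z = 0" using Lp_supp_zero[OF f] by (auto simp: F_def)
      then show ?thesis by simp
    next
      case True
      then show ?thesis using elim by (simp add: k_def D_def algebra_simps)
    qed
  qed
  have [measurable]: "k \<in> borel_measurable ?P" unfolding k_def by measurable
  have ik': "integrable ?P (\<lambda>z. ln R * F z - F z * ln (D z) - F z * max 0 (R - D z) / R)"
    using iF iL iT[of R] R by simp
  then have ik: "integrable ?P (\<lambda>z. F z * k z)"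
    by (rule integrable_cong_AE_imp) (use Fk in auto)
  have "(\<integral>z. F z * k z \<partial>?P) = (\<integral>z. ln R * F z - F z * ln (D z) - F z * max 0 (R - D z) / R \<partial>?P)"
    by (rule integral_cong_AE) (use Fk in auto)
  also have "\<dots> = - (\<integral>z. (window_mass R f z)\<^sup>2 \<partial>lborel) / R"
    using iF iL iT[of R] T[of R] R F0 L0 by simp
  \<comment> \<open>Zero mass and zero energy leave only the boundary term at scale
    \<open>R\<close>, with a negative sign. The mixture over scales shows the same integral to be
    non-negative, so the square at scale \<open>R\<close> must vanish.\<close>
  finally have 1: "(\<integral>z. F z * k z \<partial>?P) = - (\<integral>z. (window_mass R f z)\<^sup>2 \<partial>lborel) / R" .
  have "(\<integral>z. F z * k z \<partial>?P) = (\<integral>s. (\<integral>z. F z * h s z \<partial>?P) \<partial>lborel)"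
  proof (rule integral_kernel_mixture[OF sigma_finite_lborel sigma_finite_lborel_pair _ Fm _ _ _ ik])
    show "(\<lambda>(s, z). h s z) \<in> borel_measurable (lborel \<Otimes>\<^sub>M ?P)"
      unfolding h_def D_def by measurable
    show "h s z \<ge> 0" for s z by (auto simp: h_def)
    show kn: "k z \<ge> 0" for z
    proof (cases "D z \<le> R \<and> D z > 0")
      case True
      then have "ln (D z / R) \<le> D z / R - 1" using R by (intro ln_le_minus_one) auto
      then have "ln (D z) - ln R \<le> D z / R - 1" using True R by (simp add: ln_div)
      moreover have "max 0 (R - D z) / R = 1 - D z / R" using True R by (simp add: field_simps max_def)
      ultimately show ?thesis using True by (simp add: k_def)
    qed (auto simp: k_def)
    show "AE z in ?P. (\<integral>\<^sup>+s. ennreal (h s z) \<partial>lborel) = ennreal (k z)"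
      using AE_lborel_pair_neq
    proof eventually_elim
      case (elim z)
      then have D0: "D z > 0" by (auto simp: D_def)
      show ?case
      proof (cases "D z \<le> R")
        case True
        then show ?thesis using nn_integral_triangle_scales[OF D0 True] D0 by (simp add: h_def k_def)
      next
        case False
        then have "h s z = 0" for s by (auto simp: h_def indicator_def)
        then show ?thesis using False by (simp add: k_def)
      qed
    qed
  qed
  also have "\<dots> \<ge> 0"
  proof (rule Bochner_Integration.integral_nonneg)
    fix s :: real
    show "0 \<le> (\<integral>z. F z * h s z \<partial>?P)"
    proof (cases "0 < s \<and> s \<le> R")
      case True
      then have "(\<integral>z. F z * h s z \<partial>?P) = (\<integral>z. F z * max 0 (s - D z) / s\<^sup>2 \<partial>?P)"
        by (simp add: h_def)
      also have "\<dots> = (\<integral>z. (window_mass s f z)\<^sup>2 \<partial>lborel) / s\<^sup>2"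
        using T[of s] True by simp
      also have "\<dots> \<ge> 0" by simp
      finally show ?thesis .
    qed (auto simp: h_def)
  qed
  finally have "(\<integral>z. (window_mass R f z)\<^sup>2 \<partial>lborel) \<le> 0"
    using 1 R by (simp add: field_simps)
  then have "(\<integral>z. (window_mass R f z)\<^sup>2 \<partial>lborel) = 0"
    by (intro antisym) auto
  then have "AE z in lborel. (window_mass R f z)\<^sup>2 = 0"
    using integrable_window_mass_square[OF fi, of R] R
    by (subst (asm) integral_nonneg_eq_0_iff_AE) auto
  then show ?thesis by simp
qed

section \<open>The constant of the two-interval problem\<close>

lemma integrable_powr_lborel:
  fixes a c :: real
  assumes "a > -1" "c \<ge> 0"
  shows "integrable lborel (\<lambda>x. indicator {0..c} x * x powr a)"
proof -
  have "(\<lambda>x. x powr a) absolutely_integrable_on {0..c}"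
    using assms integrable_on_powr_from_0[of a c] by (subst absolutely_integrable_on_iff_nonneg) auto
  then have "integrable lebesgue (\<lambda>x. indicator {0..c} x * x powr a)"
    by (simp add: set_integrable_def)
  then show ?thesis by (subst (asm) integrable_completion) auto
qed

text \<open>If the first term fails, then \<open>w < u powr (-3/4)\<close>, and raising to the power
  -5/3 gives the second. With \<open>w\<close> the weight of \<open>X1\<close>, this embeds
  \<open>X1\<close> into L^(5/4).\<close>

lemma powr_five_quarters_le:
  fixes u w :: real
  assumes "u \<ge> 0" "w > 0"
  shows "u powr (5/4) \<le> w * u\<^sup>2 + w powr (-5/3)"
proof (cases "u = 0")
  case False
  with assms have u: "u > 0" by simp
  show ?thesis
  proof (cases "u powr (5/4) \<le> w * u\<^sup>2")
    case False
    have "w * u powr 2 < u powr (5/4)" using False u by simp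
    then have "w < u powr (5/4) / u powr 2" using u by (simp add: field_simps)
    also have "\<dots> = u powr (-3/4)" by (simp add: powr_diff[symmetric])
    finally have "(u powr (-3/4)) powr (-5/3) \<le> w powr (-5/3)"
      using assms by (intro powr_mono2') auto
    then show ?thesis using assms by (simp add: powr_powr add_increasing)
  qed (simp add: add_increasing2)
qed (use assms in auto)

text \<open>The integrand is \<open>1 - x\<^sup>2\<close> to the power -5/6, an exponent above -1.
  On each half of the interval the factor belonging to the farther end point is at least 1.\<close>

lemma integrable_sqrt_weight:
  "integrable lborel (\<lambda>x::real. indicator {-1<..<1} x * (sqrt (1 - x\<^sup>2)) powr (-5/3))"
proof (rule Bochner_Integration.integrable_bound)
  have "integrable lborel (\<lambda>x::real. indicator {0..2} x * x powr (-5/6))"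
    by (rule integrable_powr_lborel) auto
  from lborel_integrable_real_affine[OF this, of 1 1] lborel_integrable_real_affine[OF this, of "-1" 1]
  show "integrable lborel (\<lambda>x::real. indicator {0..2} (1 + 1 * x) * (1 + 1 * x) powr (-5/6) + 
      indicator {0..2} (1 + (-1) * x) * (1 + (-1) * x) powr (-5/6))"
    by (intro Bochner_Integration.integrable_add) auto
  have *: "(sqrt (1 - x\<^sup>2)) powr (-5/3) \<le> (1 + x) powr (-5/6) + (1 - x) powr (-5/6)"
    if "-1 < x" "x < 1" for x :: real
  proof -
    have pos: "1 - x\<^sup>2 > 0" using that by (simp add: abs_square_less_1)
    then have eq: "(sqrt (1 - x\<^sup>2)) powr (-5/3) = (1 - x\<^sup>2) powr (-5/6)"
      by (simp add: powr_half_sqrt[symmetric] powr_powr)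
    have *: "1 - x\<^sup>2 = (1 - x) * (1 + x)" by (simp add: power2_eq_square algebra_simps)
    show ?thesis
    proof (cases "x \<ge> 0")
      case True
      then have "1 - x \<le> 1 - x\<^sup>2" using that unfolding * by (simp add: mult_le_cancel_left1)
      then have "(1 - x\<^sup>2) powr (-5/6) \<le> (1 - x) powr (-5/6)"
        using that by (intro powr_mono2') auto
      then show ?thesis unfolding eq by (simp add: add_increasing)
    next
      case False
      then have "1 + x \<le> 1 - x\<^sup>2" using that unfolding * by (simp add: mult_le_cancel_right1)
      then have "(1 - x\<^sup>2) powr (-5/6) \<le> (1 + x) powr (-5/6)"
        using that by (intro powr_mono2') auto
      then show ?thesis unfolding eq by (simp add: add_increasing2)
    qed
  qed
  show "AE x in lborel. norm (indicator {-1<..<1} x * (sqrt (1 - x\<^sup>2)) powr (-5/3)) \<le> 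
     norm (indicator {0..2} (1 + 1 * x) * (1 + 1 * x) powr (-5/6) + 
      indicator {0..2} (1 + (-1) * x) * (1 + (-1) * x) powr (-5/6))"
    using * by (intro AE_I2) (auto simp: indicator_def)
qed measurable

text \<open>Elements of \<open>X1\<close> are only Lebesgue measurable and arbitrary outside the
  interval, whereas the product-measure arguments need Borel densities on the line. The factor
  \<open>k\<close> acts as test function: logarithms recover the operators, the constant 1 the
  mass.\<close>

lemma X1_borel_version:
  assumes "\<phi> \<in> X1"
  obtains g where "Lp_supp 1 g" "\<And>x. x \<notin> {-1<..<1} \<Longrightarrow> g x = 0"
    "\<And>k. k \<in> borel_measurable borel \<Longrightarrow> 
       (\<integral>t. k t * \<phi> t \<partial>lebesgue_on {-1<..<1}) = (\<integral>t. k t * g t \<partial>lborel)"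
proof -
  let ?S = "{-1<..<1::real}"
  have m: "\<phi> \<in> borel_measurable (lebesgue_on ?S)" 
    and i: "integrable (lebesgue_on ?S) (\<lambda>x. sqrt (1 - x\<^sup>2) * \<bar>\<phi> x\<bar>\<^sup>2)"
    using assms by (auto simp: X1_def)
  have m': "(\<lambda>x. indicator ?S x * \<phi> x) \<in> borel_measurable lebesgue"
    using m by (subst (asm) borel_measurable_restrict_space_iff) auto
  obtain g0 where [measurable]: "g0 \<in> borel_measurable lborel" and g0: "AE x in lborel. indicator ?S x * \<phi> x = g0 x"
    using completion_ex_borel_measurable_real[OF m'] by auto
  define g where "g = (\<lambda>x. indicator ?S x * g0 x)"
  have [measurable]: "g \<in> borel_measurable borel" unfolding g_def by measurable
  have AEg: "AE x in lebesgue. indicator ?S x * \<phi> x = g x"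
  proof (rule AE_completion)
    show "AE x in lborel. indicator ?S x * \<phi> x = g x"
      using g0
    proof eventually_elim
      case (elim x)
      then show ?case by (cases "x \<in> ?S") (auto simp: g_def)
    qed
  qed
  have zero: "g x = 0" if "x \<notin> ?S" for x using that by (simp add: g_def)
  have integ: "(\<integral>t. k t * \<phi> t \<partial>lebesgue_on ?S) = (\<integral>t. k t * g t \<partial>lborel)" 
    if [measurable]: "k \<in> borel_measurable borel" for k
  proof -
    have kl: "k \<in> borel_measurable lebesgue" by (rule measurable_completion) simp
    have "(\<integral>t. k t * \<phi> t \<partial>lebesgue_on ?S) = (\<integral>t. k t * (indicator ?S t * \<phi> t) \<partial>lebesgue)"
      by (simp add: integral_restrict_space mult_ac)
    also have "\<dots> = (\<integral>t. k t * g t \<partial>lebesgue)"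
    proof (rule integral_cong_AE)
      show "AE t in lebesgue. k t * (indicator ?S t * \<phi> t) = k t * g t"
        using AEg by eventually_elim simp
      show "(\<lambda>t. k t * (indicator ?S t * \<phi> t)) \<in> borel_measurable lebesgue"
        by (intro borel_measurable_times kl m')
      show "(\<lambda>t. k t * g t) \<in> borel_measurable lebesgue"
        by (rule measurable_completion) simp
    qed
    also have "\<dots> = (\<integral>t. k t * g t \<partial>lborel)" by (rule integral_completion) simp
    finally show ?thesis .
  qed
  have "integrable lebesgue (\<lambda>x. indicator ?S x *\<^sub>R (sqrt (1 - x\<^sup>2) * \<bar>\<phi> x\<bar>\<^sup>2))"
    using i by (simp add: integrable_restrict_space)
  then have "integrable lebesgue (\<lambda>x. sqrt (1 - x\<^sup>2) * (g x)\<^sup>2)"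
  proof (rule integrable_cong_AE_imp)
    show "(\<lambda>x. sqrt (1 - x\<^sup>2) * (g x)\<^sup>2) \<in> borel_measurable lebesgue"
      by (rule measurable_completion) simp
    show "AE x in lebesgue. indicator ?S x *\<^sub>R (sqrt (1 - x\<^sup>2) * \<bar>\<phi> x\<bar>\<^sup>2) = sqrt (1 - x\<^sup>2) * (g x)\<^sup>2"
      using AEg by eventually_elim (auto simp: indicator_def zero split: if_splits)
  qed
  then have ig: "integrable lborel (\<lambda>x. sqrt (1 - x\<^sup>2) * (g x)\<^sup>2)"
    by (subst (asm) integrable_completion) auto
  have "integrable lborel (\<lambda>x. \<bar>g x\<bar> powr (5/4))"
  proof (rule Bochner_Integration.integrable_bound[OF Bochner_Integration.integrable_add[OF ig integrable_sqrt_weight]])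
    have "\<bar>g x\<bar> powr (5/4) \<le> sqrt (1 - x\<^sup>2) * (g x)\<^sup>2 + indicator ?S x * (sqrt (1 - x\<^sup>2)) powr (-5/3)" for x
    proof (cases "x \<in> ?S")
      case True
      then have "sqrt (1 - x\<^sup>2) > 0" by (auto simp: abs_square_less_1)
      from powr_five_quarters_le[OF _ this, of "\<bar>g x\<bar>"] show ?thesis using True by simp
    qed (simp add: zero)
    then show "AE x in lborel. norm (\<bar>g x\<bar> powr (5/4)) \<le> 
        norm (sqrt (1 - x\<^sup>2) * (g x)\<^sup>2 + indicator ?S x * (sqrt (1 - x\<^sup>2)) powr (-5/3))"
      by (intro AE_I2) (simp add: order_trans[OF _ abs_ge_self])
  qed measurable
  moreover have "g x = 0" if "\<bar>x\<bar> > 1" for x using that by (intro zero) auto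
  ultimately have "Lp_supp 1 g" by (simp add: Lp_supp_def)
  then show ?thesis using that zero integ by blast
qed

lemma Lp_supp_diff:
  assumes f: "Lp_supp B f" and g: "Lp_supp B g"
  shows "Lp_supp B (\<lambda>x. f x - g x)"
proof -
  note [measurable] = Lp_supp_measurable[OF f] Lp_supp_measurable[OF g]
  have "integrable lborel (\<lambda>x. \<bar>f x - g x\<bar> powr (5/4))"
  proof (rule Bochner_Integration.integrable_bound)
    show "integrable lborel (\<lambda>x. 2 powr (5/4) * (\<bar>f x\<bar> powr (5/4) + \<bar>g x\<bar> powr (5/4)))"
      using Lp_supp_powr[OF f] Lp_supp_powr[OF g] by simp
    have "\<bar>a - b\<bar> powr (5/4) \<le> 2 powr (5/4) * (\<bar>a\<bar> powr (5/4) + \<bar>b\<bar> powr (5/4))" for a b :: real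
    proof -
      have "\<bar>a - b\<bar> powr (5/4) \<le> (2 * max \<bar>a\<bar> \<bar>b\<bar>) powr (5/4)" by (intro powr_mono2) auto
      also have "\<dots> = 2 powr (5/4) * (max \<bar>a\<bar> \<bar>b\<bar>) powr (5/4)" by (simp add: powr_mult)
      also have "\<dots> \<le> 2 powr (5/4) * (\<bar>a\<bar> powr (5/4) + \<bar>b\<bar> powr (5/4))"
        by (intro mult_left_mono) (auto simp: max_def)
      finally show ?thesis .
    qed
    then show "AE x in lborel. norm (\<bar>f x - g x\<bar> powr (5/4)) \<le> norm (2 powr (5/4) * (\<bar>f x\<bar> powr (5/4) + \<bar>g x\<bar> powr (5/4)))"
      by (intro AE_I2) (auto intro: order_trans)
  qed measurable
  then show ?thesis using Lp_supp_zero[OF f] Lp_supp_zero[OF g] by (auto simp: Lp_supp_def)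
qed

lemma Lp_supp_two_intervals:
  assumes d: "d > 2" and f: "Lp_supp 1 f" and g: "Lp_supp 1 g"
  shows "Lp_supp (d + 1) (\<lambda>x. f x + g (x - d))"
proof -
  note [measurable] = Lp_supp_measurable[OF f] Lp_supp_measurable[OF g]
  have "integrable lborel (\<lambda>x. \<bar>f x\<bar> powr (5/4) + \<bar>g (-d + 1 * x)\<bar> powr (5/4))"
    by (intro Bochner_Integration.integrable_add lborel_integrable_real_affine[OF Lp_supp_powr[OF g]] Lp_supp_powr[OF f]) auto
  also have "(\<lambda>x. \<bar>f x\<bar> powr (5/4) + \<bar>g (-d + 1 * x)\<bar> powr (5/4)) = (\<lambda>x. \<bar>f x + g (x - d)\<bar> powr (5/4))"
  proof
    fix x :: real
    have "\<bar>x\<bar> > 1 \<or> \<bar>x - d\<bar> > 1" using d by linarith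
    then have "f x = 0 \<or> g (x - d) = 0" using Lp_supp_zero[OF f] Lp_supp_zero[OF g] by auto
    then show "\<bar>f x\<bar> powr (5/4) + \<bar>g (-d + 1 * x)\<bar> powr (5/4) = \<bar>f x + g (x - d)\<bar> powr (5/4)" by auto
  qed
  finally show ?thesis using Lp_supp_zero[OF f] Lp_supp_zero[OF g] d by (auto simp: Lp_supp_def)
qed

lemma integrable_translate: 
  "integrable lborel f \<Longrightarrow> integrable lborel (\<lambda>x. f (x - d :: real) :: real)"
  using lborel_integrable_real_affine[of f 1 "-d"] by (simp add: add.commute)

lemma integral_translate: "(\<integral>x. f (x - d :: real) \<partial>lborel) = (\<integral>x. f x \<partial>lborel :: real)"
  using lborel_integral_real_affine[of 1 f "-d"] by (simp add: add.commute)

lemma log_potential_two_intervals: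
  assumes f: "Lp_supp 1 f" and g: "Lp_supp 1 g"
  shows "log_potential (\<lambda>x. f x + g (x - d)) s = (\<integral>t. ln \<bar>s - t\<bar> * f t \<partial>lborel) + (\<integral>t. ln \<bar>s - d - t\<bar> * g t \<partial>lborel)"
proof -
  have "log_potential (\<lambda>x. f x + g (x - d)) s = (\<integral>t. ln \<bar>s - t\<bar> * f t + ln \<bar>s - d - (t - d)\<bar> * g (t - d) \<partial>lborel)"
    by (simp add: log_potential_def algebra_simps)
  also have "\<dots> = (\<integral>t. ln \<bar>s - t\<bar> * f t \<partial>lborel) + (\<integral>t. ln \<bar>s - d - (t - d)\<bar> * g (t - d) \<partial>lborel)"
    by (intro Bochner_Integration.integral_add integrable_log_potential[OF f] 
          integrable_translate[OF integrable_log_potential[OF g, of "s - d"]])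
  also have "(\<integral>t. ln \<bar>s - d - (t - d)\<bar> * g (t - d) \<partial>lborel) = (\<integral>t. ln \<bar>s - d - t\<bar> * g t \<partial>lborel)"
    by (rule integral_translate[of "\<lambda>t. ln \<bar>s - d - t\<bar> * g t"])
  finally show ?thesis .
qed


lemma ex_AE_Ioo:
  fixes a b :: real
  assumes "AE z in lborel. P z" "a < b"
  shows "\<exists>z\<in>{a<..<b}. P z"
proof (rule ccontr)
  assume *: "\<not> (\<exists>z\<in>{a<..<b}. P z)"
  obtain N where N: "{z \<in> space lborel. \<not> P z} \<subseteq> N" "emeasure lborel N = 0" "N \<in> sets lborel"
    using assms(1) by (auto elim: AE_E)
  have "emeasure lborel {a<..<b} \<le> emeasure lborel N"
    using * N by (intro emeasure_mono) auto
  then show False using N assms(2) by simp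
qed

text \<open>The system is one equation on the union of the two intervals: both components are the
  potential of a single density on the line, the second one read off at
  \<open>d + s\<close>.\<close>

lemma op_A_eq_log_potential:
  assumes f: "Lp_supp 1 f" and g: "Lp_supp 1 g"
    and F: "\<And>k. k \<in> borel_measurable borel \<Longrightarrow> 
       (\<integral>t. k t * \<phi>\<^sub>1 t \<partial>lebesgue_on {-1<..<1}) = (\<integral>t. k t * f t \<partial>lborel)"
    and G: "\<And>k. k \<in> borel_measurable borel \<Longrightarrow> 
       (\<integral>t. k t * \<phi>\<^sub>2 t \<partial>lebesgue_on {-1<..<1}) = (\<integral>t. k t * g t \<partial>lborel)"
  shows "op_A d (\<phi>\<^sub>1, \<phi>\<^sub>2) = (\<lambda>s\<in>{-1..1}. log_potential (\<lambda>x. f x + g (x - d)) s,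
     \<lambda>s\<in>{-1..1}. log_potential (\<lambda>x. f x + g (x - d)) (d + s))"
proof -
  have "op_L \<phi>\<^sub>1 s + op_L2 d \<phi>\<^sub>2 s = log_potential (\<lambda>x. f x + g (x - d)) s" for s
  proof -
    have "(\<integral>t. ln \<bar>d - s + t\<bar> * g t \<partial>lborel) = (\<integral>t. ln \<bar>s - d - t\<bar> * g t \<partial>lborel)"
      by (intro Bochner_Integration.integral_cong refl arg_cong2[where f="(*)"] arg_cong[where f=ln]) auto
    then show ?thesis
      unfolding op_L_def op_L2_def log_potential_two_intervals[OF f g]
      by (subst F, simp, subst G, simp) simp
  qed
  moreover have "op_L1 d \<phi>\<^sub>1 s + op_L \<phi>\<^sub>2 s = log_potential (\<lambda>x. f x + g (x - d)) (d + s)" for s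
    unfolding op_L_def op_L1_def log_potential_two_intervals[OF f g]
    by (subst F, simp, subst G, simp) simp
  ultimately show ?thesis by (simp add: op_A_def)
qed

text \<open>Both potentials equal 1 wherever the densities live, so the symmetric mutual energy
  equals either total mass. The difference thus has total mass zero, and its energy vanishes because
  the two potentials cancel there; its window masses are then zero almost everywhere, and one
  suitable window isolates the right interval.\<close>

lemma two_interval_masses_unique:
  assumes d: "d > 2"
    and f: "Lp_supp 1 f\<^sub>1" "Lp_supp 1 f\<^sub>2" and g: "Lp_supp 1 g\<^sub>1" "Lp_supp 1 g\<^sub>2"
    and F: "\<And>s. s \<in> {-1..1} \<union> {d-1..d+1} \<Longrightarrow> log_potential (\<lambda>x. f\<^sub>1 x + f\<^sub>2 (x - d)) s = 1"
    and G: "\<And>s. s \<in> {-1..1} \<union> {d-1..d+1} \<Longrightarrow> log_potential (\<lambda>x. g\<^sub>1 x + g\<^sub>2 (x - d)) s = 1"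
  shows "integral\<^sup>L lborel f\<^sub>1 = integral\<^sup>L lborel g\<^sub>1" "integral\<^sup>L lborel f\<^sub>2 = integral\<^sup>L lborel g\<^sub>2"
proof -
  let ?f = "\<lambda>x. f\<^sub>1 x + f\<^sub>2 (x - d)" and ?g = "\<lambda>x. g\<^sub>1 x + g\<^sub>2 (x - d)"
  let ?c = "\<lambda>x. ?f x - ?g x"
  let ?E = "{-1..1} \<union> {d-1..d+1}"
  note Lf = Lp_supp_two_intervals[OF d f] and Lg = Lp_supp_two_intervals[OF d g]
  note Lc = Lp_supp_diff[OF Lf Lg]
  note if' = Lp_supp_integrable[OF Lf] and ig' = Lp_supp_integrable[OF Lg]
  have zero: "h\<^sub>1 x + h\<^sub>2 (x - d) = 0" if "Lp_supp 1 h\<^sub>1" "Lp_supp 1 h\<^sub>2" "x \<notin> ?E" for h\<^sub>1 h\<^sub>2 x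
    using Lp_supp_zero[OF that(1), of x] Lp_supp_zero[OF that(2), of "x - d"] that(3) d
    by (auto simp: abs_if split: if_splits)
  have fg: "?f x * log_potential ?g x = ?f x" for x
    using G[of x] zero[OF f, of x] by (cases "x \<in> ?E") auto
  have gf: "log_potential ?f x * ?g x = ?g x" for x
    using F[of x] zero[OF g, of x] by (cases "x \<in> ?E") auto
  have "(\<integral>x. ?f x \<partial>lborel) = (\<integral>x. ?f x * log_potential ?g x \<partial>lborel)" by (simp only: fg)
  also have "\<dots> = (\<integral>x. log_potential ?f x * ?g x \<partial>lborel)"
    by (simp only: log_potential_energy[OF Lf Lg])
  also have "\<dots> = (\<integral>x. ?g x \<partial>lborel)" by (simp only: gf)
  finally have tot: "(\<integral>x. ?f x \<partial>lborel) = (\<integral>x. ?g x \<partial>lborel)" .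
  have pot: "log_potential ?c s = log_potential ?f s - log_potential ?g s" for s
    unfolding log_potential_def
    by (subst Bochner_Integration.integral_diff[symmetric, OF integrable_log_potential[OF Lf] integrable_log_potential[OF Lg]])
       (simp add: right_diff_distrib)
  have "?c x * log_potential ?c x = 0" for x
    unfolding pot using F[of x] G[of x] zero[OF f, of x] zero[OF g, of x] by (cases "x \<in> ?E") auto
  then have en: "(\<integral>x. ?c x * log_potential ?c x \<partial>lborel) = 0" by (simp only: Bochner_Integration.integral_zero)
  have "(\<integral>x. ?c x \<partial>lborel) = 0" using if' ig' tot by simp
  from window_mass_zero_of_log_energy_zero[OF Lc _ _ this en, of "2 * (d + 1)"] d
  have "AE z in lborel. window_mass (2 * (d + 1)) ?c z = 0" by simp
  \<comment> \<open>For such \<open>z\<close> the window starts between 1 and \<open>d - 1\<close>: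
    it misses the left interval and contains the right one. The range of admissible centres is
    nonempty because \<open>d > 2\<close>.\<close>
  from ex_AE_Ioo[OF this, of "d + 2" "2 * d"] d
  obtain z where z: "d + 2 < z" "z < 2 * d" "window_mass (2 * (d + 1)) ?c z = 0" by auto
  have "?c x * window (2 * (d + 1)) z x = f\<^sub>2 (x - d) - g\<^sub>2 (x - d)" for x
    using Lp_supp_zero[OF f(1), of x] Lp_supp_zero[OF f(2), of "x - d"]
      Lp_supp_zero[OF g(1), of x] Lp_supp_zero[OF g(2), of "x - d"] z d
    by (cases "z - d - 1 < x \<and> x \<le> d + 1"; cases "x > d + 1") (auto simp: window_def abs_if split: if_splits)
  then have "0 = (\<integral>x. f\<^sub>2 (x - d) - g\<^sub>2 (x - d) \<partial>lborel)"
    using z(3) by (simp add: window_mass_def)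
  also have "\<dots> = (\<integral>x. f\<^sub>2 x \<partial>lborel) - (\<integral>x. g\<^sub>2 x \<partial>lborel)"
    by (subst Bochner_Integration.integral_diff)
       (auto intro!: integrable_translate Lp_supp_integrable[OF f(2)] Lp_supp_integrable[OF g(2)] simp: integral_translate)
  finally show 2: "integral\<^sup>L lborel f\<^sub>2 = integral\<^sup>L lborel g\<^sub>2" by simp
  have "(\<integral>x. h\<^sub>1 x + h\<^sub>2 (x - d) \<partial>lborel) = integral\<^sup>L lborel h\<^sub>1 + integral\<^sup>L lborel h\<^sub>2"
    if "Lp_supp 1 h\<^sub>1" "Lp_supp 1 h\<^sub>2" for h\<^sub>1 h\<^sub>2
    by (subst Bochner_Integration.integral_add)
       (auto intro!: integrable_translate Lp_supp_integrable[OF that(1)] Lp_supp_integrable[OF that(2)] simp: integral_translate)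
  from this[OF f] this[OF g] tot 2
  show "integral\<^sup>L lborel f\<^sub>1 = integral\<^sup>L lborel g\<^sub>1" by simp
qed

section \<open>The explicit preimage of the constant pair\<close>

lemma integral_reflect_Ioo:
  "(\<integral>t. F (- t) \<partial>lebesgue_on {-1<..<1::real}) = (\<integral>t. F t \<partial>lebesgue_on {-1<..<1} :: real)"
proof -
  have "(\<integral>t. F (- t) \<partial>lebesgue_on {-1<..<1::real}) = (\<integral>t. indicator {-1<..<1} t * F (0 + (-1) * t) \<partial>lebesgue)"
    by (simp add: integral_restrict_space)
  also have "\<dots> = (\<integral>t. indicator {-1<..<1} (0 + (-1) * t) * F (0 + (-1) * t) \<partial>lebesgue)"
    by (intro Bochner_Integration.integral_cong) (auto simp: indicator_def)
  also have "\<dots> = (\<integral>t. indicator {-1<..<1} t * F t \<partial>lebesgue)"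
    by (subst (2) lebesgue_integral_real_affine[where c="-1" and t=0]) auto
  finally show ?thesis by (simp add: integral_restrict_space)
qed

lemma integrable_reflect_Ioo:
  fixes F :: "real \<Rightarrow> real"
  assumes "integrable (lebesgue_on {-1<..<1}) F"
  shows "integrable (lebesgue_on {-1<..<1}) (\<lambda>t. F (- t))"
proof -
  have "integrable lebesgue (\<lambda>t. indicator {-1<..<1} t *\<^sub>R F t)"
    using assms by (simp add: integrable_restrict_space)
  then have "integrable lebesgue (\<lambda>t. indicator {-1<..<1} (0 + (-1) * t) *\<^sub>R F (0 + (-1) * t))"
    by (subst lebesgue_integrable_real_affine_iff) auto
  also have "(\<lambda>t. indicator {-1<..<1} (0 + (-1) * t) *\<^sub>R F (0 + (-1) * t)) = (\<lambda>t. indicator {-1<..<1} t *\<^sub>R F (- t))"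
    by (auto simp: indicator_def)
  finally show ?thesis by (simp add: integrable_restrict_space)
qed

lemma X1_reflect:
  assumes "\<phi> \<in> X1"
  shows "(\<lambda>t. \<phi> (- t)) \<in> X1"
proof -
  have m: "\<phi> \<in> borel_measurable (lebesgue_on {-1<..<1})"
    and i: "integrable (lebesgue_on {-1<..<1}) (\<lambda>x. sqrt (1 - x\<^sup>2) * \<bar>\<phi> x\<bar>\<^sup>2)"
    using assms by (auto simp: X1_def)
  have "uminus \<in> lebesgue_on {-1<..<1::real} \<rightarrow>\<^sub>M lebesgue_on {-1<..<1}"
  proof (rule measurable_restrict_space3)
    show "(uminus :: real \<Rightarrow> real) \<in> lebesgue \<rightarrow>\<^sub>M lebesgue"
      using lebesgue_affine_measurable[of "\<lambda>_. -1 :: real" "0 :: real"] by simp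
  qed auto
  from measurable_comp[OF this m] have "(\<lambda>t. \<phi> (- t)) \<in> borel_measurable (lebesgue_on {-1<..<1})"
    by (simp add: o_def)
  with integrable_reflect_Ioo[OF i] show ?thesis by (simp add: X1_def)
qed

text \<open>The substitution only treats the sum of the two logarithms; their separate integrability
  comes from the Borel representative.\<close>

lemma eq_density_potential_split:
  assumes d: "d > 2" and s: "s \<in> {-1..1}"
  shows "(\<integral>t. ln \<bar>s - t\<bar> * eq_density d k t \<partial>lebesgue_on {-1<..<1}) +
         (\<integral>t. ln \<bar>d - s - t\<bar> * eq_density d k t \<partial>lebesgue_on {-1<..<1}) = k * pi / 2 * ln (d / 2)"
proof -
  from X1_borel_version[OF eq_density_X1[OF d, of k]] obtain g where g: "Lp_supp 1 g"
    "\<And>h. h \<in> borel_measurable borel \<Longrightarrow> 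
       (\<integral>t. h t * eq_density d k t \<partial>lebesgue_on {-1<..<1}) = (\<integral>t. h t * g t \<partial>lborel)"
    by metis
  have "(\<integral>t. ln \<bar>s - t\<bar> * g t \<partial>lborel) + (\<integral>t. ln \<bar>d - s - t\<bar> * g t \<partial>lborel)
     = (\<integral>t. (ln \<bar>s - t\<bar> + ln \<bar>d - s - t\<bar>) * g t \<partial>lborel)"
    by (subst Bochner_Integration.integral_add[symmetric, OF integrable_log_potential[OF g(1)] integrable_log_potential[OF g(1)]])
       (simp add: distrib_right)
  also have "\<dots> = (\<integral>t. (ln \<bar>s - t\<bar> + ln \<bar>d - s - t\<bar>) * eq_density d k t \<partial>lebesgue_on {-1<..<1})"
    by (rule g(2)[symmetric]) simp
  also have "\<dots> = integral {-1<..<1} (\<lambda>t. eq_density d k t * (ln \<bar>s - t\<bar> + ln \<bar>d - s - t\<bar>))"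
    using eq_density_potential(1)[OF d s, of k]
    by (subst lebesgue_integral_eq_integral) (auto simp: integrable_lebesgue_on_iff mult.commute)
  finally show ?thesis
    unfolding eq_density_potential(2)[OF d s] by (subst g(2), simp, subst g(2), simp)
qed

text \<open>The explicit pair shows that the constant pair lies in the range of \<open>op_A\<close>,
  so \<open>inv_into\<close> returns a true preimage; uniqueness of masses then transfers the
  explicit values to it.\<close>

lemma alpha_eq:
  assumes d: "d > 2"
  shows "alpha d = 1 / ln (d / 2)"
proof -
  \<comment> \<open>Normalizes the constant potential \<open>k * pi / 2 * ln (d / 2)\<close> to 1;
    the mass \<open>k * pi / 2\<close> is then the claimed value.\<close>
  define k where "k = 2 / (pi * ln (d / 2))"
  have lnd: "ln (d / 2) > 0" using d by simp
  have k1: "k * pi / 2 = 1 / ln (d / 2)" "k * pi / 2 * ln (d / 2) = 1" using lnd by (simp_all add: k_def)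
  let ?one = "(\<lambda>s\<in>{-1..1::real}. 1 :: real, \<lambda>s\<in>{-1..1::real}. 1 :: real)"
  let ?M = "lebesgue_on {-1<..<1::real}"
  define \<psi>\<^sub>1 where "\<psi>\<^sub>1 = eq_density d k"
  \<comment> \<open>The density on the right interval is the mirror image at \<open>d / 2\<close>;
    in the coordinate shifted back by \<open>d\<close> this is reflection at 0.\<close>
  define \<psi>\<^sub>2 where "\<psi>\<^sub>2 = (\<lambda>t. \<psi>\<^sub>1 (- t))"
  have \<psi>: "\<psi>\<^sub>1 \<in> X1" "\<psi>\<^sub>2 \<in> X1"
    using X1_reflect eq_density_X1[OF d] by (auto simp: \<psi>\<^sub>1_def \<psi>\<^sub>2_def)
  have pot: "(\<integral>t. ln \<bar>s - t\<bar> * \<psi>\<^sub>1 t \<partial>?M) + (\<integral>t. ln \<bar>d - s - t\<bar> * \<psi>\<^sub>1 t \<partial>?M) = 1" if "s \<in> {-1..1}" for s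
    using eq_density_potential_split[OF d that, of k] k1 by (simp add: \<psi>\<^sub>1_def)
  have refl: "(\<integral>t. ln \<bar>c + t\<bar> * \<psi>\<^sub>2 t \<partial>?M) = (\<integral>t. ln \<bar>c - t\<bar> * \<psi>\<^sub>1 t \<partial>?M)" for c
    using integral_reflect_Ioo[of "\<lambda>t. ln \<bar>c - t\<bar> * \<psi>\<^sub>1 t"] by (simp add: \<psi>\<^sub>2_def)
  have "op_L \<psi>\<^sub>1 s + op_L2 d \<psi>\<^sub>2 s = 1" if "s \<in> {-1..1}" for s
    using pot[OF that] refl[of "d - s"] by (simp add: op_L_def op_L2_def)
  moreover have "op_L1 d \<psi>\<^sub>1 s + op_L \<psi>\<^sub>2 s = 1" if "s \<in> {-1..1}" for s
  proof -
    have "op_L \<psi>\<^sub>2 s = (\<integral>t. ln \<bar>- s + t\<bar> * \<psi>\<^sub>2 t \<partial>?M)"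
      unfolding op_L_def
      by (intro Bochner_Integration.integral_cong refl arg_cong2[where f="(*)"] arg_cong[where f=ln]) auto
    then show ?thesis using pot[of "- s"] refl[of "- s"] that by (simp add: op_L1_def)
  qed
  ultimately have A: "op_A d (\<psi>\<^sub>1, \<psi>\<^sub>2) = ?one"
    by (auto simp: op_A_def intro!: restrict_ext)
  then have im: "?one \<in> op_A d ` (X1 \<times> X1)" using \<psi> by (metis SigmaI image_eqI)
  obtain \<phi>\<^sub>1 \<phi>\<^sub>2 where \<phi>: "op_A_inv d ?one = (\<phi>\<^sub>1, \<phi>\<^sub>2)" by (cases "op_A_inv d ?one")
  have X: "\<phi>\<^sub>1 \<in> X1" "\<phi>\<^sub>2 \<in> X1" using inv_into_into[OF im] unfolding op_A_inv_def[symmetric] \<phi> by auto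
  have B: "op_A d (\<phi>\<^sub>1, \<phi>\<^sub>2) = ?one" using f_inv_into_f[OF im] unfolding op_A_inv_def[symmetric] \<phi> .
  have char: "log_potential (\<lambda>x. f\<^sub>1 x + f\<^sub>2 (x - d)) s = 1"
    if "op_A d (\<chi>\<^sub>1, \<chi>\<^sub>2) = ?one" "Lp_supp 1 f\<^sub>1" "Lp_supp 1 f\<^sub>2"
      "\<And>h. h \<in> borel_measurable borel \<Longrightarrow> (\<integral>t. h t * \<chi>\<^sub>1 t \<partial>?M) = (\<integral>t. h t * f\<^sub>1 t \<partial>lborel)"
      "\<And>h. h \<in> borel_measurable borel \<Longrightarrow> (\<integral>t. h t * \<chi>\<^sub>2 t \<partial>?M) = (\<integral>t. h t * f\<^sub>2 t \<partial>lborel)"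
      "s \<in> {-1..1} \<union> {d-1..d+1}" for \<chi>\<^sub>1 \<chi>\<^sub>2 f\<^sub>1 f\<^sub>2 s
  proof -
    let ?V = "log_potential (\<lambda>x. f\<^sub>1 x + f\<^sub>2 (x - d))"
    have eq: "(\<lambda>s\<in>{-1..1}. ?V s) = (\<lambda>s\<in>{-1..1}. 1)" "(\<lambda>s\<in>{-1..1}. ?V (d + s)) = (\<lambda>s\<in>{-1..1}. 1)"
      using op_A_eq_log_potential[OF that(2-5), of d] unfolding that(1) prod.inject by (metis, metis)
    show ?thesis
    proof (cases "s \<in> {-1..1}")
      case True
      then show ?thesis using fun_cong[OF eq(1), of s] by simp
    next
      case False
      then have "s - d \<in> {-1..1}" using that(6) by auto
      then show ?thesis using fun_cong[OF eq(2), of "s - d"] by simp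
    qed
  qed
  obtain f\<^sub>1 where f1: "Lp_supp 1 f\<^sub>1" "\<And>h. h \<in> borel_measurable borel \<Longrightarrow> (\<integral>t. h t * \<phi>\<^sub>1 t \<partial>?M) = (\<integral>t. h t * f\<^sub>1 t \<partial>lborel)"
    by (rule X1_borel_version[OF X(1)]) (rule that)
  obtain f\<^sub>2 where f2: "Lp_supp 1 f\<^sub>2" "\<And>h. h \<in> borel_measurable borel \<Longrightarrow> (\<integral>t. h t * \<phi>\<^sub>2 t \<partial>?M) = (\<integral>t. h t * f\<^sub>2 t \<partial>lborel)"
    by (rule X1_borel_version[OF X(2)]) (rule that)
  obtain g\<^sub>1 where g1: "Lp_supp 1 g\<^sub>1" "\<And>h. h \<in> borel_measurable borel \<Longrightarrow> (\<integral>t. h t * \<psi>\<^sub>1 t \<partial>?M) = (\<integral>t. h t * g\<^sub>1 t \<partial>lborel)"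
    by (rule X1_borel_version[OF \<psi>(1)]) (rule that)
  obtain g\<^sub>2 where g2: "Lp_supp 1 g\<^sub>2" "\<And>h. h \<in> borel_measurable borel \<Longrightarrow> (\<integral>t. h t * \<psi>\<^sub>2 t \<partial>?M) = (\<integral>t. h t * g\<^sub>2 t \<partial>lborel)"
    by (rule X1_borel_version[OF \<psi>(2)]) (rule that)
  note uniq = two_interval_masses_unique[OF d f1(1) f2(1) g1(1) g2(1)
      char[OF B f1(1) f2(1) f1(2) f2(2)] char[OF A g1(1) g2(1) g1(2) g2(2)]]
  have m1: "(\<integral>t. \<psi>\<^sub>1 t \<partial>?M) = 1 / ln (d / 2)"
    using eq_density_mass[OF d, of k] k1
    by (subst lebesgue_integral_eq_integral) (auto simp: integrable_lebesgue_on_iff \<psi>\<^sub>1_def)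
  have m2: "(\<integral>t. \<psi>\<^sub>2 t \<partial>?M) = 1 / ln (d / 2)"
    unfolding \<psi>\<^sub>2_def by (rule trans[OF integral_reflect_Ioo[of \<psi>\<^sub>1] m1])
  have "(\<integral>t. \<phi>\<^sub>1 t \<partial>?M) = 1 / ln (d / 2)"
    using f1(2)[of "\<lambda>_. 1", OF borel_measurable_const] g1(2)[of "\<lambda>_. 1", OF borel_measurable_const] uniq(1) m1
    by (simp only: mult_1_left)
  moreover have "(\<integral>t. \<phi>\<^sub>2 t \<partial>?M) = 1 / ln (d / 2)"
    using f2(2)[of "\<lambda>_. 1", OF borel_measurable_const] g2(2)[of "\<lambda>_. 1", OF borel_measurable_const] uniq(2) m2
    by (simp only: mult_1_left)
  ultimately have "alpha_vec d = (1 / ln (d / 2), 1 / ln (d / 2))"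
    unfolding alpha_vec_def \<phi> by simp
  then show ?thesis by (auto simp: alpha_def)
qed

section \<open>The explicit solution on the disk\<close>

lemma isCont_csqrt_0: "isCont csqrt 0"
proof -
  have "((\<lambda>z. sqrt (norm (z :: complex))) \<longlongrightarrow> sqrt (norm (0::complex))) (at 0)"
    by (intro tendsto_intros)
  then have "((\<lambda>z. norm (csqrt z)) \<longlongrightarrow> 0) (at 0)" by simp
  then have "(csqrt \<longlongrightarrow> 0) (at 0)" by (rule tendsto_norm_zero_cancel)
  then show ?thesis by (simp add: isCont_def)
qed

text \<open>The branch cut meets this half plane only at 0. The origin has to be included:
  \<open>1 - z * cis t\<close> vanishes at the end points of the arcs.\<close>

lemma continuous_on_csqrt_Re_nonneg: "continuous_on {z. Re z \<ge> 0} csqrt"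
proof (rule continuous_at_imp_continuous_on, rule ballI)
  fix z :: complex assume "z \<in> {z. Re z \<ge> 0}"
  then show "isCont csqrt z"
    using continuous_at_csqrt[of z] isCont_csqrt_0
    by (cases "z = 0") (force simp: complex_nonpos_Reals_iff complex_eq_iff)+
qed

text \<open>Factor \<open>a - x\<close> as a difference of squares. Both principal roots have
  non-negative real part, so the sum of the roots cannot be smaller than
  \<open>Re (csqrt x)\<close>, which is at least \<open>sqrt (norm x / 2)\<close>.\<close>

lemma norm_csqrt_diff_le:
  assumes "Re x \<ge> 0" "x \<noteq> 0"
  shows "norm (csqrt a - csqrt x) \<le> norm (a - x) / sqrt (norm x / 2)"
proof -
  have pos: "0 < sqrt (norm x / 2)" using assms by simp
  have "sqrt (norm x / 2) \<le> Re (csqrt x)" using assms by simp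
  also have "\<dots> \<le> Re (csqrt a + csqrt x)" using Re_csqrt[of a] by (simp del: csqrt.simps)
  also have "\<dots> \<le> norm (csqrt a + csqrt x)" by (rule complex_Re_le_cmod)
  finally have le: "sqrt (norm x / 2) \<le> norm (csqrt a + csqrt x)" .
  have "a - x = (csqrt a)\<^sup>2 - (csqrt x)\<^sup>2" by simp
  also have "\<dots> = (csqrt a - csqrt x) * (csqrt a + csqrt x)" by (simp add: power2_eq_square algebra_simps)
  finally have "norm (a - x) = norm (csqrt a - csqrt x) * norm (csqrt a + csqrt x)" by (simp add: norm_mult)
  also have "\<dots> \<ge> norm (csqrt a - csqrt x) * sqrt (norm x / 2)"
    by (intro mult_left_mono le) simp
  finally show ?thesis using pos by (simp add: field_simps)
qed

lemma Re_mult_cis_le: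
  assumes "norm z \<le> 1"
  shows "Re (z * cis t) \<le> 1"
  using complex_Re_le_cmod[of "z * cis t"] assms by (simp add: norm_mult)

lemma one_minus_mult_cis_notin_nonpos:
  assumes "norm z \<le> 1" "1 - z * cis t \<noteq> 0"
  shows "1 - z * cis t \<notin> \<real>\<^sub>\<le>\<^sub>0"
proof
  assume "1 - z * cis t \<in> \<real>\<^sub>\<le>\<^sub>0"
  then have "Re (1 - z * cis t) \<le> 0" "Im (1 - z * cis t) = 0" by (simp_all add: complex_nonpos_Reals_iff)
  then have "1 - z * cis t = 0"
    using Re_mult_cis_le[OF assms(1), of t] by (intro complex_eqI) auto
  with assms show False by simp
qed

text \<open>In the notation of the header, with the arcs \<open>a \<le> \<bar>arg z\<bar> \<le> b\<close>: \<open>pole_part\<close> is \<open>P\<close>, \<open>root_part\<close> is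
  \<open>R\<close> and \<open>arc_fun\<close> is \<open>P + R\<close>. The four square roots have arguments with positive real part in the
  disk, which fixes a holomorphic branch of \<open>R\<close>.\<close>

definition pole_part :: "real \<Rightarrow> real \<Rightarrow> complex \<Rightarrow> complex" where
  "pole_part a b z = (z\<^sup>2 - of_real (cos a + cos b) * z + 1) / 2"

definition root_part :: "real \<Rightarrow> real \<Rightarrow> complex \<Rightarrow> complex" where
  "root_part a b z = csqrt (1 - z * cis a) * csqrt (1 - z * cis (- a)) *
     csqrt (1 - z * cis b) * csqrt (1 - z * cis (- b)) / 2"

definition arc_fun :: "real \<Rightarrow> real \<Rightarrow> complex \<Rightarrow> complex" where
  "arc_fun a b z = pole_part a b z + root_part a b z"

text \<open>Half the length of the interval from \<open>cos b\<close> to \<open>cos a\<close> onto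
  which the Joukowski map sends the arcs.\<close>

definition arc_radius :: "real \<Rightarrow> real \<Rightarrow> real" where
  "arc_radius a b = (cos a - cos b) / 2"

lemma one_minus_mult_cis_pair: "(1 - z * cis a) * (1 - z * cis (- a)) = z\<^sup>2 - 2 * of_real (cos a) * z + 1"
proof -
  have "cis a * cis (- a) = 1" by (simp add: cis_mult)
  moreover have "cis a + cis (- a) = 2 * of_real (cos a)" by (simp add: complex_eq_iff)
  ultimately show ?thesis by (simp add: power2_eq_square algebra_simps) (metis distrib_left mult.left_commute)
qed

lemma root_part_square: "(root_part a b z)\<^sup>2 = (pole_part a b z)\<^sup>2 - (of_real (arc_radius a b) * z)\<^sup>2"
proof -
  have "(root_part a b z)\<^sup>2 = ((1 - z * cis a) * (1 - z * cis (- a))) * ((1 - z * cis b) * (1 - z * cis (- b))) / 4"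
    by (simp add: root_part_def power_mult_distrib power_divide mult_ac)
  also have "\<dots> = (pole_part a b z - of_real (arc_radius a b) * z) * (pole_part a b z + of_real (arc_radius a b) * z)"
    unfolding one_minus_mult_cis_pair by (simp add: pole_part_def arc_radius_def field_simps)
  finally show ?thesis by (simp add: power2_eq_square algebra_simps)
qed

lemma arc_fun_mult: "arc_fun a b z * (pole_part a b z - root_part a b z) = (of_real (arc_radius a b) * z)\<^sup>2"
  using root_part_square[of a b z] by (simp add: arc_fun_def power2_eq_square algebra_simps)

text \<open>By \<open>arc_fun_mult\<close> the function divides \<open>(r z)^2\<close>, so it could
  vanish only at 0, where its value is 1.\<close>

lemma arc_fun_nonzero:
  assumes "arc_radius a b \<noteq> 0"
  shows "arc_fun a b z \<noteq> 0"
proof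
  assume 0: "arc_fun a b z = 0"
  then have "z = 0" using arc_fun_mult[of a b z] assms by simp
  then show False using 0 by (simp add: arc_fun_def pole_part_def root_part_def)
qed

lemma arc_fun_continuous_on: "continuous_on (cball 0 1) (arc_fun a b)"
proof -
  have "continuous_on (cball 0 1) (\<lambda>z. csqrt (1 - z * cis t))" for t
    by (rule continuous_on_compose2[OF continuous_on_csqrt_Re_nonneg])
       (auto intro!: continuous_intros simp: Re_mult_cis_le simp del: times_complex.sel)
  then show ?thesis
    unfolding arc_fun_def[abs_def] pole_part_def root_part_def by (intro continuous_intros) auto
qed

lemma arc_fun_holomorphic_on: "arc_fun a b holomorphic_on ball 0 1"
proof -
  have "1 - z * cis t \<notin> \<real>\<^sub>\<le>\<^sub>0" if "z \<in> ball 0 1" for z t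
  proof (rule one_minus_mult_cis_notin_nonpos)
    show "1 - z * cis t \<noteq> 0"
    proof
      assume "1 - z * cis t = 0"
      then have "z * cis t = 1" by simp
      then have "norm (z * cis t) = 1" by (simp only: norm_one)
      then show False using that by (simp add: norm_mult)
    qed
  qed (use that in auto)
  then show ?thesis unfolding arc_fun_def[abs_def] pole_part_def root_part_def
    by (intro holomorphic_intros) auto
qed

text \<open>On the unit circle the Joukowski map is the cosine, so \<open>pole_part\<close> divided
  by \<open>cis t\<close> is real.\<close>

lemma pole_part_cis: "pole_part a b (cis t) = cis t * of_real (cos t - (cos a + cos b) / 2)"
proof -
  have "(cis t)\<^sup>2 + 1 = cis t * (cis t + cis (- t))" 
    by (simp add: distrib_left cis_mult power2_eq_square)
  also have "cis t + cis (- t) = 2 * of_real (cos t)" by (simp add: complex_eq_iff)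
  finally have "(cis t)\<^sup>2 + 1 = 2 * cis t * of_real (cos t)" by simp
  moreover have "pole_part a b (cis t) = ((cis t)\<^sup>2 + 1 - of_real (cos a + cos b) * cis t) / 2"
    by (simp add: pole_part_def)
  ultimately show ?thesis by (simp add: field_simps)
qed

lemma root_part_cis: "(root_part a b (cis t))\<^sup>2 = (cis t)\<^sup>2 * of_real ((cos t - (cos a + cos b) / 2)\<^sup>2 - (arc_radius a b)\<^sup>2)"
  unfolding root_part_square pole_part_cis power_mult_distrib of_real_diff of_real_power
  by (simp add: right_diff_distrib mult.commute)

lemma square_nonpos_Re_zero:
  fixes w :: complex and c :: real
  assumes "w\<^sup>2 = of_real c" "c \<le> 0"
  shows "Re w = 0" "(Im w)\<^sup>2 = - c"
proof -
  have "Re (w\<^sup>2) = c" "Im (w\<^sup>2) = 0" unfolding assms(1) by simp_all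
  then have 1: "(Re w)\<^sup>2 - (Im w)\<^sup>2 = c" "Re w = 0 \<or> Im w = 0"
    using \<open>Re (w\<^sup>2) = c\<close> \<open>Im (w\<^sup>2) = 0\<close> by (auto simp: power2_eq_square)
  show "Re w = 0"
  proof (cases "Im w = 0")
    case True
    then have "(Re w)\<^sup>2 \<le> 0" using 1 assms(2) by simp
    then show ?thesis by simp
  qed (use 1 in simp)
  then show "(Im w)\<^sup>2 = - c" using 1 by simp
qed

text \<open>On the arcs \<open>R / z\<close> has non-positive square and is imaginary, while
  \<open>P / z\<close> is the real number \<open>?x\<close>; the squared modulus is
  \<open>?x\<^sup>2 + (r\<^sup>2 - ?x\<^sup>2)\<close>.\<close>

lemma norm_hpart_arc:
  assumes "cos b \<le> cos t" "cos t \<le> cos a"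
  shows "norm (arc_fun a b (cis t)) = arc_radius a b"
proof -
  let ?x = "cos t - (cos a + cos b) / 2"
  define w where "w = root_part a b (cis t) / cis t"
  have x: "\<bar>?x\<bar> \<le> arc_radius a b" using assms by (simp add: arc_radius_def abs_le_iff field_simps)
  have w2: "w\<^sup>2 = of_real (?x\<^sup>2 - (arc_radius a b)\<^sup>2)"
    by (simp add: w_def power_divide root_part_cis)
  moreover have le: "?x\<^sup>2 - (arc_radius a b)\<^sup>2 \<le> 0" using x by (simp add: abs_le_square_iff[symmetric])
  ultimately have w: "Re w = 0" "(Im w)\<^sup>2 = - (?x\<^sup>2 - (arc_radius a b)\<^sup>2)" using square_nonpos_Re_zero by blast+
  have "arc_fun a b (cis t) = cis t * (of_real ?x + w)"
    by (simp add: arc_fun_def pole_part_cis w_def field_simps)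
  then have "norm (arc_fun a b (cis t)) = norm (of_real ?x + w)" by (simp add: norm_mult)
  also have "\<dots> = sqrt (?x\<^sup>2 + (Im w)\<^sup>2)" using w(1) by (simp add: cmod_def)
  also have "\<dots> = \<bar>arc_radius a b\<bar>" unfolding w(2) by simp
  finally show ?thesis using x by simp
qed

lemma ln_norm_has_real_derivative:
  fixes F :: "complex \<Rightarrow> complex"
  assumes F: "(F has_field_derivative D) (at z)" and nz: "\<And>w. F w \<noteq> 0"
  shows "((\<lambda>t. ln (norm (F (z + of_real t * z)))) has_real_derivative Re (z * D / F z)) (at 0)"
proof -
  \<comment> \<open>Division by \<open>F z\<close> moves the value at \<open>z\<close> to 1, off the
    branch cut of \<open>Ln\<close>.\<close>
  have "((\<lambda>w. Ln (F w / F z)) has_field_derivative D / F z) (at z)"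
    using nz[of z] by (auto intro!: derivative_eq_intros F)
  then have 1: "((\<lambda>w. Ln (F w / F z)) has_field_derivative D / F z) (at ((\<lambda>t. z + of_real t * z) 0))" by simp
  have "((\<lambda>t. z + of_real t * z) has_vector_derivative z) (at 0)"
    by (auto intro!: derivative_eq_intros has_vector_derivative_real_field)
  from field_vector_diff_chain_at[OF this 1] 
  have "((\<lambda>t. Ln (F (z + of_real t * z) / F z)) has_vector_derivative z * (D / F z)) (at 0)"
    by (simp add: o_def)
  then have "((\<lambda>t. Re (Ln (F (z + of_real t * z) / F z))) has_vector_derivative Re (z * (D / F z))) (at 0)"
    by (rule bounded_linear.has_vector_derivative[OF bounded_linear_Re])
  then have "((\<lambda>t. Re (Ln (F (z + of_real t * z) / F z)) + ln (norm (F z))) has_real_derivative Re (z * (D / F z))) (at 0)"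
    unfolding has_real_derivative_iff_has_vector_derivative[symmetric]
    using DERIV_add[OF _ DERIV_const] by fastforce
  also have "(\<lambda>t. Re (Ln (F (z + of_real t * z) / F z)) + ln (norm (F z))) = (\<lambda>t. ln (norm (F (z + of_real t * z))))"
    using nz by (auto simp: norm_divide ln_div)
  finally show ?thesis by simp
qed

text \<open>Off the arcs the logarithmic derivative is \<open>1 + (z P' - P) / R\<close>. On the
  circle \<open>(z P' - P) / z = \<i> sin t\<close> while \<open>(R / z)^2\<close> is positive, so
  the quotient is imaginary. Halved, the value 1 compensates the normal derivative -1/2 of
  \<open>(1 - |x|^2) / 4\<close>.\<close>

lemma arc_fun_normal_derivative:
  assumes ab: "arc_radius a b > 0" and t: "cos t < cos b \<or> cos a < cos t"
  shows "((\<lambda>x. ln (norm (arc_fun a b (cis t + of_real x * cis t)))) has_real_derivative 1) (at 0)"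
proof -
  let ?z = "cis t" and ?m = "(cos a + cos b) / 2" and ?r = "arc_radius a b"
  let ?P = "pole_part a b ?z" and ?R = "root_part a b ?z"
  have "\<bar>?r\<bar> < \<bar>cos t - ?m\<bar>" using t ab by (auto simp: arc_radius_def abs_if field_simps)
  then have c: "(cos t - ?m)\<^sup>2 - ?r\<^sup>2 > 0" using power2_strict_mono[of ?r "cos t - ?m"] by simp
  then have R2: "?R\<^sup>2 \<noteq> 0" unfolding root_part_cis by (simp del: of_real_diff of_real_power)
  then have R0: "?R \<noteq> 0" by auto
  then have nz: "1 - ?z * cis a \<noteq> 0" "1 - ?z * cis (- a) \<noteq> 0" "1 - ?z * cis b \<noteq> 0" "1 - ?z * cis (- b) \<noteq> 0"
    by (auto simp: root_part_def)
  then have np: "1 - ?z * cis a \<notin> \<real>\<^sub>\<le>\<^sub>0" "1 - ?z * cis (- a) \<notin> \<real>\<^sub>\<le>\<^sub>0"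
      "1 - ?z * cis b \<notin> \<real>\<^sub>\<le>\<^sub>0" "1 - ?z * cis (- b) \<notin> \<real>\<^sub>\<le>\<^sub>0"
    using one_minus_mult_cis_notin_nonpos[of ?z] by simp_all
  have ex: "\<exists>D. ((\<lambda>z. csqrt (1 - z * cis s)) has_field_derivative D) (at ?z)" if "1 - ?z * cis s \<notin> \<real>\<^sub>\<le>\<^sub>0" for s
  proof -
    have "((\<lambda>z. 1 - z * cis s) has_field_derivative - cis s) (at ?z)"
      by (auto intro!: derivative_eq_intros)
    from has_field_derivative_csqrt'[OF this that] show ?thesis ..
  qed
  obtain D1 D2 D3 D4 where 
    "((\<lambda>z. csqrt (1 - z * cis a)) has_field_derivative D1) (at ?z)"
    "((\<lambda>z. csqrt (1 - z * cis (- a))) has_field_derivative D2) (at ?z)"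
    "((\<lambda>z. csqrt (1 - z * cis b)) has_field_derivative D3) (at ?z)"
    "((\<lambda>z. csqrt (1 - z * cis (- b))) has_field_derivative D4) (at ?z)"
    using ex[OF np(1)] ex[OF np(2)] ex[OF np(3)] ex[OF np(4)] by blast
  from DERIV_cdivide[OF DERIV_mult[OF DERIV_mult[OF DERIV_mult[OF this(1,2)] this(3)] this(4)], of 2]
  have "\<exists>D. (root_part a b has_field_derivative D) (at ?z)"
    unfolding root_part_def[abs_def] ..
  then obtain D where D: "(root_part a b has_field_derivative D) (at ?z)" ..
  define P' where "P' = ?z - of_real ?m"
  have dP: "(pole_part a b has_field_derivative P') (at ?z)"
    unfolding pole_part_def[abs_def] P'_def by (auto intro!: derivative_eq_intros simp: field_simps)
  \<comment> \<open>Differentiating the square in two ways yields \<open>R * D\<close> without ever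
    computing the derivatives of the four roots.\<close>
  have "((\<lambda>z. (root_part a b z)\<^sup>2) has_field_derivative 2 * ?R * D) (at ?z)"
    by (auto intro!: derivative_eq_intros D)
  moreover have "((\<lambda>z. (root_part a b z)\<^sup>2) has_field_derivative 2 * ?P * P' - 2 * (of_real ?r)\<^sup>2 * ?z) (at ?z)"
    unfolding root_part_square by (auto intro!: derivative_eq_intros dP simp: power2_eq_square)
  ultimately have "2 * ?R * D = 2 * ?P * P' - 2 * (of_real ?r)\<^sup>2 * ?z" by (rule DERIV_unique)
  then have "2 * (?R * D) = 2 * (?P * P' - (of_real ?r)\<^sup>2 * ?z)" by (simp only: mult.assoc right_diff_distrib)
  then have RD: "?R * D = ?P * P' - (of_real ?r)\<^sup>2 * ?z" by (simp only: mult_cancel_left) simp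
  have dH: "(arc_fun a b has_field_derivative P' + D) (at ?z)"
    unfolding arc_fun_def[abs_def] by (intro derivative_intros dP D)
  have H0: "arc_fun a b w \<noteq> 0" for w using arc_fun_nonzero[of a b] ab by simp
  have hm: "(of_real ?r * ?z)\<^sup>2 = (?P + ?R) * (?P - ?R)" using arc_fun_mult[of a b ?z] by (simp add: arc_fun_def)
  \<comment> \<open>Replacing \<open>(r z)^2\<close> by \<open>(P + R) (P - R)\<close> lets
    \<open>arc_fun\<close> be factored out and cancelled.\<close>
  have "?R * (?z * (P' + D)) = ?z * P' * ?R + ?z * (?R * D)" by (simp add: algebra_simps)
  also have "\<dots> = ?z * P' * (?P + ?R) - (of_real ?r * ?z)\<^sup>2"
    unfolding RD by (simp add: algebra_simps power2_eq_square)
  also have "\<dots> = (?P + ?R) * (?z * P' - ?P + ?R)" unfolding hm by (simp add: algebra_simps)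
  finally have "?z * (P' + D) / arc_fun a b ?z = (?z * P' - ?P + ?R) / ?R"
    using R0 H0[of ?z] by (simp add: arc_fun_def field_simps)
  then have eq: "?z * (P' + D) / arc_fun a b ?z = 1 + (?z * P' - ?P) / ?R" using R0 by (simp add: field_simps)
  define w where "w = (?z * P' - ?P) / ?R"
  have zz: "?z\<^sup>2 - 1 = ?z * (2 * \<i> * of_real (sin t))"
  proof -
    have "?z\<^sup>2 - 1 = ?z * (cis t - cis (- t))" by (simp add: right_diff_distrib cis_mult power2_eq_square)
    also have "cis t - cis (- t) = 2 * \<i> * of_real (sin t)" by (simp add: complex_eq_iff)
    finally show ?thesis .
  qed
  have "?z * P' - ?P = (?z\<^sup>2 - 1) / 2" by (simp add: P'_def pole_part_def power2_eq_square field_simps)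
  then have "?z * P' - ?P = ?z * (\<i> * of_real (sin t))" unfolding zz by simp
  then have "w\<^sup>2 = (?z * (\<i> * of_real (sin t)))\<^sup>2 / (?z\<^sup>2 * of_real ((cos t - ?m)\<^sup>2 - ?r\<^sup>2))"
    by (simp only: w_def power_divide root_part_cis)
  also have "\<dots> = of_real (- (sin t)\<^sup>2 / ((cos t - ?m)\<^sup>2 - ?r\<^sup>2))"
    by (simp add: power_mult_distrib)
  finally have "Re w = 0" by (rule square_nonpos_Re_zero) (use c in simp)
  then have "Re (?z * (P' + D) / arc_fun a b ?z) = 1" unfolding eq w_def[symmetric] by simp
  with ln_norm_has_real_derivative[OF dH H0] show ?thesis by simp
qed


section \<open>Quantitative estimates as the arcs shrink\<close>

lemma one_minus_cos_le: "1 - cos x \<le> x\<^sup>2 / 2" for x :: real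
proof -
  have "1 - cos x = 2 * (sin (x / 2))\<^sup>2" using cos_double_sin[of "x / 2"] by simp
  also have "(sin (x / 2))\<^sup>2 \<le> (x / 2)\<^sup>2" using abs_sin_x_le_abs_x[of "x / 2"] by (simp only: abs_le_square_iff)
  finally show ?thesis by (simp add: power2_eq_square)
qed

lemma norm_cis_diff_le: "norm (cis x - cis y) \<le> \<bar>x - y\<bar>"
proof -
  have "(norm (cis x - cis y))\<^sup>2 = 2 * (1 - cos (x - y))"
    by (simp add: cmod_power2 cos_diff power2_diff) (simp add: sin_squared_eq algebra_simps)
  also have "\<dots> \<le> \<bar>x - y\<bar>\<^sup>2" using one_minus_cos_le[of "x - y"] by simp
  finally show ?thesis by (rule power2_le_imp_le) simp
qed

lemma abs_ln_diff_le:
  fixes x y :: real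
  assumes "y > 0" "\<bar>x - y\<bar> \<le> e" "e \<le> y / 2"
  shows "\<bar>ln x - ln y\<bar> \<le> 2 * e / y"
proof -
  have x: "x \<ge> y / 2" "x > 0" using assms by auto
  have "ln (x / y) \<le> x / y - 1" using assms x by (intro ln_le_minus_one) auto
  also have "\<dots> = (x - y) / y" using assms by (simp add: field_simps)
  also have "\<dots> \<le> e / y" using assms by (intro divide_right_mono) auto
  also have "\<dots> \<le> 2 * e / y" using assms by (simp add: divide_right_mono)
  finally have 1: "ln x - ln y \<le> 2 * e / y" using assms x by (simp add: ln_div)
  have "ln (y / x) \<le> y / x - 1" using assms x by (intro ln_le_minus_one) auto
  also have "\<dots> = (y - x) / x" using x by (simp add: field_simps)
  also have "\<dots> \<le> e / x" using assms x by (intro divide_right_mono) auto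
  also have "\<dots> \<le> e / (y / 2)" using assms x by (intro divide_left_mono) auto
  finally have 2: "ln y - ln x \<le> 2 * e / y" using assms x by (simp add: ln_div mult.commute)
  show ?thesis using 1 2 by simp
qed

text \<open>From \<open>x * cos x \<le> sin x \<le> x\<close>, the difference of the logarithms is
  at most \<open>- ln (cos x)\<close>, and \<open>cos x \<ge> 1/2\<close> in this range.\<close>

lemma abs_ln_sin_diff_le:
  fixes x :: real
  assumes "0 < x" "x \<le> 1"
  shows "\<bar>ln (sin x) - ln x\<bar> \<le> x"
proof -
  have sq: "x\<^sup>2 \<le> x" using assms by (simp add: power2_eq_square)
  have c: "cos x \<ge> 1 / 2" using one_minus_cos_le[of x] sq assms by simp
  have pi: "x < pi" using assms pi_gt3 by simp
  then have s: "sin x > 0" using assms by (intro sin_gt_zero) auto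
  have "ln (1 / cos x) \<le> 1 / cos x - 1" using c by (intro ln_le_minus_one) auto
  also have "\<dots> = (1 - cos x) / cos x" using c by (simp add: field_simps)
  also have "\<dots> \<le> (x\<^sup>2 / 2) / (1 / 2)" using c one_minus_cos_le[of x] by (intro frac_le) auto
  also have "\<dots> \<le> x" using sq by simp
  finally have "- ln (cos x) \<le> x" using c by (simp add: ln_div)
  moreover have "ln (x * cos x) \<le> ln (sin x)"
    using mult_cos_le_sin[of x] assms pi c s by (simp add: ln_mono)
  moreover have "ln (x * cos x) = ln x + ln (cos x)" using assms c by (intro ln_mult_pos) auto
  moreover have "ln (sin x) \<le> ln x" using sin_x_le_x[of x] assms s by simp
  ultimately show ?thesis by simp
qed

lemma norm_mult_diff_le:
  fixes x y :: "'a::real_normed_algebra"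
  assumes "norm (x - x') \<le> d" "norm (y - y') \<le> e" "norm y \<le> K" "norm x' \<le> L" "d \<ge> 0" "L \<ge> 0"
  shows "norm (x * y - x' * y') \<le> d * K + L * e"
proof -
  have "x * y - x' * y' = (x - x') * y + x' * (y - y')" by (simp add: algebra_simps)
  also have "norm \<dots> \<le> norm ((x - x') * y) + norm (x' * (y - y'))" by (rule norm_triangle_ineq)
  also have "\<dots> \<le> norm (x - x') * norm y + norm x' * norm (y - y')"
    by (intro add_mono norm_mult_ineq)
  also have "\<dots> \<le> d * K + L * e" using assms by (intro add_mono mult_mono) auto
  finally show ?thesis .
qed

lemma arc_radius_symmetric: "arc_radius (\<theta> - \<epsilon>) (\<theta> + \<epsilon>) = sin \<theta> * sin \<epsilon>"
  by (simp add: arc_radius_def cos_diff cos_add)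

text \<open>For \<open>\<epsilon> = 0\<close> the four roots pair up into squares, and
  \<open>pole_part\<close> and \<open>root_part\<close> both equal half of \<open>?D\<close>. The
  distance hypotheses keep the roots Lipschitz in the angle.\<close>

lemma norm_hpart_minus_product_le:
  assumes z: "norm z \<le> 1" and \<epsilon>: "0 \<le> \<epsilon>" "\<epsilon> \<le> 1" and c: "c > 0"
    and far: "norm (1 - z * cis \<theta>) \<ge> c" "norm (1 - z * cis (- \<theta>)) \<ge> c"
  shows "norm (arc_fun (\<theta> - \<epsilon>) (\<theta> + \<epsilon>) z - (1 - z * cis \<theta>) * (1 - z * cis (- \<theta>))) \<le> (1 + 16 / sqrt (c / 2)) * \<epsilon>"
proof -
  let ?s = "\<lambda>t. csqrt (1 - z * cis t)"
  let ?D = "(1 - z * cis \<theta>) * (1 - z * cis (- \<theta>))"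
  define \<delta> where "\<delta> = \<epsilon> / sqrt (c / 2)"
  have d0: "\<delta> \<ge> 0" using \<epsilon> c by (simp add: \<delta>_def)
  have bd: "norm (?s t) \<le> 2" for t
  proof -
    have "norm (1 - z * cis t) \<le> norm (1::complex) + norm (z * cis t)" by (rule norm_triangle_ineq4)
    also have "\<dots> \<le> 2" using z by (simp add: norm_mult)
    finally have "norm (1 - z * cis t) \<le> 2\<^sup>2" by simp
    then show ?thesis unfolding norm_csqrt by (intro real_le_lsqrt) auto
  qed
  have near: "norm (?s t - ?s t') \<le> \<delta>" if "\<bar>t - t'\<bar> \<le> \<epsilon>" "norm (1 - z * cis t') \<ge> c" for t t'
  proof -
    have "1 - z * cis t' \<noteq> 0" using that(2) c by auto
    moreover have "Re (1 - z * cis t') \<ge> 0" using Re_mult_cis_le[OF z, of t'] by simp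
    ultimately have "norm (?s t - ?s t') \<le> norm ((1 - z * cis t) - (1 - z * cis t')) / sqrt (norm (1 - z * cis t') / 2)"
      by (intro norm_csqrt_diff_le)
    also have "\<dots> \<le> \<epsilon> / sqrt (c / 2)"
    proof (rule frac_le)
      have "norm ((1 - z * cis t) - (1 - z * cis t')) = norm z * norm (cis t' - cis t)"
        by (simp add: norm_mult[symmetric] algebra_simps)
      also have "\<dots> \<le> 1 * \<bar>t' - t\<bar>" using z norm_cis_diff_le by (intro mult_mono) auto
      finally show "norm ((1 - z * cis t) - (1 - z * cis t')) \<le> \<epsilon>" using that(1) by simp
    qed (use c that \<epsilon> in auto)
    finally show ?thesis by (simp add: \<delta>_def)
  qed
  have 1: "norm (?s (\<theta> - \<epsilon>) * ?s (- (\<theta> - \<epsilon>)) - ?s \<theta> * ?s (- \<theta>)) \<le> \<delta> * 2 + 2 * \<delta>"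
    by (rule norm_mult_diff_le) (use near far bd \<epsilon> d0 in auto)
  have 2: "norm (?s (\<theta> + \<epsilon>) * ?s (- (\<theta> + \<epsilon>)) - ?s \<theta> * ?s (- \<theta>)) \<le> \<delta> * 2 + 2 * \<delta>"
    by (rule norm_mult_diff_le) (use near far bd \<epsilon> d0 in auto)
  have pb: "norm (?s t * ?s t') \<le> 4" for t t'
    using mult_mono[OF bd[of t] bd[of t']] by (simp add: norm_mult)
  \<comment> \<open>Two pairs, each off by at most \<open>4 * \<delta>\<close> and of norm at most
    4, give \<open>32 * \<delta>\<close> for twice \<open>root_part\<close>: the origin of the
    16.\<close>
  have "norm ((?s (\<theta> - \<epsilon>) * ?s (- (\<theta> - \<epsilon>))) * (?s (\<theta> + \<epsilon>) * ?s (- (\<theta> + \<epsilon>))) - (?s \<theta> * ?s (- \<theta>)) * (?s \<theta> * ?s (- \<theta>)))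
     \<le> (\<delta> * 2 + 2 * \<delta>) * 4 + 4 * (\<delta> * 2 + 2 * \<delta>)"
    by (rule norm_mult_diff_le[OF 1 2 pb pb]) (use d0 in auto)
  also have "(?s (\<theta> - \<epsilon>) * ?s (- (\<theta> - \<epsilon>))) * (?s (\<theta> + \<epsilon>) * ?s (- (\<theta> + \<epsilon>))) = 2 * root_part (\<theta> - \<epsilon>) (\<theta> + \<epsilon>) z"
    by (simp add: root_part_def)
  also have "(?s \<theta> * ?s (- \<theta>)) * (?s \<theta> * ?s (- \<theta>)) = (?s \<theta>)\<^sup>2 * (?s (- \<theta>))\<^sup>2"
    by (simp only: power2_eq_square mult_ac)
  also have "\<dots> = 2 * (?D / 2)" by simp
  finally have "norm (2 * (root_part (\<theta> - \<epsilon>) (\<theta> + \<epsilon>) z - ?D / 2)) \<le> 32 * \<delta>"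
    unfolding right_diff_distrib[of "2::complex" "root_part (\<theta> - \<epsilon>) (\<theta> + \<epsilon>) z" "?D / 2"] by (rule order.trans) simp
  then have R: "norm (root_part (\<theta> - \<epsilon>) (\<theta> + \<epsilon>) z - ?D / 2) \<le> 16 * \<delta>" by (simp only: norm_mult) simp
  have "pole_part (\<theta> - \<epsilon>) (\<theta> + \<epsilon>) z - ?D / 2 = z * of_real (cos \<theta> * (1 - cos \<epsilon>))"
    unfolding one_minus_mult_cis_pair by (simp add: pole_part_def cos_add cos_diff field_simps)
  also have "norm \<dots> \<le> 1 * (1 * (1 - cos \<epsilon>))"
    unfolding norm_mult norm_of_real abs_mult using z by (intro mult_mono) auto
  also have "\<dots> \<le> \<epsilon>"
  proof -
    have "\<epsilon>\<^sup>2 \<le> \<epsilon>" using \<epsilon> by (simp add: power2_eq_square mult_left_le)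
    then show ?thesis using one_minus_cos_le[of \<epsilon>] \<epsilon> by simp
  qed
  finally have Q: "norm (pole_part (\<theta> - \<epsilon>) (\<theta> + \<epsilon>) z - ?D / 2) \<le> \<epsilon>" .
  have "arc_fun (\<theta> - \<epsilon>) (\<theta> + \<epsilon>) z - ?D = (pole_part (\<theta> - \<epsilon>) (\<theta> + \<epsilon>) z - ?D / 2) + (root_part (\<theta> - \<epsilon>) (\<theta> + \<epsilon>) z - ?D / 2)"
    by (simp add: arc_fun_def)
  also have "norm \<dots> \<le> \<epsilon> + 16 * \<delta>" by (rule norm_triangle_le) (use Q R in simp)
  also have "\<dots> = (1 + 16 / sqrt (c / 2)) * \<epsilon>" by (simp add: \<delta>_def algebra_simps)
  finally show ?thesis .
qed

section \<open>A comparison principle for the mixed problem\<close>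

lemma second_derivative_nonpos_at_local_max:
  fixes g g' :: "real \<Rightarrow> real"
  assumes \<rho>: "\<rho> > 0" and g: "\<And>t. \<bar>t\<bar> < \<rho> \<Longrightarrow> (g has_real_derivative g' t) (at t)"
    and g': "(g' has_real_derivative c) (at 0)"
    and max: "\<And>t. \<bar>t\<bar> < \<rho> \<Longrightarrow> g t \<le> g 0"
  shows "c \<le> 0"
proof (rule ccontr)
  assume "\<not> c \<le> 0"
  then have c: "c > 0" by simp
  have "g' 0 = 0"
    by (rule DERIV_local_max[OF g[of 0] \<rho>]) (use \<rho> max in auto)
  obtain e where e: "e > 0" "\<And>h. h > 0 \<Longrightarrow> h < e \<Longrightarrow> g' 0 < g' (0 + h)"
    using DERIV_pos_inc_right[OF g' c] by blast
  define t where "t = min e \<rho> / 2"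
  have t: "0 < t" "t < e" "t < \<rho>" using e(1) \<rho> by (auto simp: t_def)
  obtain z where z: "0 < z" "z < t" "g t - g 0 = (t - 0) * g' z"
    using MVT2[OF t(1), of g g'] g t by auto
  have "g' z > 0" using e(2)[of z] z t \<open>g' 0 = 0\<close> by simp
  then have "g t > g 0" using z t by (simp add: zero_less_mult_iff algebra_simps)
  then show False using max[of t] t by simp
qed

lemma line_has_real_derivative:
  fixes f :: "real^'n::finite \<Rightarrow> real"
  assumes "f differentiable (at (x + t *\<^sub>R axis i 1))"
  shows "((\<lambda>t. f (x + t *\<^sub>R axis i 1)) has_real_derivative partial_deriv i f (x + t *\<^sub>R axis i 1)) (at t)"
proof -
  let ?y = "x + t *\<^sub>R axis i 1"
  have f: "(f has_derivative frechet_derivative f (at ?y)) (at ?y)"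
    using assms by (simp add: frechet_derivative_works)
  have "((\<lambda>t. x + t *\<^sub>R axis i 1) has_derivative (\<lambda>h. h *\<^sub>R axis i 1)) (at t)"
    by (auto intro!: derivative_eq_intros)
  from diff_chain_at[OF this f]
  have "((\<lambda>t. f (x + t *\<^sub>R axis i 1)) has_derivative (\<lambda>h. frechet_derivative f (at ?y) (h *\<^sub>R axis i 1))) (at t)"
    by (simp add: o_def)
  moreover have "frechet_derivative f (at ?y) (h *\<^sub>R axis i 1) = partial_deriv i f ?y * h" for h
    using linear_cmul[OF has_derivative_linear[OF f]] by (simp add: partial_deriv_def)
  ultimately show ?thesis by (simp add: has_field_derivative_def)
qed

lemma Re_holomorphic_line_has_real_derivative:
  assumes "(G has_field_derivative D) (at (z + of_real t * w))"
  shows "((\<lambda>t. Re (G (z + of_real t * w))) has_real_derivative Re (w * D)) (at t)"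
proof -
  have "((\<lambda>t. z + of_real t * w) has_vector_derivative w) (at t)"
    by (auto intro!: derivative_eq_intros has_vector_derivative_real_field)
  from field_vector_diff_chain_at[OF this] assms
  have "((\<lambda>t. G (z + of_real t * w)) has_vector_derivative w * D) (at t)"
    by (simp add: o_def)
  then have "((\<lambda>t. Re (G (z + of_real t * w))) has_vector_derivative Re (w * D)) (at t)"
    by (rule bounded_linear.has_vector_derivative[OF bounded_linear_Re])
  then show ?thesis by (simp add: has_real_derivative_iff_has_vector_derivative)
qed

definition rot :: "real \<Rightarrow> real^2 \<Rightarrow> complex" where
  "rot s x = cis (- s) * Complex (x $ 1) (x $ 2)"

lemma norm_rot [simp]: "norm (rot s x) = norm x"
  by (simp add: rot_def norm_mult complex_norm norm_vec_def L2_set_def sum_2)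

lemma rot_add: "rot s (x + y) = rot s x + rot s y"
  by (simp add: rot_def complex_eq_iff algebra_simps)

lemma rot_scaleR: "rot s (t *\<^sub>R x) = of_real t * rot s x"
  by (simp add: rot_def complex_eq_iff algebra_simps)

lemma rot_diff: "rot s (x - y) = rot s x - rot s y"
  by (simp add: rot_def complex_eq_iff algebra_simps)

lemma continuous_on_rot [continuous_intros]: "continuous_on S (rot s)"
proof -
  have "continuous_on S (\<lambda>x. cis (- s) * (of_real (x $ 1) + \<i> * of_real (x $ 2)))"
    by (intro continuous_intros)
  then show ?thesis by (simp add: rot_def[abs_def] Complex_eq)
qed

lemma rot_circle_pt: "rot s (circle_pt t) = cis (t - s)"
  by (simp add: rot_def circle_pt_def cis_mult[symmetric] complex_eq_iff cos_diff sin_diff)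

text \<open>Harmonicity of \<open>Re (G (rot s x))\<close>: by the chain rule its Laplacian is the
  real part of this sum times the second derivative of \<open>G\<close>.\<close>

lemma axis_squares_sum: "(rot s (axis 1 1))\<^sup>2 + (rot s (axis 2 1))\<^sup>2 = 0"
proof -
  have "rot s (axis 1 1) = cis (- s)" "rot s (axis 2 1) = cis (- s) * \<i>"
    by (simp_all add: rot_def axis_def complex_eq_iff)
  then show ?thesis by (simp add: power_mult_distrib)
qed

lemma norm_square_line: "(norm (x + t *\<^sub>R axis i 1 :: real^'n::finite))\<^sup>2 = (norm x)\<^sup>2 + 2 * t * (x $ i) + t\<^sup>2"
proof -
  have "(norm (x + t *\<^sub>R a))\<^sup>2 = (norm x)\<^sup>2 + 2 * t * (x \<bullet> a) + t\<^sup>2 * (norm a)\<^sup>2" for a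
    unfolding power2_norm_eq_inner inner_add_left inner_add_right inner_scaleR_left inner_scaleR_right
      inner_commute[of a x] by (simp add: power2_eq_square distrib_left)
  from this[of "axis i 1"] show ?thesis by (simp add: inner_axis)
qed

text \<open>Here \<open>a\<close> and \<open>b\<close> stand for \<open>u\<close> and
  \<open>v\<close> along a coordinate line, on which the squared norm is
  \<open>N + 2 * t * X + t\<^sup>2\<close>.\<close>

lemma quadratic_combination_derivs:
  fixes a b :: "real \<Rightarrow> real"
  assumes "(a has_real_derivative a') (at t)" "(b has_real_derivative b') (at t)"
  shows "((\<lambda>t. \<sigma> * (a t - 1/4 * (1 - (N + 2 * t * X + t\<^sup>2))) - K * b t + \<eta> * (N + 2 * t * X + t\<^sup>2))
      has_real_derivative \<sigma> * (a' + 1/4 * (2 * X + 2 * t)) - K * b' + \<eta> * (2 * X + 2 * t)) (at t)"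
    and "((\<lambda>t. \<sigma> * (a t + 1/4 * (2 * X + 2 * t)) - K * b t + \<eta> * (2 * X + 2 * t))
      has_real_derivative \<sigma> * (a' + 1/2) - K * b' + 2 * \<eta>) (at t)"
  by (auto intro!: derivative_eq_intros assms simp: algebra_simps)

text \<open>The comparison function \<open>v\<close> itself serves as the barrier: subtracting a small multiple of it
  makes the normal derivative on the reflecting part strictly negative, so that no Hopf lemma is
  needed.\<close>

lemma mixed_bvp_comparison:
  fixes u v :: "real^2 \<Rightarrow> real"
  assumes u: "mixed_bvp_solution \<Gamma> u" and \<Gamma>: "\<Gamma> \<subseteq> sphere 0 1" 
    and G: "G holomorphic_on ball 0 1" "\<And>x. x \<in> ball 0 1 \<Longrightarrow> v x = Re (G (rot s x))"
    and vc: "continuous_on (cball 0 1) v" and v0: "\<And>x. x \<in> \<Gamma> \<Longrightarrow> v x = 0"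
    and vn: "\<And>x. x \<in> sphere 0 1 - closure \<Gamma> \<Longrightarrow> has_normal_derivative v (1/2) x"
    and \<sigma>: "\<sigma>\<^sup>2 = 1" and \<delta>: "\<delta> > 0" and \<eta>: "0 < \<eta>" "4 * \<eta> < \<delta>" and y: "y \<in> cball 0 1"
  shows "\<sigma> * (u y - 1/4 * (1 - (norm y)\<^sup>2)) - (\<sigma> + \<delta>) * v y \<le> \<eta>"
proof -
  \<comment> \<open>The bracket is harmonic with normal derivative 1/2 on the reflecting part, and
    \<open>\<sigma>\<close> is a sign. The last term adds \<open>4 * \<eta>\<close> to the
    Laplacian, which excludes interior maxima, and \<open>2 * \<eta>\<close> to the normal
    derivative, which \<open>4 * \<eta> < \<delta>\<close> keeps below the gain
    \<open>\<delta> / 2\<close>.\<close>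
  define f where "f = (\<lambda>x. \<sigma> * (u x - 1/4 * (1 - (norm x)\<^sup>2)) - (\<sigma> + \<delta>) * v x + \<eta> * (norm x)\<^sup>2)"
  have uc: "continuous_on (cball 0 1) u" and C2: "C2_on (ball 0 1) u"
    and lap: "\<And>x. x \<in> ball 0 1 \<Longrightarrow> laplacian u x = -1" and u0: "\<And>x. x \<in> \<Gamma> \<Longrightarrow> u x = 0"
    and un: "\<And>x. x \<in> sphere 0 1 - closure \<Gamma> \<Longrightarrow> has_normal_derivative u 0 x"
    using u by (auto simp: mixed_bvp_solution_def)
  have fc: "continuous_on (cball 0 1) f"
    unfolding f_def by (intro continuous_intros uc vc)
  obtain x0 where x0: "x0 \<in> cball 0 1" "\<And>x. x \<in> cball 0 1 \<Longrightarrow> f x \<le> f x0"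
    using continuous_attains_sup[OF compact_cball _ fc] by auto
  have not_int: "x0 \<notin> ball 0 1"
  proof
    assume b: "x0 \<in> ball 0 1"
    define \<rho> where "\<rho> = 1 - norm x0"
    have \<rho>: "\<rho> > 0" using b by (simp add: \<rho>_def)
    define p where "p = (\<lambda>i t. x0 + t *\<^sub>R axis i 1 :: real^2)"
    have pb: "p i t \<in> ball 0 1" if "\<bar>t\<bar> < \<rho>" for i t
    proof -
      have "norm (p i t) \<le> norm x0 + norm (t *\<^sub>R axis i 1 :: real^2)" unfolding p_def by (rule norm_triangle_ineq)
      then show ?thesis using that by (simp add: \<rho>_def)
    qed
    define w where "w = (\<lambda>i::2. rot s (axis i 1))"
    define z where "z = rot s x0"
    have rp: "rot s (p i t) = z + of_real t * w i" for i t by (simp add: p_def z_def w_def rot_add rot_scaleR)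
    have zb: "z + of_real t * w i \<in> ball 0 1" if "\<bar>t\<bar> < \<rho>" for i t
      using pb[OF that, of i] by (simp flip: rp)
    have hG: "deriv G holomorphic_on ball 0 1" using G(1) by (rule holomorphic_deriv) simp
    \<comment> \<open>Second-derivative test along the \<open>i\<close>-th axis; adding both axes
      gives the Laplacian, where the contributions of \<open>G\<close> cancel.\<close>
    have c: "\<sigma> * (partial_deriv i (partial_deriv i u) x0 + 1/2) - (\<sigma> + \<delta>) * Re (w i * (w i * deriv (deriv G) z)) + 2 * \<eta> \<le> 0" for i
    proof (rule second_derivative_nonpos_at_local_max[OF \<rho>])
      let ?g = "\<lambda>t. \<sigma> * (u (p i t) - 1/4 * (1 - ((norm x0)\<^sup>2 + 2 * t * (x0 $ i) + t\<^sup>2))) 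
          - (\<sigma> + \<delta>) * Re (G (z + of_real t * w i)) + \<eta> * ((norm x0)\<^sup>2 + 2 * t * (x0 $ i) + t\<^sup>2)"
      let ?g' = "\<lambda>t. \<sigma> * (partial_deriv i u (p i t) + 1/4 * (2 * (x0 $ i) + 2 * t)) 
          - (\<sigma> + \<delta>) * Re (w i * deriv G (z + of_real t * w i)) + \<eta> * (2 * (x0 $ i) + 2 * t)"
      have feq: "f (p i t) = ?g t" if "\<bar>t\<bar> < \<rho>" for t
        using G(2)[OF pb[OF that, of i]] by (simp add: f_def p_def norm_square_line rp[unfolded p_def])
      show "?g t \<le> ?g 0" if "\<bar>t\<bar> < \<rho>" for t
        using feq[OF that] feq[of 0] \<rho> x0(2)[of "p i t"] pb[OF that, of i] by (simp add: p_def)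
      show "(?g has_real_derivative ?g' t) (at t)" if "\<bar>t\<bar> < \<rho>" for t
      proof -
        have "u differentiable (at (p i t))"
          using C2 pb[OF that, of i] unfolding C2_on_def differentiable_on_def 
          by (metis at_within_open open_ball)
        then have 1: "((\<lambda>t. u (p i t)) has_real_derivative partial_deriv i u (p i t)) (at t)"
          unfolding p_def by (rule line_has_real_derivative)
        have 2: "((\<lambda>t. Re (G (z + of_real t * w i))) has_real_derivative Re (w i * deriv G (z + of_real t * w i))) (at t)"
          by (rule Re_holomorphic_line_has_real_derivative) (rule holomorphic_derivI[OF G(1) open_ball zb[OF that]])
        show ?thesis
          by (rule quadratic_combination_derivs(1)[OF 1 2])
      qed
      have "partial_deriv i u differentiable (at (p i 0))"
        using C2 pb[of 0 i] \<rho> unfolding C2_on_def differentiable_on_def 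
        by (metis abs_zero at_within_open open_ball)
      then have 1: "((\<lambda>t. partial_deriv i u (p i t)) has_real_derivative partial_deriv i (partial_deriv i u) (p i 0)) (at 0)"
        unfolding p_def by (rule line_has_real_derivative)
      have "((\<lambda>t. Re ((\<lambda>\<zeta>. w i * deriv G \<zeta>) (z + of_real t * w i))) has_real_derivative 
           Re (w i * (w i * deriv (deriv G) (z + of_real 0 * w i)))) (at 0)"
      proof (rule Re_holomorphic_line_has_real_derivative)
        have "(deriv G has_field_derivative deriv (deriv G) (z + of_real 0 * w i)) (at (z + of_real 0 * w i))"
          using zb[of 0 i] \<rho> by (intro holomorphic_derivI[OF hG open_ball]) auto
        then show "((\<lambda>\<zeta>. w i * deriv G \<zeta>) has_field_derivative w i * deriv (deriv G) (z + of_real 0 * w i)) (at (z + of_real 0 * w i))"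
          by (rule DERIV_cmult)
      qed
      then have 2: "((\<lambda>t. Re (w i * deriv G (z + of_real t * w i))) has_real_derivative 
           Re (w i * (w i * deriv (deriv G) z))) (at 0)"
        by simp
      have p0: "p i 0 = x0" by (simp add: p_def)
      show "(?g' has_real_derivative \<sigma> * (partial_deriv i (partial_deriv i u) x0 + 1/2) - (\<sigma> + \<delta>) * Re (w i * (w i * deriv (deriv G) z)) + 2 * \<eta>) (at 0)"
        by (rule quadratic_combination_derivs(2)[OF 1[unfolded p0] 2])
    qed
    have "w 1 * (w 1 * deriv (deriv G) z) + w 2 * (w 2 * deriv (deriv G) z) = ((w 1)\<^sup>2 + (w 2)\<^sup>2) * deriv (deriv G) z"
      by (simp add: power2_eq_square algebra_simps)
    also have "\<dots> = 0" unfolding w_def axis_squares_sum by simp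
    finally have "w 2 * (w 2 * deriv (deriv G) z) = - (w 1 * (w 1 * deriv (deriv G) z))"
      by (simp add: eq_neg_iff_add_eq_0 add.commute)
    then have W: "Re (w 2 * (w 2 * deriv (deriv G) z)) = - Re (w 1 * (w 1 * deriv (deriv G) z))"
      by (simp only: uminus_complex.sel)
    have L: "partial_deriv 1 (partial_deriv 1 u) x0 + partial_deriv 2 (partial_deriv 2 u) x0 = -1"
      using lap[OF b] by (simp add: laplacian_def sum_2)
    have "\<sigma> * (partial_deriv 1 (partial_deriv 1 u) x0 + partial_deriv 2 (partial_deriv 2 u) x0 + 1) + 4 * \<eta> \<le> 0"
      using c[of 1] c[of 2] unfolding W by (simp add: algebra_simps)
    then show False unfolding L using \<eta> by simp
  qed
  then have sph: "x0 \<in> sphere 0 1" using x0(1) by (auto simp: dist_norm)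
  have "x0 \<in> closure \<Gamma>"
  proof (rule ccontr)
    assume "x0 \<notin> closure \<Gamma>"
    then have xs: "x0 \<in> sphere 0 1 - closure \<Gamma>" using sph by simp
    have nx: "norm x0 = 1" using sph by simp
    have d: "((\<lambda>t. f (x0 + t *\<^sub>R x0)) has_real_derivative
       (\<sigma> * (0 + 1/4 * 2) - (\<sigma> + \<delta>) * (1/2) + \<eta> * 2)) (at_left 0)"
    proof -
      have n: "(norm (x0 + t *\<^sub>R x0))\<^sup>2 = (1 + t)\<^sup>2" for t
      proof -
        have "x0 + t *\<^sub>R x0 = (1 + t) *\<^sub>R x0" by (simp add: scaleR_add_left)
        then show ?thesis using nx by simp
      qed
      have 1: "((\<lambda>t. u (x0 + t *\<^sub>R x0)) has_real_derivative 0) (at_left 0)"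
        and 2: "((\<lambda>t. v (x0 + t *\<^sub>R x0)) has_real_derivative 1/2) (at_left 0)"
        using un[OF xs] vn[OF xs] by (auto simp: has_normal_derivative_def)
      show ?thesis unfolding f_def n
        by (rule derivative_eq_intros 1 2 refl | simp)+
    qed
    \<comment> \<open>A negative outward derivative means that \<open>f\<close> increases on
      entering the disk, impossible at a maximum.\<close>
    have neg: "\<sigma> * (0 + 1/4 * 2) - (\<sigma> + \<delta>) * (1/2) + \<eta> * 2 < 0"
      using \<eta> by (simp add: algebra_simps)
    have "((\<lambda>t. (f (x0 + t *\<^sub>R x0) - f (x0 + 0 *\<^sub>R x0)) / (t - 0)) \<longlongrightarrow>
         (\<sigma> * (0 + 1/4 * 2) - (\<sigma> + \<delta>) * (1/2) + \<eta> * 2)) (at_left 0)"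
      using d by (simp only: has_field_derivative_iff)
    then have "eventually (\<lambda>t. (f (x0 + t *\<^sub>R x0) - f (x0 + 0 *\<^sub>R x0)) / (t - 0) < 0) (at_left 0)"
      by (rule order_tendstoD(2)[OF _ neg])
    moreover have "eventually (\<lambda>t::real. t \<in> {-1<..<0}) (at_left 0)"
      by (rule eventually_at_left_real) simp
    ultimately have "eventually (\<lambda>t::real. False) (at_left 0)"
    proof eventually_elim
      case (elim t)
      have "x0 + t *\<^sub>R x0 = (1 + t) *\<^sub>R x0" by (simp add: scaleR_add_left)
      then have "x0 + t *\<^sub>R x0 \<in> cball 0 1" using elim nx by simp
      from x0(2)[OF this] have "(f (x0 + t *\<^sub>R x0) - f (x0 + 0 *\<^sub>R x0)) / (t - 0) \<ge> 0"
        using elim by (intro divide_nonpos_neg) auto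
      then show False using elim by simp
    qed
    then show False by simp
  qed
  \<comment> \<open>Continuity carries the value from \<open>\<Gamma>\<close> to the arc end points,
    where neither boundary condition is prescribed.\<close>
  moreover have "f x = \<eta>" if "x \<in> closure \<Gamma>" for x
  proof (rule continuous_constant_on_closure[OF _ _ that])
    have "closure \<Gamma> \<subseteq> cball 0 1"
      using \<Gamma> by (intro closure_minimal) auto
    then show "continuous_on (closure \<Gamma>) f" using fc continuous_on_subset by blast
    fix x assume x: "x \<in> \<Gamma>"
    then have "norm x = 1" using \<Gamma> by auto
    then show "f x = \<eta>" using u0[OF x] v0[OF x] by (simp add: f_def)
  qed
  ultimately have "f x0 = \<eta>" by simp
  then have "f y \<le> \<eta>" using x0(2)[OF y] by simp
  moreover have "\<eta> * (norm y)\<^sup>2 \<ge> 0" using \<eta> by simp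
  ultimately show ?thesis by (simp add: f_def)
qed

text \<open>At a fixed point the comparison with \<open>\<eta> = \<delta> / 8\<close> bounds the
  signed difference by a fixed multiple of \<open>\<delta>\<close>; both signs and
  \<open>\<delta> \<rightarrow> 0\<close> finish.\<close>

lemma mixed_bvp_unique:
  fixes u v :: "real^2 \<Rightarrow> real"
  assumes u: "mixed_bvp_solution \<Gamma> u" and \<Gamma>: "\<Gamma> \<subseteq> sphere 0 1" 
    and G: "G holomorphic_on ball 0 1" "\<And>x. x \<in> ball 0 1 \<Longrightarrow> v x = Re (G (rot s x))"
    and vc: "continuous_on (cball 0 1) v" and v0: "\<And>x. x \<in> \<Gamma> \<Longrightarrow> v x = 0"
    and vn: "\<And>x. x \<in> sphere 0 1 - closure \<Gamma> \<Longrightarrow> has_normal_derivative v (1/2) x"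
    and y: "y \<in> cball 0 1"
  shows "u y = v y + 1/4 * (1 - (norm y)\<^sup>2)"
proof -
  let ?h = "u y - 1/4 * (1 - (norm y)\<^sup>2)"
  note cmp = mixed_bvp_comparison[OF u \<Gamma> G vc v0 vn _ _ _ _ y]
  have le: "\<sigma> * (?h - v y) \<le> \<delta> * (v y + 1)" if "\<sigma>\<^sup>2 = 1" "\<delta> > 0" for \<sigma> \<delta> :: real
  proof -
    have "\<sigma> * ?h - (\<sigma> + \<delta>) * v y \<le> \<delta> / 8"
      by (rule cmp) (use that in auto)
    then have "\<sigma> * (?h - v y) \<le> \<delta> * v y + \<delta> / 8" by (simp add: algebra_simps)
    also have "\<dots> \<le> \<delta> * (v y + 1)" using that by (simp add: algebra_simps)
    finally show ?thesis .
  qed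
  have lim: "x \<le> 0" if "\<And>\<delta>. \<delta> > 0 \<Longrightarrow> x \<le> \<delta> * K" for x K :: real
  proof (rule tendsto_lowerbound)
    show "((\<lambda>\<delta>. \<delta> * K) \<longlongrightarrow> 0) (at_right 0)" by (auto intro!: tendsto_eq_intros)
    show "eventually (\<lambda>\<delta>. x \<le> \<delta> * K) (at_right 0)"
      using that by (auto simp: eventually_at_right_field intro: exI[of _ 1])
  qed simp
  have "1 * (?h - v y) \<le> 0" by (rule lim) (rule le, auto)
  moreover have "(-1) * (?h - v y) \<le> 0" by (rule lim) (rule le, auto)
  ultimately show ?thesis by simp
qed

section \<open>The two-arc problem\<close>

lemma arc_radius_pos:
  assumes "0 \<le> a" "a < b" "b \<le> pi"
  shows "arc_radius a b > 0"
  using cos_monotone_0_pi[of a b] assms by (simp add: arc_radius_def)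

lemma continuous_on_circle_pt: "continuous_on S circle_pt"
proof -
  have "circle_pt t = cos t *\<^sub>R axis 1 1 + sin t *\<^sub>R axis 2 1" for t
    by (simp add: circle_pt_def vec_eq_iff forall_2 axis_def)
  then have eq: "circle_pt = (\<lambda>t. cos t *\<^sub>R axis 1 1 + sin t *\<^sub>R axis 2 1)" by (rule ext)
  show ?thesis unfolding eq by (intro continuous_intros)
qed

lemma circle_pt_in_closure_arc:
  assumes "\<epsilon> > 0" "\<bar>t - s\<bar> \<le> \<epsilon>"
  shows "circle_pt t \<in> closure (boundary_arc s \<epsilon>)"
proof -
  have "circle_pt ` closure {s - \<epsilon><..<s + \<epsilon>} \<subseteq> closure (boundary_arc s \<epsilon>)"
    by (rule image_closure_subset[OF continuous_on_circle_pt closed_closure])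
       (auto simp: boundary_arc_def intro: closure_subset[THEN subsetD])
  moreover have "t \<in> closure {s - \<epsilon><..<s + \<epsilon>}"
    using assms by (subst closure_greaterThanLessThan) auto
  ultimately show ?thesis by blast
qed

lemma norm_circle_pt: "norm (circle_pt t) = 1"
  using norm_rot[of t "circle_pt t"] by (simp only: rot_circle_pt) simp

lemma rot_inj: "rot s x = rot s y \<Longrightarrow> x = y"
  using norm_rot[of s "x - y"] by (simp add: rot_diff)

lemma cos_between_iff:
  assumes "0 \<le> a" "a \<le> b" "b \<le> pi" "\<bar>t\<bar> \<le> pi"
  shows "cos b \<le> cos t \<and> cos t \<le> cos a \<longleftrightarrow> a \<le> \<bar>t\<bar> \<and> \<bar>t\<bar> \<le> b"
proof -
  have "cos b \<le> cos \<bar>t\<bar> \<longleftrightarrow> \<bar>t\<bar> \<le> b" "cos \<bar>t\<bar> \<le> cos a \<longleftrightarrow> a \<le> \<bar>t\<bar>"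
    using assms by (intro cos_mono_le_eq; simp)+
  then show ?thesis by auto
qed

lemma mixed_bvp_two_arcs_explicit:
  assumes u: "mixed_bvp_solution (boundary_arc (s + \<theta>) \<epsilon> \<union> boundary_arc (s - \<theta>) \<epsilon>) u"
    and \<epsilon>: "0 < \<epsilon>" "\<epsilon> < \<theta>" "\<theta> + \<epsilon> < pi" and y: "y \<in> cball 0 1"
  shows "u y = 1/2 * (ln (norm (arc_fun (\<theta> - \<epsilon>) (\<theta> + \<epsilon>) (rot s y))) - ln (sin \<theta> * sin \<epsilon>)) + 1/4 * (1 - (norm y)\<^sup>2)"
proof -
  let ?\<Gamma> = "boundary_arc (s + \<theta>) \<epsilon> \<union> boundary_arc (s - \<theta>) \<epsilon>"
  let ?H = "arc_fun (\<theta> - \<epsilon>) (\<theta> + \<epsilon>)" and ?r = "arc_radius (\<theta> - \<epsilon>) (\<theta> + \<epsilon>)"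
  define v where "v = (\<lambda>x. 1/2 * (ln (norm (?H (rot s x))) - ln ?r))"
  have r: "?r > 0" using \<epsilon> by (intro arc_radius_pos) auto
  then have H0: "?H z \<noteq> 0" for z by (intro arc_fun_nonzero) simp
  \<comment> \<open>The disk is contractible and \<open>arc_fun\<close> has no zeros, so a
    holomorphic logarithm exists; its real part exhibits \<open>v\<close> in the form that
    uniqueness requires.\<close>
  obtain g where g: "g holomorphic_on ball 0 1" "\<And>z. z \<in> ball 0 1 \<Longrightarrow> ?H z = exp (g z)"
    using contractible_imp_holomorphic_log[OF arc_fun_holomorphic_on convex_imp_contractible[OF convex_ball] H0] by metis
  have "u y = v y + 1/4 * (1 - (norm y)\<^sup>2)"
  proof (rule mixed_bvp_unique[OF u _ _ _ _ _ _ y])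
    show "?\<Gamma> \<subseteq> sphere 0 1" by (auto simp: boundary_arc_def norm_circle_pt)
    show "(\<lambda>z. (g z - of_real (ln ?r)) / 2) holomorphic_on ball 0 1"
      by (intro holomorphic_intros g(1)) auto
    show "v x = Re ((g (rot s x) - of_real (ln ?r)) / 2)" if "x \<in> ball 0 1" for x
      using g(2)[of "rot s x"] that by (simp add: v_def)
    show "continuous_on (cball 0 1) v"
    proof -
      have "continuous_on (cball 0 1) (\<lambda>x. ?H (rot s x))"
        by (rule continuous_on_compose2[OF arc_fun_continuous_on continuous_on_rot]) auto
      then show ?thesis unfolding v_def by (intro continuous_intros) (use H0 in auto)
    qed
    show "v x = 0" if x: "x \<in> ?\<Gamma>" for x
    proof -
      obtain t where t: "x = circle_pt t" "\<bar>t - (s + \<theta>)\<bar> < \<epsilon> \<or> \<bar>t - (s - \<theta>)\<bar> < \<epsilon>"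
        using x by (force simp: boundary_arc_def abs_less_iff)
      then have "\<theta> - \<epsilon> \<le> \<bar>t - s\<bar> \<and> \<bar>t - s\<bar> \<le> \<theta> + \<epsilon>" using \<epsilon> by linarith
      then have "cos (\<theta> + \<epsilon>) \<le> cos (t - s) \<and> cos (t - s) \<le> cos (\<theta> - \<epsilon>)"
        using \<epsilon> by (subst cos_between_iff) auto
      then show ?thesis using t(1) by (simp add: v_def rot_circle_pt norm_hpart_arc)
    qed
    show "has_normal_derivative v (1/2) x" if x: "x \<in> sphere 0 1 - closure ?\<Gamma>" for x
    proof -
      define \<tau> where "\<tau> = Arg (rot s x)"
      have \<tau>: "\<bar>\<tau>\<bar> \<le> pi" using Arg_bounded[of "rot s x"] by (auto simp: \<tau>_def)
      have "norm (rot s x) = 1" using x by simp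
      then have rx: "rot s x = cis \<tau>" 
        unfolding \<tau>_def using rcis_cmod_Arg[of "rot s x"] by (simp add: rcis_def)
      then have xp: "x = circle_pt (\<tau> + s)" by (intro rot_inj[of s]) (simp add: rot_circle_pt)
      have "\<not> (\<theta> - \<epsilon> \<le> \<bar>\<tau>\<bar> \<and> \<bar>\<tau>\<bar> \<le> \<theta> + \<epsilon>)"
      proof
        assume "\<theta> - \<epsilon> \<le> \<bar>\<tau>\<bar> \<and> \<bar>\<tau>\<bar> \<le> \<theta> + \<epsilon>"
        then have "\<bar>\<tau> + s - (s + \<theta>)\<bar> \<le> \<epsilon> \<or> \<bar>\<tau> + s - (s - \<theta>)\<bar> \<le> \<epsilon>" by linarith
        then have "x \<in> closure ?\<Gamma>"
          unfolding xp closure_Un using circle_pt_in_closure_arc \<epsilon>(1) by blast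
        then show False using x by simp
      qed
      then have "\<not> (cos (\<theta> + \<epsilon>) \<le> cos \<tau> \<and> cos \<tau> \<le> cos (\<theta> - \<epsilon>))"
        using \<epsilon> \<tau> by (subst cos_between_iff) auto
      then have "cos \<tau> < cos (\<theta> + \<epsilon>) \<or> cos (\<theta> - \<epsilon>) < cos \<tau>" by auto
      from arc_fun_normal_derivative[OF r this]
      have "((\<lambda>t. 1/2 * (ln (norm (?H (cis \<tau> + of_real t * cis \<tau>))) - ln ?r)) has_real_derivative 1/2 * (1 - 0)) (at 0)"
        by (intro DERIV_cmult DERIV_diff DERIV_const)
      then have "((\<lambda>t. v (x + t *\<^sub>R x)) has_real_derivative 1/2) (at 0)"
        by (simp add: v_def rot_add rot_scaleR rx)
      then show ?thesis unfolding has_normal_derivative_def by (rule has_field_derivative_at_within)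
    qed
  qed
  then show ?thesis by (simp add: v_def arc_radius_symmetric)
qed

text \<open>The error splits into three differences of logarithms: \<open>arc_fun\<close> against
  the product of the distances to the arc centres, \<open>sin \<theta>\<close> against
  \<open>\<theta>\<close>, and \<open>sin \<epsilon>\<close> against \<open>\<epsilon>\<close>. Each
  is at most a constant times \<open>\<epsilon>\<close>.\<close>

lemma mixed_bvp_two_arcs_asymptotics:
  assumes d: "d > 2" and c: "c > 0"
    and u: "mixed_bvp_solution (boundary_arc (s + \<theta>) \<epsilon> \<union> boundary_arc (s - \<theta>) \<epsilon>) u"
    and \<theta>: "\<theta> = d * \<epsilon> / 2" and \<epsilon>: "0 < \<epsilon>" "(d + 2) * \<epsilon> \<le> 1" 
    and small: "(1 + 16 / sqrt (c / 2)) * \<epsilon> \<le> c\<^sup>2 / 2"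
    and x: "x \<in> ball 0 1" 
    and far: "c \<le> infdist x (boundary_arc (s + \<theta>) \<epsilon> \<union> boundary_arc (s - \<theta>) \<epsilon>)"
  shows "\<bar>u x - (ln (1 / \<epsilon>) - 1 / (2 * alpha d) + 1/4 * (1 - (norm x)\<^sup>2) +
      1/2 * ln (norm (x - circle_pt (s + \<theta>))) + 1/2 * ln (norm (x - circle_pt (s - \<theta>))))\<bar>
    \<le> ((1 + 16 / sqrt (c / 2)) / c\<^sup>2 + (d / 2 + 1) / 2) * \<epsilon>"
proof -
  let ?\<Gamma> = "boundary_arc (s + \<theta>) \<epsilon> \<union> boundary_arc (s - \<theta>) \<epsilon>"
  define K where "K = 1 + 16 / sqrt (c / 2)"
  define z where "z = rot s x"
  define h where "h = norm (arc_fun (\<theta> - \<epsilon>) (\<theta> + \<epsilon>) z)"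
  define n\<^sub>1 where "n\<^sub>1 = norm (x - circle_pt (s + \<theta>))"
  define n\<^sub>2 where "n\<^sub>2 = norm (x - circle_pt (s - \<theta>))"
  \<comment> \<open>The hypothesis \<open>(d + 2) * \<epsilon> \<le> 1\<close> says
    \<open>\<theta> + \<epsilon> \<le> 1/2\<close>, and \<open>d > 2\<close> keeps the arcs
    disjoint.\<close>
  have \<theta>1: "\<epsilon> < \<theta>" "\<theta> \<le> 1" "\<epsilon> \<le> 1" "\<theta> + \<epsilon> < pi"
  proof -
    have "2 * \<epsilon> < d * \<epsilon>" using d \<epsilon> by simp
    moreover have "d * \<epsilon> + 2 * \<epsilon> \<le> 1" using \<epsilon> by (simp add: distrib_right)
    ultimately show "\<epsilon> < \<theta>" "\<theta> \<le> 1" "\<epsilon> \<le> 1" "\<theta> + \<epsilon> < pi" unfolding \<theta> using \<epsilon>(1) pi_gt3 by linarith+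
  qed
  have dist: "norm (x - circle_pt (s + t)) = norm (1 - z * cis (- t))" for t
  proof -
    have "norm (x - circle_pt (s + t)) = norm (z - cis t)"
      using norm_rot[of s "x - circle_pt (s + t)"] by (simp add: rot_diff rot_circle_pt z_def)
    also have "z - cis t = - (cis t * (1 - z * cis (- t)))"
      by (simp add: right_diff_distrib mult.left_commute[of "cis t"] cis_mult)
    also have "norm \<dots> = norm (1 - z * cis (- t))" by (simp add: norm_mult)
    finally show ?thesis .
  qed
  have in_\<Gamma>: "circle_pt (s + \<theta>) \<in> ?\<Gamma>" "circle_pt (s - \<theta>) \<in> ?\<Gamma>"
    using \<epsilon> by (auto simp: boundary_arc_def)
  have n: "n\<^sub>1 \<ge> c" "n\<^sub>2 \<ge> c"
    using infdist_le[OF in_\<Gamma>(1), of x] infdist_le[OF in_\<Gamma>(2), of x] far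
    by (auto simp: n\<^sub>1_def n\<^sub>2_def dist_norm)
  have n': "n\<^sub>1 = norm (1 - z * cis (- \<theta>))" "n\<^sub>2 = norm (1 - z * cis \<theta>)"
    using dist[of \<theta>] dist[of "- \<theta>"] by (simp_all add: n\<^sub>1_def n\<^sub>2_def)
  have nn: "n\<^sub>1 * n\<^sub>2 \<ge> c\<^sup>2" using n c by (simp add: power2_eq_square mult_mono)
  have nn0: "n\<^sub>1 * n\<^sub>2 > 0" using n c by simp
  have "norm (arc_fun (\<theta> - \<epsilon>) (\<theta> + \<epsilon>) z - (1 - z * cis \<theta>) * (1 - z * cis (- \<theta>))) \<le> K * \<epsilon>"
    unfolding K_def by (rule norm_hpart_minus_product_le) (use x \<epsilon> \<theta>1 c n n' in \<open>auto simp: z_def\<close>)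
  moreover have "norm ((1 - z * cis \<theta>) * (1 - z * cis (- \<theta>))) = n\<^sub>1 * n\<^sub>2"
    by (simp add: n' norm_mult)
  ultimately have "\<bar>h - n\<^sub>1 * n\<^sub>2\<bar> \<le> K * \<epsilon>"
    unfolding h_def using norm_triangle_ineq3 order_trans by metis
  \<comment> \<open>The hypothesis \<open>small\<close> bounds the perturbation by half of
    \<open>c\<^sup>2\<close>, hence by half of \<open>n\<^sub>1 * n\<^sub>2\<close>, as the
    logarithm estimate requires.\<close>
  then have "\<bar>ln h - ln (n\<^sub>1 * n\<^sub>2)\<bar> \<le> 2 * (K * \<epsilon>) / (n\<^sub>1 * n\<^sub>2)"
    using nn nn0 small by (intro abs_ln_diff_le) (auto simp: K_def)
  also have "\<dots> \<le> 2 * (K * \<epsilon>) / c\<^sup>2"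
    using nn nn0 c \<epsilon> by (intro divide_left_mono) (auto simp: K_def add_nonneg_nonneg)
  finally have 1: "\<bar>ln h - (ln n\<^sub>1 + ln n\<^sub>2)\<bar> \<le> 2 * (K / c\<^sup>2 * \<epsilon>)"
    using n c by (simp add: ln_mult)
  have 2: "\<bar>ln (sin \<theta>) - ln \<theta>\<bar> \<le> \<theta>" "\<bar>ln (sin \<epsilon>) - ln \<epsilon>\<bar> \<le> \<epsilon>"
    using \<theta>1 \<epsilon> by (auto intro!: abs_ln_sin_diff_le)
  have s: "sin \<theta> > 0" "sin \<epsilon> > 0" using \<theta>1 \<epsilon> pi_gt3 by (auto intro!: sin_gt_zero)
  have al: "1 / (2 * alpha d) = ln (d / 2) / 2" by (simp add: alpha_eq[OF d])
  have "ln \<theta> = ln (d / 2 * \<epsilon>)" by (simp add: \<theta>)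
  also have "\<dots> = ln (d / 2) + ln \<epsilon>" using d \<epsilon> by (intro ln_mult_pos) auto
  \<comment> \<open>Here the two computations meet: \<open>ln (d / 2)\<close> from
    \<open>alpha\<close> is absorbed exactly by
    \<open>\<theta> = d / 2 * \<epsilon>\<close>.\<close>
  finally have 3: "ln (1 / \<epsilon>) - 1 / (2 * alpha d) = - (ln \<theta> + ln \<epsilon>) / 2"
    unfolding al using \<epsilon> by (simp add: ln_div)
  have "u x = 1/2 * (ln h - (ln (sin \<theta>) + ln (sin \<epsilon>))) + 1/4 * (1 - (norm x)\<^sup>2)"
    using mixed_bvp_two_arcs_explicit[OF u \<epsilon>(1) \<theta>1(1,4), of x] x s
    by (simp add: h_def z_def ln_mult_pos)
  then have "u x - (ln (1 / \<epsilon>) - 1 / (2 * alpha d) + 1/4 * (1 - (norm x)\<^sup>2) + 1/2 * ln n\<^sub>1 + 1/2 * ln n\<^sub>2)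
     = ((ln h - (ln n\<^sub>1 + ln n\<^sub>2)) - (ln (sin \<theta>) - ln \<theta>) - (ln (sin \<epsilon>) - ln \<epsilon>)) / 2"
    unfolding 3 by (simp add: field_simps)
  also have "\<bar>\<dots>\<bar> \<le> (2 * (K / c\<^sup>2 * \<epsilon>) + \<theta> + \<epsilon>) / 2" using 1 2 by (simp add: abs_le_iff)
  also have "\<dots> = (K / c\<^sup>2 + (d / 2 + 1) / 2) * \<epsilon>" by (simp add: \<theta> field_simps)
  finally show ?thesis unfolding K_def n\<^sub>1_def n\<^sub>2_def .
qed

theorem theorem3p5:
  fixes d :: real
  assumes "d > 2"
  shows "\<forall>c>0. \<exists>C. \<exists>\<epsilon>\<^sub>0>0. \<forall>\<epsilon> s\<^sub>1 s\<^sub>2 :: real. \<forall>u :: real^2 \<Rightarrow> real.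
     0 < \<epsilon> \<and> \<epsilon> < \<epsilon>\<^sub>0 \<and> \<bar>s\<^sub>1 - s\<^sub>2\<bar> = d * \<epsilon> \<and>
     mixed_bvp_solution (boundary_arc s\<^sub>1 \<epsilon> \<union> boundary_arc s\<^sub>2 \<epsilon>) u \<longrightarrow>
     (\<forall>x\<in>ball 0 1. infdist x (boundary_arc s\<^sub>1 \<epsilon> \<union> boundary_arc s\<^sub>2 \<epsilon>) \<ge> c \<longrightarrow>
        \<bar>u x - (ln (1 / \<epsilon>) - 1 / (2 * alpha d) + 1 / 4 * (1 - (norm x)\<^sup>2)
               + 1 / 2 * ln (norm (x - circle_pt s\<^sub>1))
               + 1 / 2 * ln (norm (x - circle_pt s\<^sub>2)))\<bar> \<le> C * \<epsilon>)"
proof (intro allI impI)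
  fix c :: real assume c: "c > 0"
  define K where "K = 1 + 16 / sqrt (c / 2)"
  have K: "K > 0" using c by (simp add: K_def add_pos_nonneg)
  define C where "C = K / c\<^sup>2 + (d / 2 + 1) / 2"
  \<comment> \<open>The first bound keeps the angles small, the second gives
    \<open>K * \<epsilon> \<le> c\<^sup>2 / 2\<close>; neither depends on the position of the
    arcs.\<close>
  define \<epsilon>\<^sub>0 where "\<epsilon>\<^sub>0 = min (1 / (d + 2)) (c\<^sup>2 / (2 * K))"
  have "\<epsilon>\<^sub>0 > 0" using assms c K by (simp add: \<epsilon>\<^sub>0_def)
  moreover have "\<bar>u x - (ln (1 / \<epsilon>) - 1 / (2 * alpha d) + 1 / 4 * (1 - (norm x)\<^sup>2)
               + 1 / 2 * ln (norm (x - circle_pt s\<^sub>1))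
               + 1 / 2 * ln (norm (x - circle_pt s\<^sub>2)))\<bar> \<le> C * \<epsilon>"
    if \<epsilon>: "0 < \<epsilon>" "\<epsilon> < \<epsilon>\<^sub>0" and s: "\<bar>s\<^sub>1 - s\<^sub>2\<bar> = d * \<epsilon>"
      and u: "mixed_bvp_solution (boundary_arc s\<^sub>1 \<epsilon> \<union> boundary_arc s\<^sub>2 \<epsilon>) u"
      and x: "x \<in> ball 0 1" "c \<le> infdist x (boundary_arc s\<^sub>1 \<epsilon> \<union> boundary_arc s\<^sub>2 \<epsilon>)"
    for \<epsilon> s\<^sub>1 s\<^sub>2 :: real and u :: "real^2 \<Rightarrow> real" and x
  proof -
    define \<theta> where "\<theta> = d * \<epsilon> / 2"
    define s where "s = (s\<^sub>1 + s\<^sub>2) / 2"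
    have e: "(d + 2) * \<epsilon> \<le> 1" "(1 + 16 / sqrt (c / 2)) * \<epsilon> \<le> c\<^sup>2 / 2"
      using \<epsilon> assms K unfolding \<epsilon>\<^sub>0_def K_def[symmetric] by (auto simp: field_simps)
    note main = mixed_bvp_two_arcs_asymptotics[OF assms c _ \<theta>_def \<epsilon>(1) e x(1), of s u, folded K_def, folded C_def]
    consider "s\<^sub>1 = s + \<theta>" "s\<^sub>2 = s - \<theta>" | "s\<^sub>2 = s + \<theta>" "s\<^sub>1 = s - \<theta>"
    proof (cases "s\<^sub>1 \<ge> s\<^sub>2")
      case True
      then have "s\<^sub>1 - s\<^sub>2 = 2 * \<theta>" using s unfolding \<theta>_def by linarith
      then have "s\<^sub>1 = s + \<theta>" "s\<^sub>2 = s - \<theta>" unfolding s_def by (simp_all add: field_simps)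
      then show ?thesis by (rule that(1))
    next
      case False
      then have "s\<^sub>2 - s\<^sub>1 = 2 * \<theta>" using s unfolding \<theta>_def by linarith
      then have "s\<^sub>2 = s + \<theta>" "s\<^sub>1 = s - \<theta>" unfolding s_def by (simp_all add: field_simps)
      then show ?thesis by (rule that(2))
    qed
    then show ?thesis
    proof cases
      case 1
      then show ?thesis using main u x(2) by simp
    next
      case 2
      then show ?thesis using main u x(2) by (simp add: Un_commute add.commute add.left_commute)
    qed
  qed
  ultimately show "\<exists>C. \<exists>\<epsilon>\<^sub>0>0. \<forall>\<epsilon> s\<^sub>1 s\<^sub>2 :: real. \<forall>u :: real^2 \<Rightarrow> real.
     0 < \<epsilon> \<and> \<epsilon> < \<epsilon>\<^sub>0 \<and> \<bar>s\<^sub>1 - s\<^sub>2\<bar> = d * \<epsilon> \<and>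
     mixed_bvp_solution (boundary_arc s\<^sub>1 \<epsilon> \<union> boundary_arc s\<^sub>2 \<epsilon>) u \<longrightarrow>
     (\<forall>x\<in>ball 0 1. infdist x (boundary_arc s\<^sub>1 \<epsilon> \<union> boundary_arc s\<^sub>2 \<epsilon>) \<ge> c \<longrightarrow>
        \<bar>u x - (ln (1 / \<epsilon>) - 1 / (2 * alpha d) + 1 / 4 * (1 - (norm x)\<^sup>2)
               + 1 / 2 * ln (norm (x - circle_pt s\<^sub>1))
               + 1 / 2 * ln (norm (x - circle_pt s\<^sub>2)))\<bar> \<le> C * \<epsilon>)"
    by blast
qed

end
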